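(* Let $k$ be a field of characteristic different from $7$, with separable closure $k^{\mathrm s}$ and $G_k=\mathrm{Gal}(k^{\mathrm s}/k)$, and let $\psi:G_k\to\mathbf{F}_7^\times$ be a (continuous) homomorphism. If $k\neq\mathbf{F}_2$, then there exists an elliptic curve $E$ over $k$ with a $k$-rational subgroup of order $7$ on which $G_k$ acts via $\psi$. If $k=\mathbf{F}_2$, then there exists an elliptic curve $E$ over $\mathbf{F}_2$ with an $\mathbf{F}_2$-rational subgroup of order $7$ on which $G_{\mathbf{F}_2}$ acts via $\psi$ if and only if $\psi$ is $\omega^{-1}$ or $\omega^{-1}\epsilon$, where $\epsilon$ is the unique character of $G_{\mathbf{F}_2}$ of order $2$ and $\omega$ is the cyclotomic character.
   Context: A $k$-rational subgroup of $E$ is a $G_k$-stable subgroup of $E(k^{\mathrm s})$; $G_k$ acts on such a subgroup $\Psi$ of order $7$ via $\psi$ if $P^\sigma=\psi(\sigma)P$ for all $P\in\Psi$, $\sigma\in G_k$. The cyclotomic character $\omega:G_k\to\mathbf{F}_7^\times$ gives the action of $G_k$ on the $7$th roots of unity in $k^{\mathrm s}$. *)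

theory Defs
  imports
    "HOL-Library.Cardinality"
    "HOL-Analysis.Function_Topology"
    "HOL-Algebra.Multiplicative_Group"
    "HOL-Number_Theory.Residues"
    "HOL-Computational_Algebra.Computational_Algebra"
    "Subresultants.Resultant_Prelim"
begin

section \<open>Separable closures and their Galois groups\<close>

text \<open>An extension of fields is given by two types and an embedding (a \<open>field_hom\<close>) of the
  smaller field into the larger one.\<close>

definition separable_poly :: "'a::field poly \<Rightarrow> bool" where
  "separable_poly p \<longleftrightarrow> coprime p (pderiv p)"

text \<open>Up to a scalar factor, the polynomial \<open>p\<close> below is the minimal polynomial of \<open>x\<close>.\<close>

definition separable_element :: "('k::field \<Rightarrow> 'l::field) \<Rightarrow> 'l \<Rightarrow> bool" where
  "separable_element emb x \<longleftrightarrow>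
     (\<exists>p. irreducible p \<and> separable_poly p \<and> poly (map_poly emb p) x = 0)"

definition separable_closure :: "('k::field \<Rightarrow> 'l::field) \<Rightarrow> bool" where
  "separable_closure emb \<longleftrightarrow>
     field_hom emb \<and>
     (\<forall>x. separable_element emb x) \<and>
     (\<forall>p :: 'l poly. separable_poly p \<and> degree p > 0 \<longrightarrow> (\<exists>x. poly p x = 0))"

definition galois_group :: "('k::field \<Rightarrow> 'l::field) \<Rightarrow> ('l \<Rightarrow> 'l) monoid" where
  "galois_group emb =
     \<lparr>carrier = {\<sigma>. field_hom \<sigma> \<and> bij \<sigma> \<and> (\<forall>x. \<sigma> (emb x) = emb x)},
      monoid.mult = (\<circ>), one = id\<rparr>"

text \<open>The Krull topology is the topology of pointwise convergence for the discrete topology on the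
  extension field: a neighbourhood basis of \<open>\<sigma>\<close> is given by the cosets of the groups
  of automorphisms that fix a finite set \<open>S\<close>, that is, fix the finitely generated subextension
  \<open>k(S)\<close>; see \<open>openin_krull_topology_iff\<close> below.\<close>

definition krull_topology :: "('k::field \<Rightarrow> 'l::field) \<Rightarrow> ('l \<Rightarrow> 'l) topology" where
  "krull_topology emb =
     subtopology (product_topology (\<lambda>_. discrete_topology UNIV) UNIV) (carrier (galois_group emb))"

lemma openin_krull_topology_iff:
  "openin (krull_topology emb) U \<longleftrightarrow>
     U \<subseteq> carrier (galois_group emb) \<and>
     (\<forall>\<sigma>\<in>U. \<exists>S. finite S \<and> {\<tau> \<in> carrier (galois_group emb). \<forall>x\<in>S. \<tau> x = \<sigma> x} \<subseteq> U)"
    (is "?L \<longleftrightarrow> ?R")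
proof
  let ?G = "carrier (galois_group emb)"
  assume ?L
  then obtain T where T: "openin (product_topology (\<lambda>_. discrete_topology UNIV) UNIV) T" "U = T \<inter> ?G"
    by (auto simp: krull_topology_def openin_subtopology)
  have "\<exists>S. finite S \<and> {\<tau> \<in> ?G. \<forall>x\<in>S. \<tau> x = \<sigma> x} \<subseteq> U" if "\<sigma> \<in> U" for \<sigma>
  proof -
    obtain X where X: "\<sigma> \<in> Pi\<^sub>E UNIV X" "finite {i. X i \<noteq> UNIV}" "Pi\<^sub>E UNIV X \<subseteq> T"
      using product_topology_open_contains_basis[OF T(1), of \<sigma>] T(2) \<open>\<sigma> \<in> U\<close> by auto
    have "{\<tau> \<in> ?G. \<forall>x\<in>{i. X i \<noteq> UNIV}. \<tau> x = \<sigma> x} \<subseteq> U"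
    proof clarify
      fix \<tau> assume \<tau>: "\<tau> \<in> ?G" "\<forall>x\<in>{i. X i \<noteq> UNIV}. \<tau> x = \<sigma> x"
      have "\<tau> i \<in> X i" for i
        using X(1) \<tau>(2) by (cases "X i = UNIV") (auto simp: PiE_def Pi_def)
      then show "\<tau> \<in> U" using X(3) \<tau>(1) T(2) by (auto simp: PiE_def)
    qed
    with X(2) show ?thesis by blast
  qed
  with T(2) show ?R by blast
next
  let ?G = "carrier (galois_group emb)"
  assume R: ?R
  define C where "C = (\<lambda>(S, \<sigma>). Pi\<^sub>E UNIV (\<lambda>x :: 'a. if x \<in> S then {\<sigma> x :: 'a} else UNIV))"
  define I where "I = {(S, \<sigma>). finite S \<and> \<sigma> \<in> U \<and> {\<tau> \<in> ?G. \<forall>x\<in>S. \<tau> x = \<sigma> x} \<subseteq> U}"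
  have C: "\<tau> \<in> C (S, \<sigma>) \<longleftrightarrow> (\<forall>x\<in>S. \<tau> x = \<sigma> x)" for \<tau> S \<sigma>
    unfolding C_def by (auto simp: PiE_def Pi_def split: if_splits)
  have "openin (product_topology (\<lambda>_. discrete_topology UNIV) UNIV) (\<Union>(C ` I))"
  proof (intro openin_Union ballI)
    fix T assume "T \<in> C ` I"
    then obtain S \<sigma> where "T = C (S, \<sigma>)" "finite S" by (auto simp: I_def)
    moreover have "finite {i. (if i \<in> S then {\<sigma> i} else UNIV) \<noteq> UNIV}"
      by (rule finite_subset[OF _ \<open>finite S\<close>]) auto
    ultimately show "openin (product_topology (\<lambda>_. discrete_topology UNIV) UNIV) T"
      unfolding C_def using product_topology_basis[of "\<lambda>_. discrete_topology UNIV"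
          "\<lambda>x. if x \<in> S then {\<sigma> x} else UNIV" UNIV] by simp
  qed
  moreover have "U = \<Union>(C ` I) \<inter> ?G"
  proof (intro equalityI subsetI)
    fix \<sigma> assume "\<sigma> \<in> U"
    with R obtain S where "finite S" "{\<tau> \<in> ?G. \<forall>x\<in>S. \<tau> x = \<sigma> x} \<subseteq> U" by blast
    with \<open>\<sigma> \<in> U\<close> have "(S, \<sigma>) \<in> I" by (simp add: I_def)
    moreover have "\<sigma> \<in> C (S, \<sigma>)" by (simp add: C)
    ultimately show "\<sigma> \<in> \<Union>(C ` I) \<inter> ?G" using R \<open>\<sigma> \<in> U\<close> by blast
  next
    fix \<tau> assume "\<tau> \<in> \<Union>(C ` I) \<inter> ?G"
    then obtain S \<sigma> where "(S, \<sigma>) \<in> I" "\<tau> \<in> C (S, \<sigma>)" "\<tau> \<in> ?G" by auto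
    then show "\<tau> \<in> U" unfolding C I_def by blast
  qed
  ultimately show ?L unfolding krull_topology_def openin_subtopology by blast
qed

section \<open>Characters with values in the unit group of the field of seven elements\<close>

abbreviation F7_units :: "int monoid" where
  "F7_units \<equiv> units_of (residue_ring 7)"

text \<open>HOL functions are total, so a character is required to be \<open>undefined\<close> outside the
  Galois group; this makes equality of characters the equality of HOL functions.\<close>

definition character_group :: "('k::field \<Rightarrow> 'l::field) \<Rightarrow> (('l \<Rightarrow> 'l) \<Rightarrow> int) monoid" where
  "character_group emb =
     \<lparr>carrier = {\<psi> \<in> hom (galois_group emb) F7_units.
        continuous_map (krull_topology emb) (discrete_topology (carrier F7_units)) \<psi> \<and>
        \<psi> \<in> extensional (carrier (galois_group emb))},
      monoid.mult = (\<lambda>\<chi> \<psi>. \<lambda>\<sigma>\<in>carrier (galois_group emb). \<chi> \<sigma> \<otimes>\<^bsub>F7_units\<^esub> \<psi> \<sigma>),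
      one = (\<lambda>\<sigma>\<in>carrier (galois_group emb). \<one>\<^bsub>F7_units\<^esub>)\<rparr>"

definition cyclotomic_character :: "('k::field \<Rightarrow> 'l::field) \<Rightarrow> ('l \<Rightarrow> 'l) \<Rightarrow> int" where
  "cyclotomic_character emb =
     (\<lambda>\<sigma>\<in>carrier (galois_group emb).
        THE a. a \<in> carrier F7_units \<and> (\<forall>\<zeta>. \<zeta> ^ 7 = 1 \<longrightarrow> \<sigma> \<zeta> = \<zeta> ^ nat a))"

section \<open>Elliptic curves\<close>

text \<open>\<open>Weierstrass a1 a2 a3 a4 a6\<close> stands for the projective closure of
  $y^2 + a_1 x y + a_3 y = x^3 + a_2 x^2 + a_4 x + a_6$. Base change along an embedding
  \<open>emb\<close> is \<open>map_weierstrass emb\<close>.\<close>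

datatype 'a weierstrass = Weierstrass 'a 'a 'a 'a 'a

fun discriminant :: "'a::field weierstrass \<Rightarrow> 'a" where
  "discriminant (Weierstrass a1 a2 a3 a4 a6) =
     (let b2 = a1^2 + 4 * a2;
          b4 = 2 * a4 + a1 * a3;
          b6 = a3^2 + 4 * a6;
          b8 = a1^2 * a6 + 4 * a2 * a6 - a1 * a3 * a4 + a2 * a3^2 - a4^2
      in - (b2^2 * b8) - 8 * b4^3 - 27 * b6^2 + 9 * b2 * b4 * b6)"

definition elliptic_curve :: "'a::field weierstrass \<Rightarrow> bool" where
  "elliptic_curve E \<longleftrightarrow> discriminant E \<noteq> 0"

text \<open>The point at infinity is the neutral element. A field automorphism \<open>\<sigma>\<close> acts on
  points by \<open>map_point \<sigma>\<close>.\<close>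

datatype 'a point = Infinity | Affine 'a 'a

fun on_curve :: "'a::field weierstrass \<Rightarrow> 'a point \<Rightarrow> bool" where
  "on_curve E Infinity \<longleftrightarrow> True"
| "on_curve (Weierstrass a1 a2 a3 a4 a6) (Affine x y) \<longleftrightarrow>
     y^2 + a1 * x * y + a3 * y = x^3 + a2 * x^2 + a4 * x + a6"

text \<open>The chord-and-tangent law. The inverse of $(x_1, y_1)$ is $(x_1, -y_1 - a_1 x_1 - a_3)$, and
  \<open>l\<close> is the slope of the line through the two points, which is the tangent line if they
  coincide.\<close>

fun point_add :: "'a::field weierstrass \<Rightarrow> 'a point \<Rightarrow> 'a point \<Rightarrow> 'a point" where
  "point_add E Infinity Q = Q"
| "point_add E P Infinity = P"
| "point_add (Weierstrass a1 a2 a3 a4 a6) (Affine x1 y1) (Affine x2 y2) =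
     (if x1 = x2 \<and> y2 = - y1 - a1 * x1 - a3 then Infinity
      else
        let l = (if x1 = x2
                 then (3 * x1^2 + 2 * a2 * x1 + a4 - a1 * y1) / (2 * y1 + a1 * x1 + a3)
                 else (y2 - y1) / (x2 - x1));
            x3 = l^2 + a1 * l - a2 - x1 - x2
        in Affine x3 (- (y1 + l * (x3 - x1)) - a1 * x3 - a3))"

definition curve_group :: "'a::field weierstrass \<Rightarrow> 'a point monoid" where
  "curve_group E = \<lparr>carrier = {P. on_curve E P}, monoid.mult = point_add E, one = Infinity\<rparr>"

section \<open>Rational subgroups\<close>

text \<open>For a curve \<open>E\<close> over \<open>k\<close>, \<open>curve_group (map_weierstrass emb E)\<close> is the group of
  points of \<open>E\<close> over the extension field.\<close>

definition rational_subgroup ::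
    "('k::field \<Rightarrow> 'l::field) \<Rightarrow> 'k weierstrass \<Rightarrow> 'l point set \<Rightarrow> bool" where
  "rational_subgroup emb E \<Psi> \<longleftrightarrow>
     subgroup \<Psi> (curve_group (map_weierstrass emb E)) \<and>
     (\<forall>\<sigma>\<in>carrier (galois_group emb). \<forall>P\<in>\<Psi>. map_point \<sigma> P \<in> \<Psi>)"

definition acts_via ::
    "('k::field \<Rightarrow> 'l::field) \<Rightarrow> 'k weierstrass \<Rightarrow> 'l point set \<Rightarrow> (('l \<Rightarrow> 'l) \<Rightarrow> int) \<Rightarrow> bool" where
  "acts_via emb E \<Psi> \<psi> \<longleftrightarrow>
     (\<forall>\<sigma>\<in>carrier (galois_group emb). \<forall>P\<in>\<Psi>.
        map_point \<sigma> P = P [^]\<^bsub>curve_group (map_weierstrass emb E)\<^esub> \<psi> \<sigma>)"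

end

theory Submission imports Defs
begin

text \<open>The seven points of the subgroup are placed on two lines. If \<open>P\<close> has order 7, then \<open>P\<close>, \<open>2 P\<close> and \<open>4 P\<close>
have sum zero and are collinear. The line is stable under multiplication by the squares \<open>1, 2, 4\<close> of
\<open>F\<^sub>7\<^sup>\<times>\<close>, and multiplication by \<open>- 1\<close> exchanges it with the line through the opposite points. Writing the
two lines as \<open>y = s W\<close> and \<open>y = (1 - s) W\<close> with \<open>W\<close> linear in \<open>x\<close>, and the abscissae of \<open>P\<close>, \<open>2 P\<close>, \<open>4 P\<close> as
\<open>a, b, c\<close>, the curve is \<open>y\<^sup>2 - W y = (x - a) (x - b) (x - c) + (s\<^sup>2 - s) W\<^sup>2\<close>. The conditions that doubling
permutes the three points cyclically have a solution \<open>W\<close> for every triple of distinct \<open>a, b, c\<close>, after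
rescaling them so that \<open>- (a - b) (b - c) (c - a)\<close> times \<open>(2 s - 1)\<^sup>2\<close> is a square. The resulting points form a
copy of \<open>\<int>/7\<close> (\<open>Q_add\<close>), and the curve is smooth unless a binary cubic form in \<open>b - a\<close> and \<open>c - a\<close> vanishes
(\<open>heptagon_discriminant\<close>).

The equation is invariant under cyclic permutations of \<open>a, b, c\<close> and under \<open>s \<mapsto> 1 - s\<close>. So if the Galois
group permutes \<open>a, b, c\<close> according to \<open>\<psi>\<close> modulo \<open>\<plusminus>1\<close> and sends \<open>s\<close> to \<open>s\<close> or \<open>1 - s\<close> according to whether
\<open>\<psi> \<sigma>\<close> is a square, the curve descends to \<open>k\<close> and the Galois group acts on the points via \<open>\<psi>\<close>
(\<open>curve_with_character\<close>). Elements with such a Galois action are sums of conjugates sorted by the value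
of \<open>\<psi>\<close>; they are nondegenerate by the independence of automorphisms (\<open>resolvent\<close>). If \<open>k\<close> has at least
three elements, there is enough freedom to avoid the zeros of the cubic form. This proves existence for
\<open>k \<noteq> F\<^sub>2\<close>. The descent uses that the fixed field of the Galois group is \<open>k\<close> (\<open>fixed_field\<close>), which rests on
the extension of embeddings to automorphisms of the separable closure.

Over \<open>F\<^sub>2\<close> a character is determined by its value at Frobenius. This value is 2 for \<open>\<omega>\<close> and 6 for \<open>\<epsilon>\<close>, so the
claim is that a curve exists if and only if \<open>\<psi>(Frob)\<close> is 4 or 3. For these values the three abscissae are
conjugate in \<open>F\<^sub>8\<close> in the cyclic order for which the cubic form never vanishes. Conversely, the values 1, 2,
5, 6 are excluded by elementary arguments with the addition formulas. The main one is that Frobenius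
cannot act as doubling on the abscissae: the duplication formula would make all of them roots of one
nonzero quadratic polynomial, but six affine points have at least three abscissae
(\<open>not_all_doubled\<close>).\<close>

section \<open>Separable polynomials over a field\<close>

text \<open>A nonzero combination of \<open>p\<close> and \<open>q\<close> of least degree divides both, by division with remainder,
so it is a unit if they are coprime.\<close>

lemma coprime_field_poly_bezout:
  fixes p q :: "'a::field poly"
  assumes "coprime p q"
  obtains u v where "u * p + v * q = 1"
proof -
  define I where "I = {g. g \<noteq> 0 \<and> (\<exists>u v. g = u * p + v * q)}"
  have "p \<noteq> 0 \<or> q \<noteq> 0" using assms by auto
  then have "p \<in> I \<or> q \<in> I"
    unfolding I_def by (metis (mono_tags, lifting) add.left_neutral add.right_neutral lambda_one
        mem_Collect_eq mult_zero_left)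
  then obtain g where g: "g \<in> I" "\<And>h. h \<in> I \<Longrightarrow> degree g \<le> degree h"
    using exists_least_iff[of "\<lambda>n. \<exists>g\<in>I. degree g = n"] by (metis not_less)
  from g(1) obtain u v where uv: "g \<noteq> 0" "g = u * p + v * q" by (auto simp: I_def)
  have "g dvd f" if f: "\<exists>a b. f = a * p + b * q" for f
  proof -
    from f obtain a b where "f = a * p + b * q" by blast
    then have "f mod g = (a - f div g * u) * p + (b - f div g * v) * q"
      using uv(2) by (simp add: minus_div_mult_eq_mod[symmetric] algebra_simps)
    then have "f mod g \<in> I \<or> f mod g = 0" unfolding I_def by blast
    then show ?thesis using g(2)[of "f mod g"] degree_mod_less[OF uv(1), of f] by fastforce
  qed
  from this[of p] this[of q] have "g dvd p" "g dvd q"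
    by (metis add.right_neutral lambda_one mult_zero_left, metis add.left_neutral lambda_one mult_zero_left)
  with assms have "g dvd 1" by (simp add: coprime_def)
  then obtain h where "1 = g * h" by (elim dvdE)
  then have "(h * u) * p + (h * v) * q = 1" using uv(2) by (simp add: algebra_simps)
  then show ?thesis using that by blast
qed

text \<open>Unlike coprimality, a Bezout identity is visibly preserved by ring homomorphisms, and it passes to
divisors by expanding the derivative of a product.\<close>

lemma separable_poly_iff_bezout:
  fixes p :: "'a::field poly"
  shows "separable_poly p \<longleftrightarrow> (\<exists>u v. u * p + v * pderiv p = 1)"
proof
  show "separable_poly p \<Longrightarrow> \<exists>u v. u * p + v * pderiv p = 1"
    unfolding separable_poly_def by (meson coprime_field_poly_bezout)
  show "\<exists>u v. u * p + v * pderiv p = 1 \<Longrightarrow> separable_poly p"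
    unfolding separable_poly_def by (metis coprimeI dvd_add dvd_mult)
qed

lemma separable_poly_dvd:
  assumes "separable_poly p" "m dvd p"
  shows "separable_poly m"
proof -
  from assms(2) obtain q where q: "p = m * q" by (elim dvdE)
  from assms(1) obtain u v where "u * p + v * pderiv p = 1" by (auto simp: separable_poly_iff_bezout)
  then have "(u * q + v * pderiv q) * m + (v * q) * pderiv m = 1"
    by (simp add: q pderiv_mult algebra_simps)
  then show ?thesis unfolding separable_poly_iff_bezout by blast
qed

lemma separable_poly_map_poly:
  assumes "field_hom h" "separable_poly p"
  shows "separable_poly (map_poly h p)"
proof -
  interpret h: field_hom h by fact
  interpret hp: map_poly_inj_idom_hom h ..
  from assms(2) obtain u v where "u * p + v * pderiv p = 1" by (auto simp: separable_poly_iff_bezout)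
  then have "map_poly h (u * p + v * pderiv p) = map_poly h 1" by simp
  then have "map_poly h u * map_poly h p + map_poly h v * pderiv (map_poly h p) = 1"
    by (simp add: hom_distribs)
  then show ?thesis unfolding separable_poly_iff_bezout by blast
qed

lemma separable_poly_no_double_root:
  assumes "separable_poly p" "p = [:-x, 1:] * q"
  shows "poly q x \<noteq> 0"
proof
  assume x: "poly q x = 0"
  from assms(1) obtain u v where "u * p + v * pderiv p = 1" by (auto simp: separable_poly_iff_bezout)
  then have "poly (u * p + v * pderiv p) x = 1" by simp
  then show False using x unfolding assms(2) pderiv_mult by (simp add: pderiv_pCons del: mult_pCons_left)
qed

section \<open>Automorphisms of a separable closure\<close>

text \<open>The graph of a homomorphism over \<open>k\<close> from a subring of \<open>k\<^sup>s\<close> that contains \<open>k\<close> into \<open>k\<^sup>s\<close>. Working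
with graphs makes unions of chains trivial and avoids types for intermediate fields. The last clause
says that the relation is single-valued, because the relation is closed under subtraction.\<close>

definition partial_hom :: "('k::field \<Rightarrow> 'l::field) \<Rightarrow> ('l \<times> 'l) set \<Rightarrow> bool" where
  "partial_hom emb \<Gamma> \<longleftrightarrow>
     (\<forall>c. (emb c, emb c) \<in> \<Gamma>) \<and>
     (\<forall>x y x' y'. (x, y) \<in> \<Gamma> \<longrightarrow> (x', y') \<in> \<Gamma> \<longrightarrow> (x + x', y + y') \<in> \<Gamma> \<and> (x * x', y * y') \<in> \<Gamma>) \<and>
     (\<forall>y. (0, y) \<in> \<Gamma> \<longrightarrow> y = 0)"

text \<open>If \<open>\<Gamma>\<close> is the graph of \<open>\<phi>\<close>, this says that \<open>q\<close> arises from \<open>p\<close> by applying \<open>\<phi>\<close> to the coefficients.\<close>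

definition poly_rel :: "('l::zero \<times> 'l) set \<Rightarrow> 'l poly \<Rightarrow> 'l poly \<Rightarrow> bool" where
  "poly_rel \<Gamma> p q \<longleftrightarrow> (\<forall>i. (coeff p i, coeff q i) \<in> \<Gamma>)"

locale separably_closed_extension =
  fixes emb :: "'k::field \<Rightarrow> 'l::field"
  assumes closure: "separable_closure emb"
begin

sublocale emb: field_hom emb using closure by (simp add: separable_closure_def)
sublocale emb_poly: map_poly_inj_idom_hom emb ..

lemma separable_over_base:
  obtains p where "irreducible p" "separable_poly p" "poly (map_poly emb p) x = 0"
  using closure unfolding separable_closure_def separable_element_def by blast

lemma separable_poly_has_root:
  fixes p :: "'l poly"
  assumes "separable_poly p" "degree p > 0"
  obtains x where "poly p x = 0"
  using closure assms unfolding separable_closure_def by blast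

context
  fixes \<Gamma> :: "('l \<times> 'l) set"
  assumes \<Gamma>: "partial_hom emb \<Gamma>"
begin

lemma partial_hom_emb: "(emb c, emb c) \<in> \<Gamma>"
  using \<Gamma> by (simp add: partial_hom_def)

lemma partial_hom_add: "(x, y) \<in> \<Gamma> \<Longrightarrow> (x', y') \<in> \<Gamma> \<Longrightarrow> (x + x', y + y') \<in> \<Gamma>"
  using \<Gamma> by (simp add: partial_hom_def)

lemma partial_hom_mult: "(x, y) \<in> \<Gamma> \<Longrightarrow> (x', y') \<in> \<Gamma> \<Longrightarrow> (x * x', y * y') \<in> \<Gamma>"
  using \<Gamma> by (simp add: partial_hom_def)

lemma partial_hom_zero: "(0, y) \<in> \<Gamma> \<Longrightarrow> y = 0"
  using \<Gamma> by (simp add: partial_hom_def)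

lemma partial_hom_uminus: "(x, y) \<in> \<Gamma> \<Longrightarrow> (- x, - y) \<in> \<Gamma>"
  using partial_hom_mult[OF partial_hom_emb[of "- 1"], of x y] by (simp add: hom_distribs)

lemma partial_hom_diff: "(x, y) \<in> \<Gamma> \<Longrightarrow> (x', y') \<in> \<Gamma> \<Longrightarrow> (x - x', y - y') \<in> \<Gamma>"
  using partial_hom_add[OF _ partial_hom_uminus, of x y x' y'] by simp

lemma partial_hom_functional: "(x, y) \<in> \<Gamma> \<Longrightarrow> (x, y') \<in> \<Gamma> \<Longrightarrow> y = y'"
  using partial_hom_diff[of x y x y'] partial_hom_zero[of "y - y'"] by simp

lemma partial_hom_sum:
  "(\<And>i. i \<in> A \<Longrightarrow> (f i, g i) \<in> \<Gamma>) \<Longrightarrow> (sum f A, sum g A) \<in> \<Gamma>"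
proof (induction A rule: infinite_finite_induct)
  case (insert i A)
  then show ?case by (simp add: partial_hom_add)
qed (use partial_hom_emb[of 0] in simp_all)

lemma poly_rel_emb: "poly_rel \<Gamma> (map_poly emb p) (map_poly emb p)"
  using partial_hom_emb by (simp add: poly_rel_def)

lemma poly_rel_pCons:
  "poly_rel \<Gamma> (pCons a p) (pCons b q) \<longleftrightarrow> (a, b) \<in> \<Gamma> \<and> poly_rel \<Gamma> p q"
  unfolding poly_rel_def by (auto simp: coeff_pCons split: nat.splits)

lemma poly_rel_add: "poly_rel \<Gamma> p q \<Longrightarrow> poly_rel \<Gamma> p' q' \<Longrightarrow> poly_rel \<Gamma> (p + p') (q + q')"
  by (simp add: poly_rel_def partial_hom_add)

lemma poly_rel_diff: "poly_rel \<Gamma> p q \<Longrightarrow> poly_rel \<Gamma> p' q' \<Longrightarrow> poly_rel \<Gamma> (p - p') (q - q')"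
  by (simp add: poly_rel_def partial_hom_diff)

lemma poly_rel_mult: "poly_rel \<Gamma> p q \<Longrightarrow> poly_rel \<Gamma> p' q' \<Longrightarrow> poly_rel \<Gamma> (p * p') (q * q')"
  unfolding poly_rel_def coeff_mult by (auto intro!: partial_hom_sum partial_hom_mult)

lemma poly_rel_monom: "(a, b) \<in> \<Gamma> \<Longrightarrow> poly_rel \<Gamma> (monom a n) (monom b n)"
  using partial_hom_emb[of 0] by (simp add: poly_rel_def)

lemma poly_rel_zero: "poly_rel \<Gamma> 0 q \<Longrightarrow> q = 0"
  by (simp add: poly_rel_def partial_hom_zero poly_eq_iff)

lemma poly_rel_poly:
  "poly_rel \<Gamma> p q \<Longrightarrow> (x, y) \<in> \<Gamma> \<Longrightarrow> (poly p x, poly q y) \<in> \<Gamma>"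
proof (induction p arbitrary: q rule: pCons_induct)
  case 0
  then show ?case using poly_rel_zero partial_hom_emb[of 0] by fastforce
next
  case (pCons a p)
  obtain b q' where "q = pCons b q'" by (cases q)
  with pCons show ?case by (simp add: poly_rel_pCons partial_hom_add partial_hom_mult)
qed

text \<open>A subring of an algebraic extension that contains the base field is a field: if
\<open>a + x q(x) = 0\<close> with \<open>a \<noteq> 0\<close>, the inverse of \<open>x\<close> is a polynomial in \<open>x\<close>.\<close>

lemma partial_hom_inverse:
  assumes "(x, y) \<in> \<Gamma>" "x \<noteq> 0"
  obtains y' where "(inverse x, y') \<in> \<Gamma>"
proof -
  obtain p where p: "irreducible p" "poly (map_poly emb p) x = 0"
    using separable_over_base by metis
  obtain a q where pq: "p = pCons a q" by (cases p)
  have a: "a \<noteq> 0"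
  proof
    assume "a = 0"
    then have pq': "p = [:0, 1:] * q" using pq by simp
    with p(1) have "[:0, 1::'k:] dvd 1 \<or> q dvd 1" by (metis irreducibleD)
    then have "q dvd 1" by (auto simp: poly_dvd_1)
    then obtain c where "q = [:c:]" "c \<noteq> 0" by (auto simp: poly_dvd_1 elim!: degree_eq_zeroE)
    then show False using p(2) assms(2) pq' by (simp add: hom_distribs)
  qed
  define z where "z = - (emb (inverse a) * poly (map_poly emb q) x)"
  have "emb a + x * poly (map_poly emb q) x = 0" using p(2) pq by (simp add: hom_distribs)
  then have "x * poly (map_poly emb q) x = - emb a" by (simp add: add_eq_0_iff)
  moreover have "x * z = - (inverse (emb a) * (x * poly (map_poly emb q) x))"
    by (simp add: z_def hom_distribs)
  ultimately have "x * z = 1" using a by simp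
  then have "inverse x = z" by (simp add: inverse_unique)
  moreover have "(z, - (emb (inverse a) * poly (map_poly emb q) y)) \<in> \<Gamma>"
    unfolding z_def
    by (intro partial_hom_uminus partial_hom_mult partial_hom_emb poly_rel_poly poly_rel_emb assms)
  ultimately show ?thesis using that by simp
qed

text \<open>Up to a scalar, \<open>m\<close> is the minimal polynomial of \<open>z\<close> over the domain of \<open>\<Gamma>\<close>, and \<open>m'\<close> is its image.\<close>

definition minimal_poly_rel :: "'l \<Rightarrow> 'l poly \<Rightarrow> 'l poly \<Rightarrow> bool" where
  "minimal_poly_rel z m m' \<longleftrightarrow> poly_rel \<Gamma> m m' \<and> m \<noteq> 0 \<and> poly m z = 0 \<and>
     (\<forall>p p'. poly_rel \<Gamma> p p' \<and> p \<noteq> 0 \<and> poly p z = 0 \<longrightarrow> degree m \<le> degree p)"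

lemma minimal_poly_rel_exists: obtains m m' where "minimal_poly_rel z m m'"
proof -
  obtain p where p: "irreducible p" "poly (map_poly emb p) z = 0"
    using separable_over_base by metis
  then have "map_poly emb p \<noteq> 0" by auto
  then have "\<exists>n p p'. n = degree p \<and> poly_rel \<Gamma> p p' \<and> p \<noteq> 0 \<and> poly p z = 0"
    using p poly_rel_emb by blast
  then obtain m m' where "poly_rel \<Gamma> m m'" "m \<noteq> 0" "poly m z = 0"
     "\<forall>k<degree m. \<not> (\<exists>p p'. k = degree p \<and> poly_rel \<Gamma> p p' \<and> p \<noteq> 0 \<and> poly p z = 0)"
    unfolding exists_least_iff[of "\<lambda>n. \<exists>p p'. n = degree p \<and> poly_rel \<Gamma> p p' \<and> p \<noteq> 0 \<and> poly p z = 0"]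
    by blast
  then have "minimal_poly_rel z m m'" unfolding minimal_poly_rel_def by (metis not_less)
  then show ?thesis using that by blast
qed

context
  fixes z :: 'l and m m' :: "'l poly"
  assumes m: "minimal_poly_rel z m m'"
begin

text \<open>Polynomial division by \<open>m\<close>, carried out simultaneously on both sides of \<open>\<Gamma>\<close>.\<close>

lemma poly_rel_division:
  assumes "poly_rel \<Gamma> p p'" "poly p z = 0"
  shows "\<exists>q q'. poly_rel \<Gamma> q q' \<and> p = q * m \<and> p' = q' * m'"
  using assms
proof (induction "degree p" arbitrary: p p' rule: less_induct)
  case less
  note m' = m[unfolded minimal_poly_rel_def]
  show ?case
  proof (cases "p = 0")
    case True
    then show ?thesis using less.prems poly_rel_zero partial_hom_emb[of 0]
      by (intro exI[of _ 0]) (auto simp: poly_rel_def)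
  next
    case False
    define n where "n = degree p - degree m"
    have deg: "degree m \<le> degree p" using less.prems False m' by blast
    obtain d where d: "(inverse (lead_coeff m), d) \<in> \<Gamma>"
      using partial_hom_inverse[of "lead_coeff m" "coeff m' (degree m)"] m'
      by (auto simp: poly_rel_def)
    define c where "c = lead_coeff p * inverse (lead_coeff m)"
    define c' where "c' = coeff p' (degree p) * d"
    have c: "(c, c') \<in> \<Gamma>" unfolding c_def c'_def
      using less.prems d by (auto simp: poly_rel_def intro!: partial_hom_mult)
    define r where "r = p - monom c n * m"
    define r' where "r' = p' - monom c' n * m'"
    have r: "poly_rel \<Gamma> r r'" unfolding r_def r'_def
      using less.prems m' c by (intro poly_rel_diff poly_rel_mult poly_rel_monom) auto
    have rz: "poly r z = 0" using less.prems m' by (simp add: r_def)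
    have "degree (monom c n * m) \<le> degree p"
      using degree_mult_le[of "monom c n" m] degree_monom_le[of c n] deg by (simp add: n_def)
    then have "degree r \<le> degree p" unfolding r_def by (intro degree_diff_le) auto
    moreover have "coeff r (degree p) = 0"
      using deg m' by (simp add: r_def n_def coeff_monom_mult c_def)
    ultimately have r0: "r = 0 \<or> degree r < degree p"
      by (metis False eq_zero_or_degree_less le_degree leading_coeff_0_iff le_neq_implies_less)
    have "\<exists>q q'. poly_rel \<Gamma> q q' \<and> r = q * m \<and> r' = q' * m'"
    proof (cases "r = 0")
      case True
      then show ?thesis using r poly_rel_zero partial_hom_emb[of 0]
        by (intro exI[of _ 0]) (auto simp: poly_rel_def)
    qed (use less.hyps r rz r0 in blast)
    then obtain q q' where q: "poly_rel \<Gamma> q q'" "r = q * m" "r' = q' * m'" by blast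
    have "p = (q + monom c n) * m" "p' = (q' + monom c' n) * m'"
      using q by (simp_all add: r_def r'_def algebra_simps)
    then show ?thesis using poly_rel_add[OF q(1) poly_rel_monom[OF c]] by blast
  qed
qed

text \<open>The extension sends \<open>p(z)\<close> to \<open>q(w)\<close>, where \<open>q\<close> is the image of \<open>p\<close>. It is well defined because a
polynomial that vanishes at \<open>z\<close> is a multiple of \<open>m\<close>, so that its image vanishes at \<open>w\<close>.\<close>

lemma partial_hom_extend:
  assumes w: "poly m' w = 0"
  obtains \<Gamma>' where "partial_hom emb \<Gamma>'" "\<Gamma> \<subseteq> \<Gamma>'" "(z, w) \<in> \<Gamma>'"
proof -
  define \<Gamma>' where "\<Gamma>' = {(poly p z, poly q w) | p q. poly_rel \<Gamma> p q}"
  have I: "poly_rel \<Gamma> p q \<Longrightarrow> x = poly p z \<Longrightarrow> y = poly q w \<Longrightarrow> (x, y) \<in> \<Gamma>'" for p q x y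
    unfolding \<Gamma>'_def by blast
  have 0: "(0, 0) \<in> \<Gamma>" "(1, 1) \<in> \<Gamma>" using partial_hom_emb[of 0] partial_hom_emb[of 1] by auto
  then have rel0: "poly_rel \<Gamma> 0 0" by (simp add: poly_rel_def)
  have sub: "\<Gamma> \<subseteq> \<Gamma>'"
  proof clarify
    fix x y assume "(x, y) \<in> \<Gamma>"
    then show "(x, y) \<in> \<Gamma>'"
      using rel0 by (intro I[of "[:x:]" "[:y:]"]) (simp_all add: poly_rel_pCons)
  qed
  moreover have "(z, w) \<in> \<Gamma>'"
    using rel0 0 by (intro I[of "[:0,1:]" "[:0,1:]"]) (simp_all add: poly_rel_pCons)
  moreover have "partial_hom emb \<Gamma>'"
    unfolding partial_hom_def
  proof (intro conjI allI impI)
    show "(emb c, emb c) \<in> \<Gamma>'" for c using sub partial_hom_emb by blast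
  next
    fix x y x' y' assume "(x, y) \<in> \<Gamma>'" "(x', y') \<in> \<Gamma>'"
    then obtain p q p' q' where *: "poly_rel \<Gamma> p q" "x = poly p z" "y = poly q w"
       "poly_rel \<Gamma> p' q'" "x' = poly p' z" "y' = poly q' w" unfolding \<Gamma>'_def by blast
    show "(x + x', y + y') \<in> \<Gamma>'"
      using * by (intro I[of "p + p'" "q + q'"]) (simp_all add: poly_rel_add)
    show "(x * x', y * y') \<in> \<Gamma>'"
      using * by (intro I[of "p * p'" "q * q'"]) (simp_all add: poly_rel_mult)
  next
    fix y assume "(0, y) \<in> \<Gamma>'"
    then obtain p q where "poly_rel \<Gamma> p q" "poly p z = 0" "y = poly q w" unfolding \<Gamma>'_def by force
    with poly_rel_division[of p q] w show "y = 0" by auto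
  qed
  ultimately show ?thesis using that by blast
qed

text \<open>Both \<open>m\<close> and \<open>m'\<close> divide the separable polynomial of \<open>z\<close> over \<open>k\<close>, which \<open>\<Gamma>\<close> leaves unchanged. Hence
\<open>m'\<close> has a root, and \<open>\<Gamma>\<close> can be extended to \<open>z\<close>.\<close>

lemma minimal_poly_rel_separable: "separable_poly m" "separable_poly m'" "degree m > 0" "degree m' > 0"
proof -
  note m' = m[unfolded minimal_poly_rel_def]
  obtain p where p: "irreducible p" "separable_poly p" "poly (map_poly emb p) z = 0"
    using separable_over_base by metis
  with poly_rel_division[OF poly_rel_emb, of p] have "m dvd map_poly emb p" "m' dvd map_poly emb p"
    by (metis dvd_triv_right)+
  moreover have "separable_poly (map_poly emb p)"
    using p(2) emb.field_hom_axioms by (rule separable_poly_map_poly[rotated])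
  ultimately show "separable_poly m" "separable_poly m'" by (auto intro: separable_poly_dvd)
  show "degree m > 0" using m' by (metis degree_eq_zeroE gr0I pCons_0_0 poly_const_conv)
  obtain d where d: "(inverse (lead_coeff m), d) \<in> \<Gamma>"
    using partial_hom_inverse[of "lead_coeff m" "coeff m' (degree m)"] m'
    by (auto simp: poly_rel_def)
  have "coeff m' (degree m) \<noteq> 0"
  proof
    assume "coeff m' (degree m) = 0"
    then have "(lead_coeff m, 0) \<in> \<Gamma>" using m' by (metis poly_rel_def)
    from partial_hom_mult[OF this d] have "(emb 1, 0) \<in> \<Gamma>" using m' by simp
    with partial_hom_emb[of 1] show False by (metis partial_hom_functional emb.hom_one zero_neq_one)
  qed
  with \<open>degree m > 0\<close> show "degree m' > 0" by (meson le_degree less_le_trans)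
qed

end

end

text \<open>An endomorphism over \<open>k\<close> is injective and permutes the finitely many roots of each polynomial over \<open>k\<close>,
so it is surjective.\<close>

lemma endomorphism_in_galois_group:
  assumes "field_hom \<sigma>" and emb: "\<And>c. \<sigma> (emb c) = emb c"
  shows "\<sigma> \<in> carrier (galois_group emb)"
proof -
  interpret \<sigma>: field_hom \<sigma> by fact
  have "surj \<sigma>"
  proof -
    have "y \<in> range \<sigma>" for y
    proof -
      obtain p where p: "irreducible p" "poly (map_poly emb p) y = 0"
        using separable_over_base by metis
      define R where "R = {x. poly (map_poly emb p) x = 0}"
      have "map_poly emb p \<noteq> 0" using p(1) by auto
      then have "finite R" unfolding R_def by (rule poly_roots_finite)
      moreover have "\<sigma> ` R \<subseteq> R"
      proof clarify
        fix x assume "x \<in> R"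
        have "poly (map_poly emb p) (\<sigma> x) = poly (map_poly \<sigma> (map_poly emb p)) (\<sigma> x)"
          by (simp add: map_poly_map_poly o_def emb)
        also have "\<dots> = \<sigma> (poly (map_poly emb p) x)" by simp
        finally show "\<sigma> x \<in> R" using \<open>x \<in> R\<close> by (simp add: R_def)
      qed
      moreover have "inj_on \<sigma> R" by (rule inj_onI) simp
      ultimately have "\<sigma> ` R = R" by (simp add: endo_inj_surj)
      then show ?thesis using p(2) by (auto simp: R_def)
    qed
    then show ?thesis by blast
  qed
  moreover have "inj \<sigma>" by (rule injI) simp
  ultimately show ?thesis
    using \<open>field_hom \<sigma>\<close> emb by (simp add: galois_group_def bij_def)
qed

text \<open>By Zorn's lemma there is a maximal extension; it is defined everywhere, because otherwise the minimal
polynomial of a missing element would allow one more step.\<close>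

lemma partial_hom_extend_to_automorphism:
  assumes \<Gamma>0: "partial_hom emb \<Gamma>0"
  obtains \<sigma> where "\<sigma> \<in> carrier (galois_group emb)" "\<And>x y. (x, y) \<in> \<Gamma>0 \<Longrightarrow> \<sigma> x = y"
proof -
  define A where "A = {\<Gamma>. partial_hom emb \<Gamma> \<and> \<Gamma>0 \<subseteq> \<Gamma>}"
  have "\<exists>M\<in>A. \<forall>X\<in>A. M \<subseteq> X \<longrightarrow> X = M"
  proof (rule subset_Zorn_nonempty)
    show "A \<noteq> {}" using \<Gamma>0 by (auto simp: A_def)
  next
    fix C assume C: "C \<noteq> {}" "subset.chain A C"
    then have CA: "\<And>X. X \<in> C \<Longrightarrow> partial_hom emb X \<and> \<Gamma>0 \<subseteq> X" by (auto simp: subset_chain_def A_def)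
    have chain: "X \<subseteq> Y \<or> Y \<subseteq> X" if "X \<in> C" "Y \<in> C" for X Y
      using C(2) that by (auto simp: subset_chain_def)
    obtain X0 where "X0 \<in> C" using C(1) by blast
    then have "\<Gamma>0 \<subseteq> \<Union>C" using CA by blast
    moreover have "partial_hom emb (\<Union>C)"
      unfolding partial_hom_def
    proof (intro conjI allI impI)
      show "(emb c, emb c) \<in> \<Union>C" for c using \<open>X0 \<in> C\<close> CA partial_hom_emb by blast
    next
      fix x y x' y' assume "(x, y) \<in> \<Union>C" "(x', y') \<in> \<Union>C"
      then obtain X where X: "X \<in> C" "(x, y) \<in> X" "(x', y') \<in> X" using chain by blast
      then show "(x + x', y + y') \<in> \<Union>C" "(x * x', y * y') \<in> \<Union>C"
        using CA partial_hom_add partial_hom_mult by blast+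
    next
      fix y assume "(0, y) \<in> \<Union>C"
      then show "y = 0" using CA partial_hom_zero by blast
    qed
    ultimately show "\<Union>C \<in> A" by (simp add: A_def)
  qed
  then obtain \<Gamma> where \<Gamma>: "partial_hom emb \<Gamma>" "\<Gamma>0 \<subseteq> \<Gamma>"
    and max: "\<And>\<Gamma>'. partial_hom emb \<Gamma>' \<Longrightarrow> \<Gamma> \<subseteq> \<Gamma>' \<Longrightarrow> \<Gamma>' = \<Gamma>"
    unfolding A_def by (smt (verit, ccfv_threshold) mem_Collect_eq order_trans)
  have total: "\<exists>y. (x, y) \<in> \<Gamma>" for x
  proof -
    obtain m m' where m: "minimal_poly_rel \<Gamma> x m m'" using minimal_poly_rel_exists[OF \<Gamma>(1)] by metis
    obtain w where "poly m' w = 0"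
      using separable_poly_has_root minimal_poly_rel_separable[OF \<Gamma>(1) m] by metis
    then show ?thesis using partial_hom_extend[OF \<Gamma>(1) m] max by (metis)
  qed
  define \<sigma> where "\<sigma> x = (THE y. (x, y) \<in> \<Gamma>)" for x
  have \<sigma>: "\<sigma> x = y" if "(x, y) \<in> \<Gamma>" for x y
    unfolding \<sigma>_def using that partial_hom_functional[OF \<Gamma>(1)] by blast
  have \<sigma>': "(x, \<sigma> x) \<in> \<Gamma>" for x using total[of x] \<sigma> by blast
  have emb: "\<sigma> (emb c) = emb c" for c by (intro \<sigma> partial_hom_emb \<Gamma>(1))
  have "field_hom \<sigma>"
  proof
    show "\<sigma> (x + y) = \<sigma> x + \<sigma> y" "\<sigma> (x * y) = \<sigma> x * \<sigma> y" for x y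
      by (intro \<sigma> partial_hom_add partial_hom_mult \<sigma>' \<Gamma>(1))+
    show "\<sigma> 0 = 0" "\<sigma> 1 = 1" using emb[of 0] emb[of 1] by auto
  qed
  then have "\<sigma> \<in> carrier (galois_group emb)" using emb by (rule endomorphism_in_galois_group)
  then show ?thesis using that \<sigma> \<Gamma>(2) by blast
qed

text \<open>An element outside \<open>k\<close> has a second conjugate \<open>w\<close> by separability, and the \<open>k\<close>-homomorphism that
sends it to \<open>w\<close> extends to an automorphism.\<close>

lemma fixed_field:
  assumes "\<And>\<sigma>. \<sigma> \<in> carrier (galois_group emb) \<Longrightarrow> \<sigma> z = z"
  shows "z \<in> range emb"
proof -
  define \<Gamma> where "\<Gamma> = {(emb c, emb c) | c. True}"
  have \<Gamma>: "partial_hom emb \<Gamma>"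
    unfolding partial_hom_def \<Gamma>_def by (auto simp: hom_distribs[symmetric] intro: exI[of _ "_ + _"])
  obtain m m' where m: "minimal_poly_rel \<Gamma> z m m'" using minimal_poly_rel_exists[OF \<Gamma>] by metis
  then have mm: "poly_rel \<Gamma> m m'" by (simp add: minimal_poly_rel_def[OF \<Gamma>])
  have "coeff m' i = coeff m i" for i using mm by (auto simp: poly_rel_def \<Gamma>_def dest: spec[of _ i])
  then have "m' = m" by (rule poly_eqI)
  have mz: "poly m z = 0" using m by (simp add: minimal_poly_rel_def[OF \<Gamma>])
  note sep = minimal_poly_rel_separable[OF \<Gamma> m]
  obtain r where r: "m = [:- z, 1:] * r" using mz by (metis dvdE poly_eq_0_iff_dvd)
  have "r \<noteq> 0" using r sep(3) by auto
  show ?thesis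
  proof (cases "degree r = 0")
    case False
    have "separable_poly r" using sep(1) r by (metis separable_poly_dvd dvd_triv_right)
    then obtain w where w: "poly r w = 0" using separable_poly_has_root[of r] False by blast
    then have "w \<noteq> z" using separable_poly_no_double_root[OF sep(1) r] by blast
    have "poly m' w = 0" using w by (simp add: \<open>m' = m\<close> r del: mult_pCons_left)
    then obtain \<Gamma>' where "partial_hom emb \<Gamma>'" "(z, w) \<in> \<Gamma>'"
      using partial_hom_extend[OF \<Gamma> m] by metis
    then show ?thesis using partial_hom_extend_to_automorphism[of \<Gamma>'] assms \<open>w \<noteq> z\<close> by metis
  next
    case True
    then obtain c where c: "r = [:c:]" by (elim degree_eq_zeroE)
    then have "coeff m 1 = c" "coeff m 0 = - z * c" "c \<noteq> 0" using r \<open>r \<noteq> 0\<close> by auto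
    moreover have "coeff m i \<in> range emb" for i
      using mm by (auto simp: poly_rel_def \<Gamma>_def)
    ultimately obtain a b where ab: "emb a = c" "emb b = - z * c" by (metis imageE)
    then have "z = emb (- b / a)" using \<open>c \<noteq> 0\<close> by (simp add: hom_distribs field_simps)
    then show ?thesis by blast
  qed
qed

end

section \<open>Characters and their resolvents\<close>

text \<open>Dedekind's lemma for characters of a submonoid \<open>M\<close>. If the relation is multiplied by \<open>g z\<close> and
subtracted from the relation at \<open>z x\<close>, the term of \<open>g\<close> cancels, and the induction hypothesis applies
to the coefficients \<open>c f (f z - g z)\<close>.\<close>

lemma dedekind_independence:
  fixes F :: "('a::monoid_mult \<Rightarrow> 'b::field) set"
  assumes "finite F"
    and "1 \<in> M" "\<And>x y. x \<in> M \<Longrightarrow> y \<in> M \<Longrightarrow> x * y \<in> M"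
    and "\<And>f. f \<in> F \<Longrightarrow> f 1 = 1"
    and "\<And>f x y. f \<in> F \<Longrightarrow> x \<in> M \<Longrightarrow> y \<in> M \<Longrightarrow> f (x * y) = f x * f y"
    and "\<And>f g. f \<in> F \<Longrightarrow> g \<in> F \<Longrightarrow> f \<noteq> g \<Longrightarrow> \<exists>x\<in>M. f x \<noteq> g x"
    and "\<And>x. x \<in> M \<Longrightarrow> (\<Sum>f\<in>F. c f * f x) = 0"
    and "f \<in> F"
  shows "c f = 0"
  using assms(1,4-)
proof (induction F arbitrary: c f rule: finite_induct)
  case (insert g F)
  have "c f = 0" if f: "f \<in> F" for f
  proof -
    obtain z where z: "z \<in> M" "f z \<noteq> g z" using insert.prems(3)[of f g] insert.hyps(2) f by auto
    have "(\<Sum>h\<in>F. (c h * (h z - g z)) * h x) = 0" if x: "x \<in> M" for x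
    proof -
      have "(\<Sum>h\<in>F. (c h * (h z - g z)) * h x) = (\<Sum>h\<in>F. c h * h (z * x)) - g z * (\<Sum>h\<in>F. c h * h x)"
        unfolding sum_distrib_left sum_subtractf[symmetric]
        using z x insert.prems(2)[of _ z x] by (intro sum.cong refl) (simp add: algebra_simps)
      also have "\<dots> = (\<Sum>h\<in>insert g F. c h * h (z * x)) - g z * (\<Sum>h\<in>insert g F. c h * h x)"
        using insert.hyps z x insert.prems(2)[of g z x] by (simp add: algebra_simps)
      also have "\<dots> = 0" using insert.prems(4)[of x] insert.prems(4)[of "z * x"] assms(3) z x by simp
      finally show ?thesis .
    qed
    then have "c f * (f z - g z) = 0"
      using insert.prems f by (intro insert.IH[of "\<lambda>h. c h * (h z - g z)"]) auto
    then show ?thesis using z by simp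
  qed
  moreover from this have "c g = 0"
    using insert.prems(4)[OF assms(2)] insert.prems(1)[of g] insert.hyps by (simp add: sum.neutral)
  ultimately show ?case using insert.prems(5) by auto
qed simp

lemma F7_units_carrier: "carrier F7_units = {1..6}"
  and F7_units_mult: "a \<otimes>\<^bsub>F7_units\<^esub> b = a * b mod 7"
  and F7_units_one: "\<one>\<^bsub>F7_units\<^esub> = 1"
proof -
  have *: "{0..7 - 1 :: int} = {0,1,2,3,4,5,6}" "{1..6 :: int} = {1,2,3,4,5,6}" by auto
  have "carrier F7_units = {x \<in> {0..7 - 1}. \<exists>y\<in>{0..7 - 1}. y * x mod 7 = 1}"
    by (simp add: units_of_def Units_def residue_ring_def mult.commute)
  also have "\<dots> = {1..6}" unfolding * by (simp add: Collect_conv_if2 conj_disj_distribR Collect_disj_eq insert_commute cong: conj_cong)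
  finally show "carrier F7_units = {1..6}" .
qed (simp_all add: units_of_def residue_ring_def)

context separably_closed_extension
begin

abbreviation "Gal \<equiv> carrier (galois_group emb)"

lemma Gal_field_hom: "\<sigma> \<in> Gal \<Longrightarrow> field_hom \<sigma>"
  and Gal_emb: "\<sigma> \<in> Gal \<Longrightarrow> \<sigma> (emb c) = emb c"
  by (simp_all add: galois_group_def)

lemma Gal_id: "id \<in> Gal"
proof -
  have "field_hom (id :: 'l \<Rightarrow> 'l)" by unfold_locales simp_all
  then show ?thesis by (simp add: galois_group_def)
qed

lemma Gal_comp: 
  assumes "\<sigma> \<in> Gal" "\<tau> \<in> Gal" shows "\<sigma> \<circ> \<tau> \<in> Gal"
proof -
  interpret \<sigma>: field_hom \<sigma> using assms by (simp add: Gal_field_hom)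
  interpret \<tau>: field_hom \<tau> using assms by (simp add: Gal_field_hom)
  have "field_hom (\<sigma> \<circ> \<tau>)" by unfold_locales (simp_all add: hom_distribs)
  then show ?thesis using assms by (simp add: galois_group_def bij_comp)
qed

lemma Gal_inverse:
  assumes "\<sigma> \<in> Gal"
  obtains \<tau> where "\<tau> \<in> Gal" "\<tau> \<circ> \<sigma> = id" "\<sigma> \<circ> \<tau> = id"
proof -
  interpret \<sigma>: field_hom \<sigma> using assms by (simp add: Gal_field_hom)
  define \<tau> where "\<tau> = inv_into UNIV \<sigma>"
  have b: "bij \<sigma>" using assms by (simp add: galois_group_def)
  have \<tau>: "\<tau> (\<sigma> x) = x" "\<sigma> (\<tau> x) = x" for x
    using b by (simp_all add: \<tau>_def bij_is_inj bij_is_surj surj_f_inv_f)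
  have *: "\<tau> y = x" if "\<sigma> x = y" for x y using \<tau> that by blast
  have "field_hom \<tau>"
    by unfold_locales (auto intro!: * simp: hom_distribs \<tau>)
  moreover have "\<tau> (emb c) = emb c" for c using * Gal_emb[OF assms] by blast
  ultimately have "\<tau> \<in> Gal" using b by (simp add: galois_group_def \<tau>_def bij_imp_bij_inv)
  then show ?thesis using that \<tau> by (simp add: fun_eq_iff)
qed

lemma Gal_orbit_finite: "finite ((\<lambda>\<sigma>. \<sigma> x) ` Gal)"
proof -
  obtain p where p: "irreducible p" "poly (map_poly emb p) x = 0"
    using separable_over_base by metis
  have "(\<lambda>\<sigma>. \<sigma> x) ` Gal \<subseteq> {y. poly (map_poly emb p) y = 0}"
  proof clarify
    fix \<sigma> assume \<sigma>: "\<sigma> \<in> Gal"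
    then interpret \<sigma>: field_hom \<sigma> by (rule Gal_field_hom)
    have "poly (map_poly emb p) (\<sigma> x) = poly (map_poly \<sigma> (map_poly emb p)) (\<sigma> x)"
      by (simp add: map_poly_map_poly o_def Gal_emb[OF \<sigma>])
    then show "poly (map_poly emb p) (\<sigma> x) = 0" using p(2) by simp
  qed
  moreover have "map_poly emb p \<noteq> 0" using p(1) by auto
  ultimately show ?thesis by (rule finite_subset[OF _ poly_roots_finite])
qed

lemma galois_group_mult: "\<sigma> \<otimes>\<^bsub>galois_group emb\<^esub> \<tau> = \<sigma> \<circ> \<tau>"
  by (simp add: galois_group_def)

text \<open>Continuity means triviality on the automorphisms that fix some finite set: the kernel is an open
neighbourhood of the identity, and conversely every preimage is a union of cosets of a stabiliser.\<close>

lemma character_group_carrier_iff: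
  "\<psi> \<in> carrier (character_group emb) \<longleftrightarrow>
     \<psi> \<in> extensional Gal \<and> (\<forall>\<sigma>\<in>Gal. \<psi> \<sigma> \<in> {1..6}) \<and>
     (\<forall>\<sigma>\<in>Gal. \<forall>\<tau>\<in>Gal. \<psi> (\<sigma> \<circ> \<tau>) = \<psi> \<sigma> * \<psi> \<tau> mod 7) \<and>
     (\<exists>S. finite S \<and> (\<forall>\<sigma>\<in>Gal. (\<forall>x\<in>S. \<sigma> x = x) \<longrightarrow> \<psi> \<sigma> = 1))"
  (is "?L \<longleftrightarrow> ?R")
proof
  assume \<psi>: ?L
  then have hom: "\<psi> \<in> hom (galois_group emb) F7_units" and ext: "\<psi> \<in> extensional Gal"
    and cont: "continuous_map (krull_topology emb) (discrete_topology (carrier F7_units)) \<psi>"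
    by (auto simp: character_group_def)
  have \<psi>_range: "\<psi> \<sigma> \<in> {1..6}" if "\<sigma> \<in> Gal" for \<sigma>
    using hom that F7_units_carrier by (auto simp: hom_def Pi_def)
  have \<psi>_mult: "\<psi> (\<sigma> \<circ> \<tau>) = \<psi> \<sigma> * \<psi> \<tau> mod 7" if "\<sigma> \<in> Gal" "\<tau> \<in> Gal" for \<sigma> \<tau>
    using hom that by (auto simp: hom_def galois_group_mult F7_units_mult)
  have "\<psi> id * \<psi> id mod 7 = \<psi> id" using \<psi>_mult[of id id] Gal_id by simp
  moreover have "\<psi> id \<in> {1,2,3,4,5,6}" using \<psi>_range[OF Gal_id] by auto
  ultimately have id1: "\<psi> id = 1" by auto
  have top: "topspace (krull_topology emb) = Gal"
    by (auto simp: krull_topology_def topspace_subtopology)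
  have "openin (krull_topology emb) {\<sigma> \<in> Gal. \<psi> \<sigma> \<in> {1}}"
    using openin_continuous_map_preimage[OF cont, of "{1}"] top F7_units_carrier by simp
  then obtain S where S: "finite S" "{\<tau> \<in> Gal. \<forall>x\<in>S. \<tau> x = id x} \<subseteq> {\<sigma> \<in> Gal. \<psi> \<sigma> \<in> {1}}"
    using id1 Gal_id unfolding openin_krull_topology_iff by blast
  have "\<psi> \<sigma> = 1" if "\<sigma> \<in> Gal" "\<forall>x\<in>S. \<sigma> x = x" for \<sigma>
    using S(2) that by auto
  then have "\<exists>S. finite S \<and> (\<forall>\<sigma>\<in>Gal. (\<forall>x\<in>S. \<sigma> x = x) \<longrightarrow> \<psi> \<sigma> = 1)"
    using S(1) by (intro exI[of _ S]) simp
  then show ?R by (intro conjI ballI ext \<psi>_range \<psi>_mult)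
next
  assume R: ?R
  then obtain S where S: "finite S" "\<forall>\<sigma>\<in>Gal. (\<forall>x\<in>S. \<sigma> x = x) \<longrightarrow> \<psi> \<sigma> = 1" by blast
  have agree: "\<psi> \<tau> = \<psi> \<sigma>" if \<sigma>: "\<sigma> \<in> Gal" "\<tau> \<in> Gal" "\<forall>x\<in>S. \<tau> x = \<sigma> x" for \<sigma> \<tau>
  proof -
    obtain \<rho> where \<rho>: "\<rho> \<in> Gal" "\<rho> \<circ> \<sigma> = id" "\<sigma> \<circ> \<rho> = id" using Gal_inverse[OF \<sigma>(1)] by metis
    have "(\<rho> \<circ> \<tau>) x = x" if "x \<in> S" for x using \<sigma>(3) that fun_cong[OF \<rho>(2), of x] by simp
    then have "\<psi> (\<rho> \<circ> \<tau>) = 1" using S(2) Gal_comp \<rho>(1) \<sigma>(2) by blast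
    moreover have "\<tau> = \<sigma> \<circ> (\<rho> \<circ> \<tau>)" using \<rho>(3) by (simp add: comp_assoc[symmetric])
    ultimately have "\<psi> \<tau> = \<psi> \<sigma> * 1 mod 7" using R Gal_comp \<rho>(1) \<sigma> by metis
    moreover have "\<psi> \<sigma> \<in> {1..6}" using R \<sigma> by blast
    ultimately show ?thesis by simp
  qed
  have top: "topspace (krull_topology emb) = Gal"
    by (auto simp: krull_topology_def topspace_subtopology)
  have "openin (krull_topology emb) {\<sigma> \<in> Gal. \<psi> \<sigma> \<in> U}" for U
    unfolding openin_krull_topology_iff
  proof (intro conjI ballI)
    fix \<sigma> assume "\<sigma> \<in> {\<sigma> \<in> Gal. \<psi> \<sigma> \<in> U}"
    then have "{\<tau> \<in> Gal. \<forall>x\<in>S. \<tau> x = \<sigma> x} \<subseteq> {\<sigma> \<in> Gal. \<psi> \<sigma> \<in> U}"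
      by (auto dest: agree[of \<sigma>])
    then show "\<exists>S. finite S \<and> {\<tau> \<in> Gal. \<forall>x\<in>S. \<tau> x = \<sigma> x} \<subseteq> {\<sigma> \<in> Gal. \<psi> \<sigma> \<in> U}"
      using S(1) by blast
  qed blast
  moreover have range: "\<psi> \<sigma> \<in> {1..6}" if "\<sigma> \<in> Gal" for \<sigma> using R that by blast
  ultimately have "continuous_map (krull_topology emb) (discrete_topology (carrier F7_units)) \<psi>"
    unfolding continuous_map_def top F7_units_carrier by (simp add: Pi_def)
  moreover have "\<psi> (\<sigma> \<circ> \<tau>) = \<psi> \<sigma> * \<psi> \<tau> mod 7" if "\<sigma> \<in> Gal" "\<tau> \<in> Gal" for \<sigma> \<tau>
    using R that by blast
  then have "\<psi> \<in> hom (galois_group emb) F7_units"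
    unfolding hom_def galois_group_mult F7_units_mult F7_units_carrier using range by (simp add: Pi_def)
  ultimately show ?L using R by (simp add: character_group_def)
qed

lemma character_range:
  assumes "\<psi> \<in> carrier (character_group emb)" "\<sigma> \<in> Gal"
  shows "\<psi> \<sigma> \<in> {1..6}"
proof -
  have "\<forall>\<sigma>\<in>Gal. \<psi> \<sigma> \<in> {1..6}"
    using assms(1) unfolding character_group_carrier_iff by (elim conjE)
  from bspec[OF this assms(2)] show ?thesis .
qed

lemma character_comp:
  assumes "\<psi> \<in> carrier (character_group emb)" "\<sigma> \<in> Gal" "\<tau> \<in> Gal"
  shows "\<psi> (\<sigma> \<circ> \<tau>) = \<psi> \<sigma> * \<psi> \<tau> mod 7"
proof -
  have "\<forall>\<sigma>\<in>Gal. \<forall>\<tau>\<in>Gal. \<psi> (\<sigma> \<circ> \<tau>) = \<psi> \<sigma> * \<psi> \<tau> mod 7"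
    using assms(1) unfolding character_group_carrier_iff by (elim conjE)
  from bspec[OF bspec[OF this assms(2)] assms(3)] show ?thesis .
qed

lemma character_finite_level:
  assumes "\<psi> \<in> carrier (character_group emb)"
  shows "\<exists>S. finite S \<and> (\<forall>\<sigma>\<in>Gal. (\<forall>x\<in>S. \<sigma> x = x) \<longrightarrow> \<psi> \<sigma> = 1)"
  using assms unfolding character_group_carrier_iff by (elim conjE)

lemma character_id:
  assumes "\<psi> \<in> carrier (character_group emb)"
  shows "\<psi> id = 1"
  using character_finite_level[OF assms] Gal_id by auto

text \<open>For \<open>y\<close> in a finite subextension through which \<open>\<psi>\<close> factors, let \<open>t a\<close> be the sum of the conjugates
\<open>\<sigma> y\<close> with \<open>\<psi> \<sigma> = a\<close>. The Galois group permutes these sums by multiplication of the index, and by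
independence of the \<open>\<sigma>\<close> a prescribed linear combination of them is nonzero for a suitable \<open>y\<close>. For an
\<open>a\<close> that is not a value of \<open>\<psi>\<close> the sum is empty. Since \<open>1\<close> is a value, \<open>c 1 \<noteq> 0\<close> makes the combination
nontrivial.\<close>

lemma resolvent:
  fixes c :: "int \<Rightarrow> 'l"
  assumes \<psi>: "\<psi> \<in> carrier (character_group emb)" and c: "c 1 \<noteq> 0"
  obtains t :: "int \<Rightarrow> 'l" where
    "\<And>\<sigma> a. \<sigma> \<in> Gal \<Longrightarrow> a \<in> {1..6} \<Longrightarrow> \<sigma> (t a) = t (\<psi> \<sigma> * a mod 7)"
    "(\<Sum>a=1..6. c a * t a) \<noteq> 0"
proof -
  obtain S where S: "finite S" "\<forall>\<sigma>\<in>Gal. (\<forall>x\<in>S. \<sigma> x = x) \<longrightarrow> \<psi> \<sigma> = 1"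
    using character_finite_level[OF \<psi>] by (elim exE conjE)
  \<comment> \<open>the subfield fixed by the stabiliser of the finite set \<open>S\<close>\<close>
  define M where "M = {y. \<forall>\<sigma>\<in>Gal. (\<forall>x\<in>S. \<sigma> x = x) \<longrightarrow> \<sigma> y = y}"
  have "S \<subseteq> M" by (auto simp: M_def)
  have M1: "1 \<in> M"
    unfolding M_def using Gal_emb[of _ 1] by simp
  have M_mult: "x * y \<in> M" if "x \<in> M" "y \<in> M" for x y
  proof -
    have "\<sigma> (x * y) = x * y" if "\<sigma> \<in> Gal" "\<forall>x\<in>S. \<sigma> x = x" for \<sigma>
    proof -
      interpret field_hom \<sigma> using that(1) by (rule Gal_field_hom)
      have "\<sigma> x = x" "\<sigma> y = y" using that \<open>x \<in> M\<close> \<open>y \<in> M\<close> unfolding M_def by blast+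
      then show ?thesis by (simp add: hom_distribs)
    qed
    then show ?thesis by (simp add: M_def)
  qed
  have agree: "(\<forall>y\<in>M. \<sigma> y = \<tau> y) \<and> \<psi> \<sigma> = \<psi> \<tau>"
    if \<sigma>: "\<sigma> \<in> Gal" "\<tau> \<in> Gal" "\<forall>x\<in>S. \<sigma> x = \<tau> x" for \<sigma> \<tau>
  proof -
    obtain \<rho> where \<rho>: "\<rho> \<in> Gal" "\<rho> \<circ> \<tau> = id" "\<tau> \<circ> \<rho> = id" using Gal_inverse[OF \<sigma>(2)] by metis
    have in_Gal: "\<rho> \<circ> \<sigma> \<in> Gal" and fixS: "\<forall>x\<in>S. (\<rho> \<circ> \<sigma>) x = x"
      using \<sigma> \<rho> by (auto simp: Gal_comp fun_eq_iff)
    have eq: "\<sigma> = \<tau> \<circ> (\<rho> \<circ> \<sigma>)" using \<rho>(3) by (simp add: comp_assoc[symmetric])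
    have "\<psi> \<sigma> = \<psi> \<tau> * 1 mod 7"
      using character_comp[OF \<psi> \<sigma>(2) in_Gal] S(2) in_Gal fixS eq by simp
    then have "\<psi> \<sigma> = \<psi> \<tau>" using character_range[OF \<psi> \<sigma>(2)] by simp
    moreover have "\<sigma> y = \<tau> y" if "y \<in> M" for y
    proof -
      have "(\<rho> \<circ> \<sigma>) y = y" using that in_Gal fixS unfolding M_def by blast
      then show ?thesis using fun_cong[OF \<rho>(3), of "\<sigma> y"] by simp
    qed
    ultimately show ?thesis by blast
  qed
  \<comment> \<open>a finite set of embeddings of \<open>M\<close>, on which \<open>\<psi>\<close> induces the function \<open>\<Psi>\<close>\<close>
  define R where "R = (\<lambda>\<sigma>. restrict \<sigma> M) ` Gal"
  have "finite R"
  proof (rule finite_imageD)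
    have "(\<lambda>f. restrict f S) ` R \<subseteq> (\<Pi>\<^sub>E x\<in>S. (\<lambda>\<sigma>. \<sigma> x) ` Gal)"
      using \<open>S \<subseteq> M\<close> by (auto simp: R_def)
    then show "finite ((\<lambda>f. restrict f S) ` R)"
      by (rule finite_subset) (intro finite_PiE S(1) Gal_orbit_finite)
    show "inj_on (\<lambda>f. restrict f S) R"
    proof (rule inj_onI)
      fix f g assume "f \<in> R" "g \<in> R" and fg: "restrict f S = restrict g S"
      then obtain \<sigma> \<tau> where \<sigma>: "\<sigma> \<in> Gal" "f = restrict \<sigma> M" "\<tau> \<in> Gal" "g = restrict \<tau> M"
        by (auto simp: R_def)
      have "\<sigma> x = \<tau> x" if "x \<in> S" for x
        using fun_cong[OF fg, of x] that \<open>S \<subseteq> M\<close> \<sigma> by auto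
      then show "f = g" using agree[OF \<sigma>(1,3)] \<sigma>(2,4) by (auto intro!: restrict_ext)
    qed
  qed
  define \<Psi> where "\<Psi> f = (THE a. \<exists>\<sigma>\<in>Gal. f = restrict \<sigma> M \<and> a = \<psi> \<sigma>)" for f
  have \<Psi>: "\<Psi> (restrict \<sigma> M) = \<psi> \<sigma>" if "\<sigma> \<in> Gal" for \<sigma>
    unfolding \<Psi>_def
  proof (rule the_equality)
    fix a assume "\<exists>\<tau>\<in>Gal. restrict \<sigma> M = restrict \<tau> M \<and> a = \<psi> \<tau>"
    then obtain \<tau> where \<tau>: "\<tau> \<in> Gal" "restrict \<sigma> M = restrict \<tau> M" "a = \<psi> \<tau>" by blast
    then have "\<forall>x\<in>S. \<sigma> x = \<tau> x" using \<open>S \<subseteq> M\<close> by (metis restrict_apply subsetD)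
    then show "a = \<psi> \<sigma>" using agree that \<tau> by metis
  qed (use that in blast)
  have R_cases: "\<exists>\<sigma>\<in>Gal. f = restrict \<sigma> M \<and> \<Psi> f = \<psi> \<sigma>" if "f \<in> R" for f
    using that \<Psi> by (auto simp: R_def)
  have \<Psi>_range: "\<Psi> f \<in> {1..6}" if "f \<in> R" for f
    using R_cases[OF that] character_range[OF \<psi>] by auto
  define r where "r = restrict id M"
  have r: "r \<in> R" "\<Psi> r = 1" using \<Psi>[OF Gal_id] Gal_id character_id[OF \<psi>] by (auto simp: R_def r_def)
  have "\<not> (\<forall>y\<in>M. (\<Sum>f\<in>R. c (\<Psi> f) * f y) = 0)"
  proof
    assume *: "\<forall>y\<in>M. (\<Sum>f\<in>R. c (\<Psi> f) * f y) = 0"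
    have "c (\<Psi> r) = 0"
    proof (rule dedekind_independence[of R M "\<lambda>f. c (\<Psi> f)"])
      fix f assume "f \<in> R"
      then obtain \<sigma> where \<sigma>: "\<sigma> \<in> Gal" "f = restrict \<sigma> M" by (auto simp: R_def)
      interpret field_hom \<sigma> using \<sigma>(1) by (rule Gal_field_hom)
      show "f 1 = 1" using M1 \<sigma> by simp
      show "f (x * y) = f x * f y" if "x \<in> M" "y \<in> M" for x y
        using that M_mult \<sigma> by (simp add: hom_distribs)
    next
      fix f g assume "f \<in> R" "g \<in> R" "f \<noteq> g"
      then show "\<exists>x\<in>M. f x \<noteq> g x" by (auto simp: R_def fun_eq_iff split: if_splits)
    qed (use \<open>finite R\<close> M1 M_mult * r in auto)
    then show False using c r by simp
  qed
  then obtain y where y: "y \<in> M" "(\<Sum>f\<in>R. c (\<Psi> f) * f y) \<noteq> 0" by blast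
  define t where "t a = (\<Sum>f | f \<in> R \<and> \<Psi> f = a. f y)" for a
  have L: "restrict (\<sigma> \<circ> f) M \<in> R \<and> \<Psi> (restrict (\<sigma> \<circ> f) M) = \<psi> \<sigma> * \<Psi> f mod 7"
    if "\<sigma> \<in> Gal" "f \<in> R" for \<sigma> f
  proof -
    obtain \<tau> where \<tau>: "\<tau> \<in> Gal" "f = restrict \<tau> M" "\<Psi> f = \<psi> \<tau>" using R_cases \<open>f \<in> R\<close> by blast
    have "restrict (\<sigma> \<circ> f) M = restrict (\<sigma> \<circ> \<tau>) M" using \<tau>(2) by auto
    then show ?thesis using \<tau> \<Psi> Gal_comp \<open>\<sigma> \<in> Gal\<close> character_comp[OF \<psi>] by (simp add: R_def)
  qed
  have equivariant: "\<sigma> (t a) = t (\<psi> \<sigma> * a mod 7)" if \<sigma>: "\<sigma> \<in> Gal" "a \<in> {1..6}" for \<sigma> a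
  proof -
    interpret field_hom \<sigma> using \<sigma>(1) by (rule Gal_field_hom)
    obtain \<rho> where \<rho>: "\<rho> \<in> Gal" "\<rho> \<circ> \<sigma> = id" "\<sigma> \<circ> \<rho> = id" using Gal_inverse[OF \<sigma>(1)] by metis
    have 1: "\<psi> \<rho> * \<psi> \<sigma> mod 7 = 1"
      using character_comp[OF \<psi> \<rho>(1) \<sigma>(1)] \<rho>(2) character_id[OF \<psi>] by simp
    have 2: "\<psi> \<rho> * (\<psi> \<sigma> * a mod 7) mod 7 = a"
    proof -
      have "\<psi> \<rho> * (\<psi> \<sigma> * a mod 7) mod 7 = (\<psi> \<rho> * \<psi> \<sigma> mod 7) * a mod 7"
        by (simp add: mod_simps mult.assoc)
      then show ?thesis using 1 \<sigma>(2) by simp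
    qed
    have ext: "restrict f M = f" if "f \<in> R" for f using that by (auto simp: R_def)
    have "\<sigma> (t a) = (\<Sum>f | f \<in> R \<and> \<Psi> f = a. \<sigma> (f y))" by (simp add: t_def hom_distribs)
    also have "\<dots> = t (\<psi> \<sigma> * a mod 7)"
      unfolding t_def
    proof (rule sum.reindex_bij_witness[where i = "\<lambda>f. restrict (\<rho> \<circ> f) M" and j = "\<lambda>f. restrict (\<sigma> \<circ> f) M"])
      fix f assume f: "f \<in> {f \<in> R. \<Psi> f = a}"
      have "restrict (\<rho> \<circ> restrict (\<sigma> \<circ> f) M) M = restrict f M"
        using fun_cong[OF \<rho>(2)] by (auto intro!: restrict_ext)
      then show "restrict (\<rho> \<circ> restrict (\<sigma> \<circ> f) M) M = f" using ext f by simp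
      show "restrict (\<sigma> \<circ> f) M \<in> {f \<in> R. \<Psi> f = \<psi> \<sigma> * a mod 7}" using L[OF \<sigma>(1)] f by auto
      show "restrict (\<sigma> \<circ> f) M y = \<sigma> (f y)" using y by simp
    next
      fix f assume f: "f \<in> {f \<in> R. \<Psi> f = \<psi> \<sigma> * a mod 7}"
      have "restrict (\<sigma> \<circ> restrict (\<rho> \<circ> f) M) M = restrict f M"
        using fun_cong[OF \<rho>(3)] by (auto intro!: restrict_ext)
      then show "restrict (\<sigma> \<circ> restrict (\<rho> \<circ> f) M) M = f" using ext f by simp
      show "restrict (\<rho> \<circ> f) M \<in> {f \<in> R. \<Psi> f = a}" using L[OF \<rho>(1)] f 2 by auto
    qed
    finally show ?thesis .
  qed
  have "(\<Sum>a=1..6. c a * t a) = (\<Sum>f\<in>R. c (\<Psi> f) * f y)"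
  proof -
    have "(\<Sum>f\<in>R. c (\<Psi> f) * f y) = (\<Sum>a\<in>{1..6}. \<Sum>f | f \<in> R \<and> \<Psi> f = a. c (\<Psi> f) * f y)"
      using \<open>finite R\<close> \<Psi>_range by (intro sum.group[symmetric]) auto
    also have "\<dots> = (\<Sum>a=1..6. c a * t a)"
      by (intro sum.cong refl) (simp add: t_def sum_distrib_left)
    finally show ?thesis by simp
  qed
  then have "(\<Sum>a=1..6. c a * t a) \<noteq> 0" using y(2) by simp
  with equivariant show ?thesis by (rule that[of t])
qed

end

section \<open>A family of curves with a cyclic subgroup of order seven\<close>

text \<open>The line \<open>y = W(x)\<close> with this slope and intercept takes the values
\<open>- V (c - a)\<^sup>2 (a - b)\<close>, \<open>- V (a - b)\<^sup>2 (b - c)\<close>, \<open>- V (b - c)\<^sup>2 (c - a)\<close> at \<open>a\<close>, \<open>b\<close>, \<open>c\<close>. These values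
are what the conditions \<open>2 P\<^sub>a = P\<^sub>b\<close>, \<open>2 P\<^sub>b = P\<^sub>c\<close>, \<open>2 P\<^sub>c = P\<^sub>a\<close> require; that three prescribed values
are interpolated by a line rather than by a parabola is the coincidence on which the family rests.\<close>

definition heptagon_slope :: "'a::field \<Rightarrow> 'a \<Rightarrow> 'a \<Rightarrow> 'a \<Rightarrow> 'a" where
  "heptagon_slope V a b c = - V * (a^2 + b^2 + c^2 - a * b - b * c - c * a)"

definition heptagon_intercept :: "'a::field \<Rightarrow> 'a \<Rightarrow> 'a \<Rightarrow> 'a \<Rightarrow> 'a" where
  "heptagon_intercept V a b c = V * (a^2 * c + b * c^2 + a * b^2 - 3 * a * b * c)"

definition heptagon_line :: "'a::field \<Rightarrow> 'a \<Rightarrow> 'a \<Rightarrow> 'a \<Rightarrow> 'a \<Rightarrow> 'a" where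
  "heptagon_line V a b c x = heptagon_slope V a b c * x + heptagon_intercept V a b c"

text \<open>The curve \<open>y\<^sup>2 - W y = (x - a) (x - b) (x - c) + \<kappa> W\<^sup>2\<close>. For \<open>\<kappa> = s\<^sup>2 - s\<close> it meets each of the lines
\<open>y = s W\<close> and \<open>y = (1 - s) W\<close> in the points above \<open>a\<close>, \<open>b\<close>, \<open>c\<close>, and inversion exchanges the two
lines. Varying \<open>\<kappa>\<close> gives the quadratic twists in a form that is valid in every characteristic.\<close>

definition heptagon_curve :: "'a::field \<Rightarrow> 'a \<Rightarrow> 'a \<Rightarrow> 'a \<Rightarrow> 'a \<Rightarrow> 'a weierstrass" where
  "heptagon_curve \<kappa> V a b c =
     (let \<alpha> = heptagon_slope V a b c; \<beta> = heptagon_intercept V a b c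
      in Weierstrass (- \<alpha>) (\<kappa> * \<alpha>^2 - (a + b + c)) (- \<beta>)
           (a * b + b * c + c * a + 2 * \<kappa> * \<alpha> * \<beta>) (\<kappa> * \<beta>^2 - a * b * c))"

text \<open>The definitions are invariant under cyclic permutations of \<open>a\<close>, \<open>b\<close>, \<open>c\<close>, the action of the squares in
\<open>F\<^sub>7\<^sup>\<times>\<close> on the collinear points.\<close>

lemma heptagon_curve_rotate: "heptagon_curve \<kappa> V b c a = heptagon_curve \<kappa> V a b c"
  and heptagon_line_rotate: "heptagon_line V b c a = heptagon_line V a b c"
proof -
  have *: "heptagon_slope V b c a = heptagon_slope V a b c"
    "heptagon_intercept V b c a = heptagon_intercept V a b c"
    by (simp_all add: heptagon_slope_def heptagon_intercept_def algebra_simps)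
  then show "heptagon_line V b c a = heptagon_line V a b c" by (simp add: heptagon_line_def fun_eq_iff)
  show "heptagon_curve \<kappa> V b c a = heptagon_curve \<kappa> V a b c"
    unfolding heptagon_curve_def Let_def * by (simp add: algebra_simps)
qed

lemma heptagon_line_at:
  "heptagon_line V a b c a = - V * (c - a)^2 * (a - b)"
  "heptagon_line V a b c b = - V * (a - b)^2 * (b - c)"
  "heptagon_line V a b c c = - V * (b - c)^2 * (c - a)"
  unfolding heptagon_line_def heptagon_slope_def heptagon_intercept_def
  by (simp_all add: power2_eq_square algebra_simps)

lemma heptagon_line_diff:
  "heptagon_line V a b c x - heptagon_line V a b c y = heptagon_slope V a b c * (x - y)"
  by (simp add: heptagon_line_def algebra_simps)

lemma on_heptagon_curve_iff:
  "on_curve (heptagon_curve \<kappa> V a b c) (Affine x y) \<longleftrightarrow>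
     y^2 - heptagon_line V a b c x * y = (x - a) * (x - b) * (x - c) + \<kappa> * (heptagon_line V a b c x)^2"
proof -
  define \<alpha> where "\<alpha> = heptagon_slope V a b c"
  define \<beta> where "\<beta> = heptagon_intercept V a b c"
  have "y^2 + - \<alpha> * x * y + - \<beta> * y = y^2 - (\<alpha> * x + \<beta>) * y" by (simp add: algebra_simps)
  moreover have "x^3 + (\<kappa> * \<alpha>^2 - (a + b + c)) * x^2 + (a * b + b * c + c * a + 2 * \<kappa> * \<alpha> * \<beta>) * x +
      (\<kappa> * \<beta>^2 - a * b * c) = (x - a) * (x - b) * (x - c) + \<kappa> * (\<alpha> * x + \<beta>)^2"
    by (simp add: power2_eq_square power3_eq_cube algebra_simps)
  ultimately show ?thesis
    unfolding heptagon_curve_def heptagon_line_def Let_def on_curve.simps \<alpha>_def[symmetric] \<beta>_def[symmetric]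
    by (simp only:)
qed

lemma point_add_commute:
  assumes "on_curve E P" "on_curve E Q"
  shows "point_add E P Q = point_add E Q P"
proof (cases P)
  case [simp]: (Affine x1 y1)
  show ?thesis
  proof (cases Q)
    case [simp]: (Affine x2 y2)
    obtain a1 a2 a3 a4 a6 where [simp]: "E = Weierstrass a1 a2 a3 a4 a6" by (cases E)
    show ?thesis
    proof (cases "x1 = x2")
      case [simp]: True
      have "y1^2 + a1 * x2 * y1 + a3 * y1 = y2^2 + a1 * x2 * y2 + a3 * y2"
        using assms by simp
      then have "(y1 - y2) * (y2 - (- y1 - a1 * x2 - a3)) = 0"
        by (simp add: power2_eq_square algebra_simps)
      then have "y1 = y2 \<or> y2 = - y1 - a1 * x2 - a3" by simp
      then show ?thesis by auto
    next
      case False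
      define l where "l = (y2 - y1) / (x2 - x1)"
      define z where "z = l^2 + a1 * l - a2 - x1 - x2"
      have l': "(y1 - y2) / (x1 - x2) = l" unfolding l_def by (metis minus_diff_eq minus_divide_divide)
      have "l * (x2 - x1) = y2 - y1" using False by (simp add: l_def)
      then have y: "y2 + l * (z - x2) = y1 + l * (z - x1)" by (simp add: algebra_simps)
      have "l^2 + a1 * l - a2 - x2 - x1 = z" by (simp add: z_def)
      then have z: "z = l^2 + a1 * l - a2 - x2 - x1" by simp
      have "point_add E Q P = Affine z (- (y2 + l * (z - x2)) - a1 * z - a3)"
        unfolding z using False by (simp add: Let_def l')
      moreover have "point_add E P Q = Affine z (- (y1 + l * (z - x1)) - a1 * z - a3)"
        unfolding z_def l_def using False by (simp add: Let_def)
      ultimately show ?thesis unfolding y by simp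
    qed
  qed (cases E, simp)
qed (cases E; cases Q; simp)

lemma point_add_eqI:
  assumes "x1 \<noteq> x2 \<and> l = (y2 - y1) / (x2 - x1) \<or>
      x1 = x2 \<and> y1 = y2 \<and> y2 \<noteq> - y1 - a1 * x1 - a3 \<and>
      l = (3 * x1^2 + 2 * a2 * x1 + a4 - a1 * y1) / (2 * y1 + a1 * x1 + a3)"
    and "x3 = l^2 + a1 * l - a2 - x1 - x2"
    and "y3 = - (y1 + l * (x3 - x1)) - a1 * x3 - a3"
  shows "point_add (Weierstrass a1 a2 a3 a4 a6) (Affine x1 y1) (Affine x2 y2) = Affine x3 y3"
  using assms(1) unfolding assms(2,3) by (elim disjE conjE) (simp_all add: Let_def)

locale heptagon =
  fixes s V a b c :: "'a::field"
  assumes distinct: "a \<noteq> b" "b \<noteq> c" "c \<noteq> a"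
    and normalised: "(2 * s - 1)^2 * V^2 * ((a - b) * (b - c) * (c - a)) = -1"
begin

abbreviation "E \<equiv> heptagon_curve (s^2 - s) V a b c"
abbreviation "W \<equiv> heptagon_line V a b c"
abbreviation "\<alpha> \<equiv> heptagon_slope V a b c"

lemma nonzero: "V \<noteq> 0" "2 * s - 1 \<noteq> 0"
  using normalised by auto

lemma rotate: "heptagon s V b c a"
  using distinct normalised by unfold_locales (auto simp: algebra_simps)

lemma negate: "heptagon (1 - s) V a b c"
  using distinct normalised by unfold_locales (auto simp: power2_eq_square algebra_simps)

lemma curve_negate: "heptagon_curve ((1 - s)^2 - (1 - s)) V a b c = E"
  by (simp add: power2_eq_square algebra_simps)

lemma W_nonzero: "W a \<noteq> 0" "W b \<noteq> 0" "W c \<noteq> 0"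
  using distinct nonzero by (simp_all add: heptagon_line_at)

lemma vertices_on_curve:
  "on_curve E (Affine a (s * W a))" "on_curve E (Affine b (s * W b))" "on_curve E (Affine c (s * W c))"
  unfolding on_heptagon_curve_iff by (simp_all add: power2_eq_square algebra_simps)

lemma opposite: "point_add E (Affine x (t * W x)) (Affine x ((1 - t) * W x)) = Infinity"
  by (simp add: heptagon_curve_def Let_def heptagon_line_def algebra_simps)

text \<open>The tangent at \<open>P\<^sub>a\<close> has slope \<open>s \<alpha> + tangent_offset\<close>, in excess of the slope \<open>s \<alpha>\<close> of the line through the
three points. It passes through \<open>- P\<^sub>b\<close>, so the same slope serves for \<open>2 P\<^sub>a = P\<^sub>b\<close> and for
\<open>P\<^sub>a - P\<^sub>b = - P\<^sub>a\<close>. The normalisation turns the division by \<open>2 y - W\<close> into this polynomial.\<close>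

definition tangent_offset :: 'a where
  "tangent_offset = - (2 * s - 1) * V * (a - b) * (b - c)"

lemma tangent_offset_square: "tangent_offset^2 + (2 * s - 1) * \<alpha> * tangent_offset = a - c"
proof -
  define d where "d = 2 * s - 1"
  have "tangent_offset^2 + d * \<alpha> * tangent_offset = d^2 * V^2 * ((a - b) * (b - c) * (c - a)) * (c - a)"
    unfolding tangent_offset_def d_def[symmetric] heptagon_slope_def by (simp add: power2_eq_square algebra_simps)
  then show ?thesis using normalised by (simp add: d_def)
qed

lemma tangent_offset_mult_ba: "tangent_offset * (b - a) = - (2 * s - 1) * W b"
proof -
  define d where "d = 2 * s - 1"
  show ?thesis unfolding tangent_offset_def d_def[symmetric] heptagon_line_at
    by (simp add: power2_eq_square algebra_simps)
qed

lemma tangent_offset_mult_Wa: "tangent_offset * ((2 * s - 1) * W a) = (a - b) * (a - c)"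
proof -
  define d where "d = 2 * s - 1"
  have "tangent_offset * (d * W a) = d^2 * V^2 * ((a - b) * (b - c) * (c - a)) * ((a - b) * (c - a))"
    unfolding tangent_offset_def d_def[symmetric] heptagon_line_at by (simp add: power2_eq_square algebra_simps)
  also have "\<dots> = (-1) * ((a - b) * (c - a))" by (simp only: normalised d_def)
  finally show ?thesis by (simp add: d_def algebra_simps)
qed

lemma tangent_slope_square: "(s * \<alpha> + tangent_offset)^2 - \<alpha> * (s * \<alpha> + tangent_offset) = (s^2 - s) * \<alpha>^2 + (a - c)"
  unfolding tangent_offset_square[symmetric] by (simp add: power2_eq_square algebra_simps)

lemma tangent_slope_mult_ba: "(s * \<alpha> + tangent_offset) * (b - a) = (1 - s) * W b - s * W a"
proof -
  have "(s * \<alpha> + tangent_offset) * (b - a) = s * (\<alpha> * (b - a)) + tangent_offset * (b - a)" by (simp add: algebra_simps)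
  also have "\<dots> = s * (W b - W a) - (2 * s - 1) * W b"
    unfolding tangent_offset_mult_ba heptagon_line_diff by (simp add: algebra_simps)
  finally show ?thesis by (simp add: algebra_simps)
qed

text \<open>The chord-and-tangent law on this curve with all divisions removed: the first hypothesis is the sum of
the three abscissae on the line of slope \<open>l\<close>, the second says that the line passes through the inverse
of the third point.\<close>

lemma chord_add:
  assumes "l^2 - \<alpha> * l = (s^2 - s) * \<alpha>^2 - (a + b + c) + x1 + x2 + x3"
    and "l * (x3 - x1) = W x3 - y1 - y3"
    and "x1 \<noteq> x2 \<and> l = (y2 - y1) / (x2 - x1) \<or>
         x1 = x2 \<and> y1 = y2 \<and> y1 \<noteq> W x1 - y1 \<and>
         l = (3 * x1^2 + 2 * ((s^2 - s) * \<alpha>^2 - (a + b + c)) * x1 +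
              (a * b + b * c + c * a + 2 * (s^2 - s) * \<alpha> * heptagon_intercept V a b c) + \<alpha> * y1) /
             (2 * y1 - W x1)"
  shows "point_add E (Affine x1 y1) (Affine x2 y2) = Affine x3 y3"
proof -
  define A where "A = \<alpha>"
  define B where "B = heptagon_intercept V a b c"
  have W: "W x = A * x + B" for x by (simp add: heptagon_line_def A_def B_def)
  show ?thesis
    unfolding heptagon_curve_def Let_def A_def[symmetric] B_def[symmetric]
  proof (rule point_add_eqI)
    show "x3 = l^2 + - A * l - ((s^2 - s) * A^2 - (a + b + c)) - x1 - x2"
      using assms(1) unfolding A_def[symmetric] by (simp add: algebra_simps)
    show "y3 = - (y1 + l * (x3 - x1)) - - A * x3 - - B" using assms(2) by (simp add: W)
    have "y1 \<noteq> W x1 - y1 \<longleftrightarrow> y1 \<noteq> - y1 - - A * x1 - - B" by (simp add: W algebra_simps)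
    moreover have "2 * y1 - W x1 = 2 * y1 + - A * x1 + - B" by (simp add: W)
    moreover have "\<alpha> * y1 = - (- A * y1)" by (simp add: A_def)
    ultimately show "x1 \<noteq> x2 \<and> l = (y2 - y1) / (x2 - x1) \<or>
      x1 = x2 \<and> y1 = y2 \<and> y2 \<noteq> - y1 - - A * x1 - - B \<and>
      l = (3 * x1^2 + 2 * ((s^2 - s) * A^2 - (a + b + c)) * x1 +
           (a * b + b * c + c * a + 2 * (s^2 - s) * A * B) - - A * y1) / (2 * y1 + - A * x1 + - B)"
      using assms(3) unfolding A_def[symmetric] B_def[symmetric] by auto
  qed
qed

lemma double_a: "point_add E (Affine a (s * W a)) (Affine a (s * W a)) = Affine b (s * W b)"
proof (rule chord_add[where l = "s * \<alpha> + tangent_offset"])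
  show "(s * \<alpha> + tangent_offset)^2 - \<alpha> * (s * \<alpha> + tangent_offset) = (s\<^sup>2 - s) * \<alpha>\<^sup>2 - (a + b + c) + a + a + b"
    unfolding tangent_slope_square by simp
  show "(s * \<alpha> + tangent_offset) * (b - a) = W b - s * W a - s * W b"
    unfolding tangent_slope_mult_ba by (simp add: algebra_simps)
  have d: "2 * (s * W a) - W a = (2 * s - 1) * W a" by (simp add: algebra_simps)
  then have nz: "2 * (s * W a) - W a \<noteq> 0" using W_nonzero nonzero by simp
  define B where "B = heptagon_intercept V a b c"
  have B: "B = W a - \<alpha> * a" by (simp add: B_def heptagon_line_def)
  have "(s * \<alpha> + tangent_offset) * (2 * (s * W a) - W a) = s * \<alpha> * ((2 * s - 1) * W a) + (a - b) * (a - c)"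
    unfolding d distrib_right tangent_offset_mult_Wa by simp
  also have "\<dots> = 3 * a^2 + 2 * ((s^2 - s) * \<alpha>^2 - (a + b + c)) * a +
              (a * b + b * c + c * a + 2 * (s^2 - s) * \<alpha> * B) + \<alpha> * (s * W a)"
    unfolding B by (simp add: power2_eq_square algebra_simps)
  finally have "s * \<alpha> + tangent_offset =
     (3 * a^2 + 2 * ((s^2 - s) * \<alpha>^2 - (a + b + c)) * a +
              (a * b + b * c + c * a + 2 * (s^2 - s) * \<alpha> * B) + \<alpha> * (s * W a)) /
             (2 * (s * W a) - W a)" by (rule nonzero_eq_divide_eq[OF nz, THEN iffD2])
  moreover have "s * W a \<noteq> W a - s * W a" using nz by (auto simp: algebra_simps)
  ultimately show "a \<noteq> a \<and> s * \<alpha> + tangent_offset = (s * W a - s * W a) / (a - a) \<or>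
         a = a \<and> s * W a = s * W a \<and> s * W a \<noteq> W a - s * W a \<and>
         s * \<alpha> + tangent_offset = (3 * a^2 + 2 * ((s^2 - s) * \<alpha>^2 - (a + b + c)) * a +
              (a * b + b * c + c * a + 2 * (s^2 - s) * \<alpha> * heptagon_intercept V a b c) + \<alpha> * (s * W a)) /
             (2 * (s * W a) - W a)"
    unfolding B_def by blast
qed

lemma add_ab: "point_add E (Affine a (s * W a)) (Affine b (s * W b)) = Affine c ((1 - s) * W c)"
proof (rule chord_add[where l = "s * \<alpha>"])
  show "s * \<alpha> * (c - a) = W c - s * W a - (1 - s) * W c"
    unfolding mult.assoc heptagon_line_diff[symmetric] by (simp add: algebra_simps)
  show "(s * \<alpha>)^2 - \<alpha> * (s * \<alpha>) = (s^2 - s) * \<alpha>^2 - (a + b + c) + a + b + c"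
    by (simp add: power2_eq_square algebra_simps)
  have "s * W b - s * W a = s * \<alpha> * (b - a)"
    unfolding mult.assoc heptagon_line_diff[symmetric] by (simp add: algebra_simps)
  then have "s * \<alpha> = (s * W b - s * W a) / (b - a)" using distinct by simp
  then show "a \<noteq> b \<and> s * \<alpha> = (s * W b - s * W a) / (b - a) \<or> 
         a = b \<and> s * W a = s * W b \<and> s * W a \<noteq> W a - s * W a \<and>
         s * \<alpha> = (3 * a^2 + 2 * ((s^2 - s) * \<alpha>^2 - (a + b + c)) * a +
              (a * b + b * c + c * a + 2 * (s^2 - s) * \<alpha> * heptagon_intercept V a b c) + \<alpha> * (s * W a)) /
             (2 * (s * W a) - W a)" using distinct by blast
qed

lemma diff_ab: "point_add E (Affine a (s * W a)) (Affine b ((1 - s) * W b)) = Affine a ((1 - s) * W a)"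
proof (rule chord_add[where l = "s * \<alpha> + tangent_offset"])
  show "(s * \<alpha> + tangent_offset)^2 - \<alpha> * (s * \<alpha> + tangent_offset) = (s\<^sup>2 - s) * \<alpha>\<^sup>2 - (a + b + c) + a + b + a"
    unfolding tangent_slope_square by simp
  have "s * \<alpha> + tangent_offset = ((1 - s) * W b - s * W a) / (b - a)"
    using distinct unfolding tangent_slope_mult_ba[symmetric] by simp
  then show "a \<noteq> b \<and> s * \<alpha> + tangent_offset = ((1 - s) * W b - s * W a) / (b - a) \<or> 
         a = b \<and> s * W a = (1 - s) * W b \<and> s * W a \<noteq> W a - s * W a \<and>
         s * \<alpha> + tangent_offset = (3 * a^2 + 2 * ((s^2 - s) * \<alpha>^2 - (a + b + c)) * a +
              (a * b + b * c + c * a + 2 * (s^2 - s) * \<alpha> * heptagon_intercept V a b c) + \<alpha> * (s * W a)) /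
             (2 * (s * W a) - W a)" using distinct by blast
qed (simp add: algebra_simps)


lemma opposite_sym: "point_add E (Affine x ((1 - t) * W x)) (Affine x (t * W x)) = Infinity"
  using opposite[of x "1 - t"] by simp

end

text \<open>The multiple \<open>i P\<close> of \<open>P = P\<^sub>a\<close> lies above \<open>a\<close>, \<open>b\<close> or \<open>c\<close> according to the class of \<open>i\<close> modulo \<open>\<plusminus>1\<close>, and
on the line \<open>y = s W\<close> or \<open>y = (1 - s) W\<close> according to whether \<open>i\<close> is a square.\<close>

definition heptagon_x :: "'a \<Rightarrow> 'a \<Rightarrow> 'a \<Rightarrow> int \<Rightarrow> 'a" where
  "heptagon_x a b c i = (if i \<in> {1, 6} then a else if i \<in> {2, 5} then b else c)"

definition heptagon_s :: "'a::ring_1 \<Rightarrow> int \<Rightarrow> 'a" where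
  "heptagon_s s i = (if i \<in> {1, 2, 4} then s else 1 - s)"

context heptagon
begin

definition Q :: "int \<Rightarrow> 'a point" where
  "Q i = (if i = 0 then Infinity
          else Affine (heptagon_x a b c i) (heptagon_s s i * W (heptagon_x a b c i)))"

lemma Q_simps:
  "Q 0 = Infinity" "Q 1 = Affine a (s * W a)" "Q 2 = Affine b (s * W b)"
  "Q 3 = Affine c ((1 - s) * W c)" "Q 4 = Affine c (s * W c)"
  "Q 5 = Affine b ((1 - s) * W b)" "Q 6 = Affine a ((1 - s) * W a)"
  by (simp_all add: Q_def heptagon_x_def heptagon_s_def)

lemma Q_on_curve: "on_curve E (Q i)"
proof -
  interpret neg: heptagon "1 - s" V a b c by (rule negate)
  show ?thesis
    using vertices_on_curve neg.vertices_on_curve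
    unfolding Q_def curve_negate by (auto simp: heptagon_x_def heptagon_s_def)
qed

lemma Q_inj: "inj_on Q {0..6}"
proof -
  have "s * w \<noteq> (1 - s) * w" "(1 - s) * w \<noteq> s * w" if "w \<noteq> 0" for w
  proof -
    have "s * w - (1 - s) * w = (2 * s - 1) * w" by (simp add: algebra_simps)
    then have "s * w - (1 - s) * w \<noteq> 0" using that nonzero by simp
    then show "s * w \<noteq> (1 - s) * w" "(1 - s) * w \<noteq> s * w" by auto
  qed
  note * = this[OF W_nonzero(1)] this[OF W_nonzero(2)] this[OF W_nonzero(3)]
  have "{0..6 :: int} = {0, 1, 2, 3, 4, 5, 6}" by auto
  then show ?thesis using * distinct distinct[symmetric] by (simp add: Q_simps)
qed

text \<open>Rotation of \<open>a\<close>, \<open>b\<close>, \<open>c\<close> and the exchange of \<open>s\<close> and \<open>1 - s\<close> reduce the addition table to a doubling, a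
sum of two points on one line, a difference of two such points, and sums of opposite points.\<close>

lemma Q_add:
  assumes "i \<in> {0..6}" "j \<in> {0..6}"
  shows "point_add E (Q i) (Q j) = Q ((i + j) mod 7)"
proof -
  interpret r: heptagon s V b c a by (rule rotate)
  interpret rr: heptagon s V c a b by (rule r.rotate)
  interpret n: heptagon "1 - s" V a b c by (rule negate)
  interpret nr: heptagon "1 - s" V b c a by (rule n.rotate)
  interpret nrr: heptagon "1 - s" V c a b by (rule nr.rotate)
  note rot = heptagon_curve_rotate[of _ V b c a] heptagon_curve_rotate[of _ V c a b]
    heptagon_line_rotate[of V b c a] heptagon_line_rotate[of V c a b]
  have s: "1 - (1 - s) = s" by simp
  define T :: "(int \<times> int) set" where "T = {(1,1), (2,2), (4,4), (6,6), (5,5), (3,3), (1,2), (2,4), (4,1), (6,5), (5,3), (3,6),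
       (1,5), (2,3), (4,6), (6,2), (5,4), (3,1), (1,6), (2,5), (3,4)}"
  have half: "point_add E (Q i) (Q j) = Q ((i + j) mod 7)" if "(i, j) \<in> T" for i j
    using that double_a r.double_a rr.double_a n.double_a nr.double_a nrr.double_a
      add_ab r.add_ab rr.add_ab n.add_ab nr.add_ab nrr.add_ab
      diff_ab r.diff_ab rr.diff_ab n.diff_ab nr.diff_ab nrr.diff_ab
      opposite[of _ s] opposite_sym[of _ s]
    unfolding rot curve_negate s T_def
    by (elim insertE) (simp_all add: Q_simps)
  have "i \<in> {0, 1, 2, 3, 4, 5, 6}" "j \<in> {0, 1, 2, 3, 4, 5, 6}" using assms by auto
  then have "i = 0 \<or> j = 0 \<or> (i, j) \<in> T \<or> (j, i) \<in> T"
    unfolding T_def by (elim insertE emptyE) simp_all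
  then consider "i = 0" | "j = 0" | (fw) "(i, j) \<in> T" | (bw) "(j, i) \<in> T" by blast
  then show ?thesis
  proof cases
    case 1
    then show ?thesis using assms by (simp add: Q_simps)
  next
    case 2
    then show ?thesis using assms by (cases "Q i") (simp_all add: Q_simps)
  next
    case fw
    then show ?thesis by (rule half)
  next
    case bw
    have "point_add E (Q i) (Q j) = point_add E (Q j) (Q i)"
      by (intro point_add_commute Q_on_curve)
    then show ?thesis using half[OF bw] by (simp add: add.commute)
  qed
qed

lemma Q_uminus: "i \<in> {0..6} \<Longrightarrow> point_add E (Q i) (Q ((7 - i) mod 7)) = Infinity"
  by (subst Q_add) (auto simp: Q_simps mod_simps)

lemma Q_pow:
  assumes "i \<in> {0..6}"
  shows "Q i [^]\<^bsub>curve_group E\<^esub> n = Q ((i * int n) mod 7)"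
proof (induction n)
  case 0
  then show ?case by (simp add: nat_pow_def curve_group_def Q_simps)
next
  case (Suc n)
  have "Q i [^]\<^bsub>curve_group E\<^esub> Suc n = point_add E (Q ((i * int n) mod 7)) (Q i)"
    using Suc by (simp add: nat_pow_def curve_group_def)
  also have "\<dots> = Q ((i * int n mod 7 + i) mod 7)"
    using assms by (intro Q_add) auto
  also have "(i * int n mod 7 + i) mod 7 = i * int (Suc n) mod 7"
    by (simp add: mod_simps algebra_simps)
  finally show ?case .
qed

end

text \<open>The addition law shows uniqueness of the inverse: a sum is the point at infinity only for a point and
its reflection.\<close>

lemma curve_group_m_inv:
  assumes "on_curve E P" "on_curve E R" "point_add E P R = Infinity" "point_add E R P = Infinity"
  shows "inv\<^bsub>curve_group E\<^esub> P = R"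
proof -
  obtain a1 a2 a3 a4 a6 where E: "E = Weierstrass a1 a2 a3 a4 a6" by (cases E)
  have left_inverse: "R' = (case P of Infinity \<Rightarrow> Infinity | Affine x y \<Rightarrow> Affine x (- y - a1 * x - a3))"
    if "point_add E R' P = Infinity" for R'
    using that by (cases P; cases R') (simp_all add: E Let_def split: if_splits)
  have unique: "R' = R" if "point_add E R' P = Infinity" for R'
    using left_inverse[OF that] left_inverse[OF assms(4)] by (rule trans[OF _ sym])
  show ?thesis
    unfolding m_inv_def
  proof (rule the_equality)
    show "R \<in> carrier (curve_group E) \<and> P \<otimes>\<^bsub>curve_group E\<^esub> R = \<one>\<^bsub>curve_group E\<^esub> \<and>
       R \<otimes>\<^bsub>curve_group E\<^esub> P = \<one>\<^bsub>curve_group E\<^esub>"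
      using assms by (simp add: curve_group_def)
  next
    fix R' assume "R' \<in> carrier (curve_group E) \<and> P \<otimes>\<^bsub>curve_group E\<^esub> R' = \<one>\<^bsub>curve_group E\<^esub> \<and>
       R' \<otimes>\<^bsub>curve_group E\<^esub> P = \<one>\<^bsub>curve_group E\<^esub>"
    then have "point_add E R' P = Infinity" by (simp add: curve_group_def)
    then show "R' = R" by (rule unique)
  qed
qed

context heptagon
begin

lemma Q_subgroup: "subgroup (Q ` {0..6}) (curve_group E)"
proof
  show "Q ` {0..6} \<subseteq> carrier (curve_group E)" using Q_on_curve by (auto simp: curve_group_def)
  show "\<one>\<^bsub>curve_group E\<^esub> \<in> Q ` {0..6}"
    by (rule image_eqI[of _ _ 0]) (simp_all add: curve_group_def Q_simps)
next
  fix P R assume "P \<in> Q ` {0..6}" "R \<in> Q ` {0..6}"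
  then obtain i j where "i \<in> {0..6}" "P = Q i" "j \<in> {0..6}" "R = Q j" by blast
  then show "P \<otimes>\<^bsub>curve_group E\<^esub> R \<in> Q ` {0..6}"
    by (auto simp: curve_group_def Q_add intro!: imageI)
next
  fix P assume "P \<in> Q ` {0..6}"
  then obtain i where i: "i \<in> {0..6}" "P = Q i" by blast
  have "inv\<^bsub>curve_group E\<^esub> P = Q ((7 - i) mod 7)"
    using i Q_uminus[OF i(1)] point_add_commute[OF Q_on_curve Q_on_curve, of "(7 - i) mod 7" i]
    by (intro curve_group_m_inv Q_on_curve) (simp_all add: Q_on_curve)
  then show "inv\<^bsub>curve_group E\<^esub> P \<in> Q ` {0..6}" by (auto intro!: imageI)
qed

lemma Q_card: "card (Q ` {0..6}) = 7"
  using Q_inj by (simp add: card_image)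

end

section \<open>The discriminant of the family\<close>

text \<open>The quantities \<open>c2, c4, c6, c8\<close> are the invariants \<open>b\<^sub>2, b\<^sub>4, b\<^sub>6, b\<^sub>8\<close> after \<open>x \<mapsto> x + h\<close>. The discriminant changes by
a multiple of \<open>4 b\<^sub>8 - b\<^sub>2 b\<^sub>6 + b\<^sub>4\<^sup>2\<close>, which vanishes for every Weierstrass equation.\<close>

lemma discriminant_translate:
  fixes b2 b4 b6 b8 h :: "'a::field"
  assumes "4 * b8 = b2 * b6 - b4^2"
  defines "c2 \<equiv> b2 + 12 * h"
    and "c4 \<equiv> b4 + h * b2 + 6 * h^2"
    and "c6 \<equiv> b6 + 2 * h * b4 + h^2 * b2 + 4 * h^3"
    and "c8 \<equiv> b8 + 3 * h * b6 + 3 * h^2 * b4 + h^3 * b2 + 3 * h^4"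
  shows "- (c2^2 * c8) - 8 * c4^3 - 27 * c6^2 + 9 * c2 * c4 * c6 =
         - (b2^2 * b8) - 8 * b4^3 - 27 * b6^2 + 9 * b2 * b4 * b6"
proof -
  have "- (c2^2 * c8) - 8 * c4^3 - 27 * c6^2 + 9 * c2 * c4 * c6 =
         - (b2^2 * b8) - 8 * b4^3 - 27 * b6^2 + 9 * b2 * b4 * b6
         - (6 * b2 * h + 36 * h^2) * (4 * b8 - (b2 * b6 - b4^2))"
    unfolding c2_def c4_def c6_def c8_def
    by (simp add: power2_eq_square power3_eq_cube power4_eq_xxxx algebra_simps)
  then show ?thesis using assms(1) by simp
qed

text \<open>With \<open>d = r / t\<close> this is \<open>t\<^sup>3 (d\<^sup>3 - 8 d\<^sup>2 + 5 d + 1)\<close>. The cubic in \<open>d\<close> is the factor of the discriminant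
of Tate's normal form for a point of order 7 that vanishes at the three cusps other than
\<open>0, 1, \<infinity>\<close>.\<close>

definition cuspidal_form :: "'a::comm_ring_1 \<Rightarrow> 'a \<Rightarrow> 'a" where
  "cuspidal_form r t = r^3 - 8 * r^2 * t + 5 * r * t^2 + t^3"

text \<open>The invariants are those of the curve with \<open>a = 0\<close>, \<open>b = r\<close>, \<open>c = t\<close>, after \<open>V\<close> and \<open>s\<close> have been
eliminated by means of the normalisation.\<close>

lemma heptagon_discriminant_base:
  fixes r t :: "'a::field"
  assumes "r \<noteq> 0" "t \<noteq> 0" "r \<noteq> t"
  defines "S \<equiv> r^2 + t^2 - r * t"
  defines "b2 \<equiv> - (S^2) / (r * t * (t - r)) - 4 * (r + t)"
    and "b4 \<equiv> S * t / (t - r) + 2 * r * t"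
    and "b6 \<equiv> - r * t^3 / (t - r)"
    and "b8 \<equiv> r^2 * t^3 / (t - r)"
  shows "- (b2^2 * b8) - 8 * b4^3 - 27 * b6^2 + 9 * b2 * b4 * b6 = - (r * t * (t - r) * cuspidal_form r t)"
proof -
  define u where "u = t - r"
  have u: "u \<noteq> 0" "t = r + u" using assms by (simp_all add: u_def)
  define P where "P = - (S^2) - 4 * r * t * u * (r + t)"
  define B where "B = S * t + 2 * r * t * u"
  have b2: "b2 = P / (r * t * u)" and b4: "b4 = B / u"
    using assms(1,2) u(1) unfolding b2_def b4_def P_def B_def u_def[symmetric]
    by (simp_all add: field_simps)
  have "(- (b2^2 * b8) - 8 * b4^3 - 27 * b6^2 + 9 * b2 * b4 * b6) * u^3 =
      - t * P^2 - 8 * B^3 - 27 * r^2 * t^6 * u - 9 * t^2 * P * B"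
    unfolding b2 b4 b6_def b8_def u_def[symmetric]
    using assms(1,2) u(1) by (simp add: field_simps power2_eq_square power3_eq_cube eval_nat_numeral)
  also have "\<dots> = - (r * t * u * cuspidal_form r t) * u^3"
    unfolding P_def B_def S_def cuspidal_form_def u(2)
    by (simp add: eval_nat_numeral algebra_simps)
  finally have "(- (b2^2 * b8) - 8 * b4^3 - 27 * b6^2 + 9 * b2 * b4 * b6) * u^3 =
      - (r * t * u * cuspidal_form r t) * u^3" .
  moreover have "u^3 \<noteq> 0" using u(1) by simp
  ultimately show ?thesis unfolding u_def[symmetric] by (rule mult_right_cancel[THEN iffD1, rotated])
qed

context heptagon
begin

lemma heptagon_discriminant:
  "discriminant E = (a - b) * (b - c) * (c - a) * - cuspidal_form (b - a) (c - a)"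
proof -
  define r where "r = b - a"
  define t where "t = c - a"
  have bc: "b = a + r" "c = a + t" by (simp_all add: r_def t_def)
  define S where "S = r^2 + t^2 - r * t"
  define e where "e = (2 * s - 1)^2"
  define A where "A = e * V^2 * S^2"
  define C where "C = e * V^2 * (r * t^2)^2"
  define B where "B = - (e * V^2 * S * (r * t^2))"
  define \<kappa> where "\<kappa> = s^2 - s"
  have e: "e = 1 + 4 * \<kappa>" by (simp add: e_def \<kappa>_def power2_eq_square algebra_simps)
  have nz: "r \<noteq> 0" "t \<noteq> 0" "r \<noteq> t" using distinct by (auto simp: r_def t_def)
  have "e * V^2 * (r * t * (t - r)) = -1"
  proof -
    have "r * t * (t - r) = (a - b) * (b - c) * (c - a)" by (simp add: r_def t_def algebra_simps)
    then show ?thesis using normalised by (simp add: e_def)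
  qed
  then have eV: "e * V^2 = - 1 / (r * t * (t - r))" using nz by (simp add: field_simps)
  define b2 where "b2 = A - 4 * (r + t)"
  define b4 where "b4 = B + 2 * r * t"
  define b8 where "b8 = - (B * (r * t) + C * (r + t)) - (r * t)^2"
  have \<alpha>: "\<alpha> = - V * S"
    unfolding heptagon_slope_def bc S_def by (simp add: power2_eq_square algebra_simps)
  have \<beta>: "heptagon_intercept V a b c = V * (r * t^2) + V * S * a"
    unfolding heptagon_intercept_def bc S_def by (simp add: power2_eq_square algebra_simps)
  \<comment> \<open>the invariants of \<open>E\<close>, which is the curve with \<open>a = 0\<close> translated by \<open>- a\<close>\<close>
  define c2 where "c2 = b2 + 12 * (- a)"
  define c4 where "c4 = b4 + (- a) * b2 + 6 * (-a)^2"
  define c6 where "c6 = C + 2 * (- a) * b4 + (-a)^2 * b2 + 4 * (-a)^3"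
  define c8 where "c8 = b8 + 3 * (- a) * C + 3 * (-a)^2 * b4 + (-a)^3 * b2 + 3 * (-a)^4"
  have "discriminant E = - (c2^2 * c8) - 8 * c4^3 - 27 * c6^2 + 9 * c2 * c4 * c6"
  proof -
    define T where "T = r * t^2"
    define a1 where "a1 = V * S"
    define a2 where "a2 = \<kappa> * (V * S)^2 - (a + b + c)"
    define a3 where "a3 = - (V * T + V * S * a)"
    define a4 where "a4 = a * b + b * c + c * a - 2 * \<kappa> * (V * S) * (V * T + V * S * a)"
    define a6 where "a6 = \<kappa> * (V * T + V * S * a)^2 - a * b * c"
    note ABC = A_def B_def C_def T_def[symmetric] e
    have "E = Weierstrass a1 a2 a3 a4 a6"
      unfolding heptagon_curve_def Let_def \<alpha> \<beta> \<kappa>_def[symmetric] a1_def a2_def a3_def a4_def a6_def T_def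
      by simp
    moreover have "a1^2 + 4 * a2 = c2"
      unfolding c2_def b2_def ABC a1_def a2_def bc by (simp add: eval_nat_numeral algebra_simps)
    moreover have "2 * a4 + a1 * a3 = c4"
      unfolding c4_def b4_def b2_def ABC a1_def a3_def a4_def bc by (simp add: eval_nat_numeral algebra_simps)
    moreover have "a3^2 + 4 * a6 = c6"
      unfolding c6_def b4_def b2_def ABC a3_def a6_def bc by (simp add: eval_nat_numeral algebra_simps)
    moreover have "a1^2 * a6 + 4 * a2 * a6 - a1 * a3 * a4 + a2 * a3^2 - a4^2 = c8"
      unfolding c8_def b8_def b4_def b2_def ABC a1_def a2_def a3_def a4_def a6_def bc
      by (simp add: eval_nat_numeral algebra_simps)
    ultimately show ?thesis by (simp add: Let_def)
  qed
  also have "\<dots> = - (b2^2 * b8) - 8 * b4^3 - 27 * C^2 + 9 * b2 * b4 * C"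
    unfolding c2_def c4_def c6_def c8_def
  proof (rule discriminant_translate)
    show "4 * b8 = b2 * C - b4^2"
      unfolding b8_def b2_def b4_def A_def B_def C_def by (simp add: eval_nat_numeral algebra_simps)
  qed
  also have "b2 = - (S^2) / (r * t * (t - r)) - 4 * (r + t)"
    using nz by (simp add: b2_def A_def eV)
  also have "b4 = S * t / (t - r) + 2 * r * t"
    unfolding b4_def B_def eV using nz by (simp add: field_simps power2_eq_square)
  also have C: "C = - r * t^3 / (t - r)"
    unfolding C_def eV using nz by (simp add: field_simps power2_eq_square power3_eq_cube)
  also have "b8 = r^2 * t^3 / (t - r)"
  proof -
    have B: "B * (t - r) = S * t"
      unfolding B_def eV using nz by (simp add: field_simps power2_eq_square)
    have C': "C * (t - r) = - r * t^3" unfolding C using nz by simp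
    have "b8 * (t - r) = - ((B * (t - r)) * (r * t) + (C * (t - r)) * (r + t)) - (r * t)^2 * (t - r)"
      unfolding b8_def by (simp add: algebra_simps)
    also have "\<dots> = r^2 * t^3"
      unfolding B C' S_def by (simp add: eval_nat_numeral algebra_simps)
    finally have "b8 * (t - r) = r^2 * t^3" .
    then show ?thesis using nz by (simp add: eq_divide_eq)
  qed
  also note heptagon_discriminant_base[OF nz, folded S_def]
  also have "- (r * t * (t - r) * cuspidal_form r t) = (a - b) * (b - c) * (c - a) * - cuspidal_form r t"
    by (simp add: bc algebra_simps)
  finally show ?thesis by (simp add: r_def t_def)
qed

end

section \<open>Members of the family with a prescribed character\<close>

lemma sum_1_6:
  fixes f :: "int \<Rightarrow> 'a::comm_monoid_add"
  shows "(\<Sum>i = 1..6. f i) = f 1 + f 2 + f 3 + f 4 + f 5 + f 6"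
proof -
  have "{1..6 :: int} = {1, 2, 3, 4, 5, 6}" by auto
  then show ?thesis by (simp add: add.assoc)
qed

lemma map_weierstrass_heptagon_curve:
  assumes "field_hom h"
  shows "map_weierstrass h (heptagon_curve \<kappa> V a b c) = heptagon_curve (h \<kappa>) (h V) (h a) (h b) (h c)"
proof -
  interpret field_hom h by fact
  show ?thesis
    by (simp add: heptagon_curve_def Let_def heptagon_slope_def heptagon_intercept_def hom_distribs)
qed

lemma map_heptagon_line:
  assumes "field_hom h"
  shows "h (heptagon_line V a b c x) = heptagon_line (h V) (h a) (h b) (h c) (h x)"
proof -
  interpret field_hom h by fact
  show ?thesis
    by (simp add: heptagon_line_def heptagon_slope_def heptagon_intercept_def hom_distribs)
qed

lemma discriminant_map_weierstrass:
  assumes "field_hom h"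
  shows "discriminant (map_weierstrass h E) = h (discriminant E)"
proof -
  interpret field_hom h by fact
  show ?thesis by (cases E) (simp add: Let_def hom_distribs)
qed

lemma cuspidal_form_scale: "cuspidal_form (l * x) (l * y) = l^3 * cuspidal_form x y"
  by (simp add: cuspidal_form_def eval_nat_numeral algebra_simps)

context separably_closed_extension
begin

lemma weierstrass_descent:
  assumes "\<And>\<sigma>. \<sigma> \<in> Gal \<Longrightarrow> map_weierstrass \<sigma> E = E"
  obtains E0 where "map_weierstrass emb E0 = E"
proof -
  obtain a1 a2 a3 a4 a6 where E: "E = Weierstrass a1 a2 a3 a4 a6" by (cases E)
  have "a1 \<in> range emb" "a2 \<in> range emb" "a3 \<in> range emb" "a4 \<in> range emb" "a6 \<in> range emb"
    by (rule fixed_field; use assms in \<open>simp add: E\<close>)+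
  then obtain b1 b2 b3 b4 b6 where "a1 = emb b1" "a2 = emb b2" "a3 = emb b3" "a4 = emb b4" "a6 = emb b6"
    by blast
  then have "map_weierstrass emb (Weierstrass b1 b2 b3 b4 b6) = E" by (simp add: E)
  then show ?thesis by (rule that)
qed

lemma character_cases:
  assumes "\<psi> \<in> carrier (character_group emb)" "\<sigma> \<in> Gal"
  shows "\<psi> \<sigma> \<in> {1, 2, 3, 4, 5, 6}"
  using character_range[OF assms] by auto

lemma heptagon_s_equivariant:
  assumes "g \<in> {1, 2, 3, 4, 5, 6}" "i \<in> {1, 2, 3, 4, 5, 6}" "field_hom \<sigma>"
    and "\<sigma> s = (if g \<in> {1, 2, 4} then s else 1 - s)"
  shows "\<sigma> (heptagon_s s i) = heptagon_s s (g * i mod 7)"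
proof -
  interpret field_hom \<sigma> by fact
  have "\<sigma> (1 - s) = (if g \<in> {1, 2, 4} then 1 - s else s)"
    using assms(4) by (simp add: hom_distribs)
  then show ?thesis
    using assms(1,2,4) unfolding heptagon_s_def by (elim insertE emptyE) simp_all
qed

text \<open>The Galois group permutes \<open>X 1\<close>, \<open>X 2\<close>, \<open>X 4\<close> cyclically and sends \<open>s\<close> to \<open>s\<close> or \<open>1 - s\<close>. Both changes
leave the curve unchanged, so that it descends to \<open>k\<close>, and they move \<open>Q i\<close> to \<open>Q (\<psi> \<sigma> i)\<close>.\<close>

lemma curve_with_character:
  assumes \<psi>: "\<psi> \<in> carrier (character_group emb)"
    and X: "\<And>\<sigma> i. \<sigma> \<in> Gal \<Longrightarrow> i \<in> {1..6} \<Longrightarrow> \<sigma> (X i) = X (\<psi> \<sigma> * i mod 7)"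
    and even: "X 6 = X 1" "X 5 = X 2" "X 3 = X 4"
    and X_distinct: "X 1 \<noteq> X 2" "X 2 \<noteq> X 4" "X 4 \<noteq> X 1"
    and cusp: "cuspidal_form (X 2 - X 1) (X 4 - X 1) \<noteq> 0"
    and s: "\<And>\<sigma>. \<sigma> \<in> Gal \<Longrightarrow> \<sigma> s = (if \<psi> \<sigma> \<in> {1, 2, 4} then s else 1 - s)"
    and s_nz: "2 * s - 1 \<noteq> 0"
  shows "\<exists>E \<Psi>. elliptic_curve E \<and> rational_subgroup emb E \<Psi> \<and> card \<Psi> = 7 \<and> acts_via emb E \<Psi> \<psi>"
proof -
  define e where "e = (2 * s - 1)^2"
  define D where "D = (X 1 - X 2) * (X 2 - X 4) * (X 4 - X 1)"
  \<comment> \<open>scaling the abscissae by \<open>r\<close> multiplies \<open>D\<close> by \<open>r\<^sup>3\<close> and achieves the normalisation\<close>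
  define r where "r = - 1 / (e * D)"
  define V where "V = e * D"
  define a where "a = r * X 1"
  define b where "b = r * X 2"
  define c where "c = r * X 4"
  have e: "e \<noteq> 0" using s_nz by (simp add: e_def)
  have D: "D \<noteq> 0" using X_distinct by (simp add: D_def)
  have r: "r \<noteq> 0" using e D by (simp add: r_def)
  interpret heptagon s V a b c
  proof
    show "a \<noteq> b" "b \<noteq> c" "c \<noteq> a" using X_distinct r by (simp_all add: a_def b_def c_def)
    have "(a - b) * (b - c) * (c - a) = r^3 * D"
      by (simp add: a_def b_def c_def D_def power3_eq_cube algebra_simps)
    then have "e * V^2 * ((a - b) * (b - c) * (c - a)) = (e * D * r)^3"
      by (simp add: V_def power2_eq_square power3_eq_cube algebra_simps)
    also have "e * D * r = - 1" using e D by (simp add: r_def)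
    finally show "(2 * s - 1)^2 * V^2 * ((a - b) * (b - c) * (c - a)) = -1" by (simp add: e_def)
  qed
  have \<sigma>: "\<sigma> r = r \<and> \<sigma> (s^2 - s) = s^2 - s \<and> \<sigma> V = V \<and>
      (\<sigma> a = a \<and> \<sigma> b = b \<and> \<sigma> c = c \<or> \<sigma> a = b \<and> \<sigma> b = c \<and> \<sigma> c = a \<or> \<sigma> a = c \<and> \<sigma> b = a \<and> \<sigma> c = b)"
    if "\<sigma> \<in> Gal" for \<sigma>
  proof -
    interpret field_hom \<sigma> using that by (rule Gal_field_hom)
      have s2: "\<sigma> s = s \<or> \<sigma> s = 1 - s" using s[OF that] by (simp split: if_splits)
    have "(2 * (1 - s) - 1)^2 = (2 * s - 1)^2" "(1 - s)^2 - (1 - s) = s^2 - s"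
      by (simp_all add: power2_eq_square algebra_simps)
    then have "(2 * \<sigma> s - 1)^2 = (2 * s - 1)^2" "(\<sigma> s)^2 - \<sigma> s = s^2 - s" using s2 by auto
    then have \<sigma>e: "\<sigma> e = e" and \<sigma>\<kappa>: "\<sigma> (s^2 - s) = s^2 - s"
      unfolding e_def by (simp_all add: hom_distribs)
    have X3: "\<sigma> (X 1) = X 1 \<and> \<sigma> (X 2) = X 2 \<and> \<sigma> (X 4) = X 4 \<or>
          \<sigma> (X 1) = X 2 \<and> \<sigma> (X 2) = X 4 \<and> \<sigma> (X 4) = X 1 \<or>
          \<sigma> (X 1) = X 4 \<and> \<sigma> (X 2) = X 1 \<and> \<sigma> (X 4) = X 2"
      using character_cases[OF \<psi> that] X[OF that, of 1] X[OF that, of 2] X[OF that, of 4] even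
      by (elim insertE emptyE) simp_all
    then have \<sigma>D: "\<sigma> D = D"
      unfolding D_def by (elim disjE conjE) (simp_all add: hom_distribs)
    have \<sigma>r: "\<sigma> r = r" by (simp add: r_def hom_distribs \<sigma>e \<sigma>D)
    moreover have "\<sigma> V = V" by (simp add: V_def hom_distribs \<sigma>e \<sigma>D)
    moreover note \<sigma>\<kappa>
    moreover have "\<sigma> a = r * \<sigma> (X 1)" "\<sigma> b = r * \<sigma> (X 2)" "\<sigma> c = r * \<sigma> (X 4)"
      by (simp_all add: a_def b_def c_def hom_distribs \<sigma>r)
    ultimately show ?thesis using X3 by (auto simp: a_def b_def c_def)
  qed
  note rot = heptagon_curve_rotate[of _ V b c a] heptagon_curve_rotate[of _ V c a b]
    heptagon_line_rotate[of V b c a] heptagon_line_rotate[of V c a b]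
  have \<sigma>E: "map_weierstrass \<sigma> E = E" if "\<sigma> \<in> Gal" for \<sigma>
    using \<sigma>[OF that] unfolding map_weierstrass_heptagon_curve[OF Gal_field_hom[OF that]]
    by (elim disjE conjE) (simp_all add: rot)
  have \<sigma>W: "\<sigma> (W x) = W (\<sigma> x)" if "\<sigma> \<in> Gal" for \<sigma> x
    using \<sigma>[OF that] unfolding map_heptagon_line[OF Gal_field_hom[OF that]]
    by (elim disjE conjE) (simp_all add: rot)
  obtain E0 where E0: "map_weierstrass emb E0 = E" using weierstrass_descent[OF \<sigma>E] by blast
  have "b - a = r * (X 2 - X 1)" "c - a = r * (X 4 - X 1)"
    by (simp_all add: a_def b_def c_def algebra_simps)
  then have "cuspidal_form (b - a) (c - a) = r^3 * cuspidal_form (X 2 - X 1) (X 4 - X 1)"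
    by (simp only: cuspidal_form_scale)
  then have "discriminant E \<noteq> 0"
    using cusp r distinct unfolding heptagon_discriminant by simp
  then have "elliptic_curve E0"
    unfolding elliptic_curve_def E0[symmetric] discriminant_map_weierstrass[OF emb.field_hom_axioms]
    by auto
  have X_i: "heptagon_x a b c i = r * X i" if "i \<in> {1, 2, 3, 4, 5, 6}" for i
    using that even by (elim insertE emptyE) (simp_all add: heptagon_x_def a_def b_def c_def)
  have \<sigma>Q: "map_point \<sigma> (Q i) = Q (i * \<psi> \<sigma> mod 7)" if "\<sigma> \<in> Gal" "i \<in> {0..6}" for \<sigma> i
  proof (cases "i = 0")
    case False
    interpret field_hom \<sigma> using that(1) by (rule Gal_field_hom)
    define j where "j = \<psi> \<sigma> * i mod 7"
    have g: "\<psi> \<sigma> \<in> {1, 2, 3, 4, 5, 6}" using character_cases[OF \<psi> that(1)] .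
    have i: "i \<in> {1, 2, 3, 4, 5, 6}" using that(2) False by auto
    have j: "j \<in> {1, 2, 3, 4, 5, 6}" unfolding j_def using g i by (elim insertE emptyE) simp_all
    have "\<sigma> (heptagon_x a b c i) = heptagon_x a b c j"
      unfolding X_i[OF i] X_i[OF j] using X[OF that(1), of i] \<sigma>[OF that(1)] i
      by (auto simp: hom_distribs j_def)
    moreover have "\<sigma> (heptagon_s s i) = heptagon_s s j"
      unfolding j_def using g i Gal_field_hom[OF that(1)] s[OF that(1)] by (rule heptagon_s_equivariant)
    moreover have "j \<noteq> 0" using j by auto
    ultimately show ?thesis
      using False unfolding Q_def by (simp add: hom_distribs \<sigma>W[OF that(1)] j_def mult.commute)
  qed (simp add: Q_simps)
  have "rational_subgroup emb E0 (Q ` {0..6})"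
    unfolding rational_subgroup_def E0 using Q_subgroup by (auto simp: \<sigma>Q intro!: imageI)
  moreover have "acts_via emb E0 (Q ` {0..6}) \<psi>"
    unfolding acts_via_def E0
  proof (intro ballI)
    fix \<sigma> P assume \<sigma>: "\<sigma> \<in> Gal" and "P \<in> Q ` {0..6}"
    then obtain i where i: "i \<in> {0..6}" "P = Q i" by blast
    obtain n where n: "\<psi> \<sigma> = int n"
      using character_range[OF \<psi> \<sigma>] by (metis atLeastAtMost_iff zero_le_imp_eq_int zero_le_one order_trans)
    have "P [^]\<^bsub>curve_group E\<^esub> \<psi> \<sigma> = Q (i * \<psi> \<sigma> mod 7)"
      unfolding n i(2) int_pow_int by (rule Q_pow[OF i(1)])
    then show "map_point \<sigma> P = P [^]\<^bsub>curve_group E\<^esub> \<psi> \<sigma>" using \<sigma>Q[OF \<sigma> i(1)] i(2) by simp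
  qed
  ultimately show ?thesis using \<open>elliptic_curve E0\<close> Q_card by blast
qed

text \<open>Let \<open>u\<close> and \<open>v\<close> be the sums of the resolvents with square and with nonsquare index. Away from
characteristic 2 take \<open>s = (1 + u - v) / 2\<close>, and in characteristic 2 take \<open>s = u / (u + v)\<close>.\<close>

lemma quadratic_element:
  assumes \<psi>: "\<psi> \<in> carrier (character_group emb)"
  obtains s where "\<And>\<sigma>. \<sigma> \<in> Gal \<Longrightarrow> \<sigma> s = (if \<psi> \<sigma> \<in> {1, 2, 4} then s else 1 - s)" "2 * s - 1 \<noteq> 0"
proof -
  \<comment> \<open>the combination \<open>u - v\<close> tests \<open>2 s \<noteq> 1\<close>; in characteristic 2 it is written \<open>u + v\<close>, the denominator of \<open>s\<close>\<close>
  define w where "w = (if (2::'l) = 0 then 1 else - 1 :: 'l)"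
  define c where "c i = (if i \<in> {1, 2, 4} then 1 else w)" for i :: int
  obtain t where t: "\<And>\<sigma> a. \<sigma> \<in> Gal \<Longrightarrow> a \<in> {1..6} \<Longrightarrow> \<sigma> (t a) = t (\<psi> \<sigma> * a mod 7)"
    and nz: "(\<Sum>a=1..6. c a * t a) \<noteq> 0"
    by (rule resolvent[OF \<psi>, of c]) (auto simp: c_def)
  define u where "u = t 1 + t 2 + t 4"
  define v where "v = t 3 + t 5 + t 6"
  have uv: "u + w * v \<noteq> 0" using nz by (simp add: sum_1_6 c_def u_def v_def algebra_simps)
  have \<sigma>: "\<sigma> u = (if \<psi> \<sigma> \<in> {1, 2, 4} then u else v) \<and> \<sigma> v = (if \<psi> \<sigma> \<in> {1, 2, 4} then v else u)"
    if "\<sigma> \<in> Gal" for \<sigma>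
  proof -
    interpret field_hom \<sigma> using that by (rule Gal_field_hom)
    show ?thesis
      using character_cases[OF \<psi> that] t[OF that, of 1] t[OF that, of 2] t[OF that, of 3]
        t[OF that, of 4] t[OF that, of 5] t[OF that, of 6]
      unfolding u_def v_def by (elim insertE emptyE) (simp_all add: hom_distribs ac_simps)
  qed
  show ?thesis
  proof (cases "(2::'l) = 0")
    case True
    then have nz: "u + v \<noteq> 0" using uv by (simp add: w_def)
    show ?thesis
    proof (rule that[of "u / (u + v)"])
      fix \<sigma> assume "\<sigma> \<in> Gal"
      then interpret field_hom \<sigma> by (rule Gal_field_hom)
      have "1 - u / (u + v) = v / (u + v)" using nz by (simp add: field_simps)
      then show "\<sigma> (u / (u + v)) = (if \<psi> \<sigma> \<in> {1, 2, 4} then u / (u + v) else 1 - u / (u + v))"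
        using \<sigma>[OF \<open>\<sigma> \<in> Gal\<close>] by (simp add: hom_distribs add.commute)
    qed (simp add: True)
  next
    case False
    then have nz: "u - v \<noteq> 0" using uv by (simp add: w_def)
    show ?thesis
    proof (rule that[of "(1 + (u - v)) / 2"])
      fix \<sigma> assume "\<sigma> \<in> Gal"
      then interpret field_hom \<sigma> by (rule Gal_field_hom)
      have minus: "1 - (1 + (u - v)) / 2 = (1 + (v - u)) / 2" using False by (simp add: field_simps)
      show "\<sigma> ((1 + (u - v)) / 2) = (if \<psi> \<sigma> \<in> {1, 2, 4} then (1 + (u - v)) / 2 else 1 - (1 + (u - v)) / 2)"
        unfolding minus using \<sigma>[OF \<open>\<sigma> \<in> Gal\<close>] by (simp add: hom_distribs)
    qed (use nz False in simp)
  qed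
qed

text \<open>A single inequality suffices because an automorphism with \<open>\<psi> \<sigma> \<noteq> \<plusminus>1\<close> permutes the three elements in a
cycle of length 3.\<close>

lemma cubic_distinct:
  assumes \<psi>: "\<psi> \<in> carrier (character_group emb)"
    and X: "\<And>\<sigma> i. \<sigma> \<in> Gal \<Longrightarrow> i \<in> {1..6} \<Longrightarrow> \<sigma> (X i) = X (\<psi> \<sigma> * i mod 7)"
    and even: "X 6 = X 1" "X 5 = X 2" "X 3 = X 4"
    and \<sigma>: "\<sigma> \<in> Gal" "\<psi> \<sigma> \<notin> {1, 6}" and ne: "X 1 \<noteq> X 2"
  shows "X 2 \<noteq> X 4" "X 4 \<noteq> X 1"
proof -
  interpret field_hom \<sigma> using \<sigma>(1) by (rule Gal_field_hom)
  have "X 2 \<noteq> X 4 \<and> X 4 \<noteq> X 1"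
  proof (cases "\<psi> \<sigma> \<in> {2, 5}")
    case True
    then have "\<sigma> (X 1) = X 2" "\<sigma> (X 2) = X 4" "\<sigma> (X 4) = X 1"
      using X[OF \<sigma>(1), of 1] X[OF \<sigma>(1), of 2] X[OF \<sigma>(1), of 4] even by auto
    then show ?thesis using ne by (metis injectivity)
  next
    case False
    then have "\<psi> \<sigma> = 3 \<or> \<psi> \<sigma> = 4" using \<sigma>(2) character_cases[OF \<psi> \<sigma>(1)] by blast
    then have "\<sigma> (X 1) = X 4" "\<sigma> (X 2) = X 1" "\<sigma> (X 4) = X 2"
      using X[OF \<sigma>(1), of 1] X[OF \<sigma>(1), of 2] X[OF \<sigma>(1), of 4] even by auto
    then show ?thesis using ne by (metis injectivity)
  qed
  then show "X 2 \<noteq> X 4" "X 4 \<noteq> X 1" by blast+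
qed

lemma cubic_elements:
  assumes \<psi>: "\<psi> \<in> carrier (character_group emb)"
    and \<sigma>0: "\<sigma>0 \<in> Gal" "\<psi> \<sigma>0 \<notin> {1, 6}"
  obtains X :: "int \<Rightarrow> 'l" where
    "\<And>\<sigma> i. \<sigma> \<in> Gal \<Longrightarrow> i \<in> {1..6} \<Longrightarrow> \<sigma> (X i) = X (\<psi> \<sigma> * i mod 7)"
    "X 6 = X 1" "X 5 = X 2" "X 3 = X 4" "X 1 \<noteq> X 2" "X 2 \<noteq> X 4" "X 4 \<noteq> X 1"
proof -
  define c where "c i = (if i \<in> {1, 6} then 1 else if i \<in> {2, 5} then - 1 else 0 :: 'l)" for i :: int
  obtain t where t: "\<And>\<sigma> a. \<sigma> \<in> Gal \<Longrightarrow> a \<in> {1..6} \<Longrightarrow> \<sigma> (t a) = t (\<psi> \<sigma> * a mod 7)"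
    and nz: "(\<Sum>a=1..6. c a * t a) \<noteq> 0"
    by (rule resolvent[OF \<psi>, of c]) (auto simp: c_def)
  define X where "X i = t i + t (7 - i)" for i
  have X: "\<sigma> (X i) = X (\<psi> \<sigma> * i mod 7)" if \<sigma>: "\<sigma> \<in> Gal" and i: "i \<in> {1..6}" for \<sigma> i
  proof -
    interpret field_hom \<sigma> using \<sigma> by (rule Gal_field_hom)
    have i': "i \<in> {1, 2, 3, 4, 5, 6}" using i by auto
    have "\<psi> \<sigma> * (7 - i) mod 7 = 7 - \<psi> \<sigma> * i mod 7"
      using character_cases[OF \<psi> \<sigma>] i' by (elim insertE emptyE) simp_all
    then show ?thesis using t[OF \<sigma> i] t[OF \<sigma>, of "7 - i"] i by (simp add: X_def hom_distribs)
  qed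
  have even: "X 6 = X 1" "X 5 = X 2" "X 3 = X 4" by (simp_all add: X_def add.commute)
  have "(\<Sum>a=1..6. c a * t a) = X 1 - X 2" by (simp add: sum_1_6 c_def X_def)
  then have "X 1 \<noteq> X 2" using nz by simp
  then show ?thesis using that[of X, OF X even] cubic_distinct[OF \<psi> X even \<sigma>0] by blast
qed

text \<open>If the cuspidal form vanishes for \<open>X\<close>, try \<open>X\<^sup>2 + v X\<close> with \<open>v\<close> in \<open>k\<close>. As a function of \<open>v\<close> the form is
then a polynomial of degree at most 2, because its cubic coefficient is the value for \<open>X\<close>. It is not
zero: at \<open>v = - (X 1 + X 2)\<close>, where the first two elements coincide, the form is a cube of a nonzero
element. So it cannot vanish at the three elements \<open>0, 1, u\<close> of \<open>k\<close>.\<close>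

lemma cubic_elements_noncuspidal:
  fixes u :: 'k
  assumes \<psi>: "\<psi> \<in> carrier (character_group emb)"
    and \<sigma>0: "\<sigma>0 \<in> Gal" "\<psi> \<sigma>0 \<notin> {1, 6}"
    and u: "u \<noteq> 0" "u \<noteq> 1"
  obtains X :: "int \<Rightarrow> 'l" where
    "\<And>\<sigma> i. \<sigma> \<in> Gal \<Longrightarrow> i \<in> {1..6} \<Longrightarrow> \<sigma> (X i) = X (\<psi> \<sigma> * i mod 7)"
    "X 6 = X 1" "X 5 = X 2" "X 3 = X 4" "X 1 \<noteq> X 2" "X 2 \<noteq> X 4" "X 4 \<noteq> X 1"
    "cuspidal_form (X 2 - X 1) (X 4 - X 1) \<noteq> 0"
proof -
  obtain X where X: "\<And>\<sigma> i. \<sigma> \<in> Gal \<Longrightarrow> i \<in> {1..6} \<Longrightarrow> \<sigma> (X i) = X (\<psi> \<sigma> * i mod 7)"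
    and even: "X 6 = X 1" "X 5 = X 2" "X 3 = X 4"
    and ne: "X 1 \<noteq> X 2" "X 2 \<noteq> X 4" "X 4 \<noteq> X 1"
    using cubic_elements[OF \<psi> \<sigma>0] by blast
  show ?thesis
  proof (cases "cuspidal_form (X 2 - X 1) (X 4 - X 1) = 0")
    case True
    define Y where "Y v i = X i * (X i + emb v)" for v i
    define R where "R = X 2 - X 1"
    define T where "T = X 4 - X 1"
    define A where "A = X 1 + X 2"
    define B where "B = X 1 + X 4"
    have diff: "Y v 2 - Y v 1 = R * (A + emb v)" "Y v 4 - Y v 1 = T * (B + emb v)" for v
      by (simp_all add: Y_def R_def T_def A_def B_def algebra_simps)
    define \<alpha> where "\<alpha> = R^3 * A^3 - 8 * R^2 * T * A^2 * B + 5 * R * T^2 * A * B^2 + T^3 * B^3"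
    define \<beta> where "\<beta> = 3 * R^3 * A^2 - 8 * R^2 * T * (A^2 + 2 * A * B) + 5 * R * T^2 * (B^2 + 2 * A * B) + 3 * T^3 * B^2"
    define \<gamma> where "\<gamma> = 3 * R^3 * A - 8 * R^2 * T * (2 * A + B) + 5 * R * T^2 * (A + 2 * B) + 3 * T^3 * B"
    have quadratic: "cuspidal_form (R * (A + v)) (T * (B + v)) = \<alpha> + \<beta> * v + \<gamma> * v^2" for v
    proof -
      have "cuspidal_form (R * (A + v)) (T * (B + v)) = \<alpha> + \<beta> * v + \<gamma> * v^2 + cuspidal_form R T * v^3"
        unfolding \<alpha>_def \<beta>_def \<gamma>_def cuspidal_form_def by (simp add: eval_nat_numeral algebra_simps)
      then show ?thesis using True by (simp add: R_def T_def)
    qed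
    have "\<exists>v. cuspidal_form (Y v 2 - Y v 1) (Y v 4 - Y v 1) \<noteq> 0"
    proof (rule ccontr)
      assume "\<nexists>v. cuspidal_form (Y v 2 - Y v 1) (Y v 4 - Y v 1) \<noteq> 0"
      then have zero: "\<alpha> + \<beta> * emb v + \<gamma> * (emb v)^2 = 0" for v unfolding diff quadratic by blast
      have "\<alpha> = 0" using zero[of 0] by simp
      moreover from this have "\<gamma> = - \<beta>" using zero[of 1] by (simp add: add_eq_0_iff)
      ultimately have "\<beta> * (emb u * (1 - emb u)) = 0" using zero[of u] by (simp add: power2_eq_square algebra_simps)
      then have "\<beta> = 0" using u by auto
      then have "cuspidal_form (R * (A + - A)) (T * (B + - A)) = 0"
        unfolding quadratic using \<open>\<alpha> = 0\<close> \<open>\<gamma> = - \<beta>\<close> by simp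
      then have "(T * (B - A))^3 = 0" by (simp add: cuspidal_form_def)
      moreover have "T \<noteq> 0" "B - A \<noteq> 0" using ne by (auto simp: T_def A_def B_def)
      ultimately show False by simp
    qed
    then obtain v where v: "cuspidal_form (Y v 2 - Y v 1) (Y v 4 - Y v 1) \<noteq> 0" by blast
    have Y: "\<sigma> (Y v i) = Y v (\<psi> \<sigma> * i mod 7)" if "\<sigma> \<in> Gal" "i \<in> {1..6}" for \<sigma> i
    proof -
      interpret field_hom \<sigma> using that(1) by (rule Gal_field_hom)
      show ?thesis using X[OF that] Gal_emb[OF that(1)] by (simp add: Y_def hom_distribs)
    qed
    have Y_even: "Y v 6 = Y v 1" "Y v 5 = Y v 2" "Y v 3 = Y v 4" by (simp_all add: Y_def even)
    have "Y v 1 \<noteq> Y v 2"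
    proof
      interpret field_hom \<sigma>0 using \<sigma>0(1) by (rule Gal_field_hom)
      assume "Y v 1 = Y v 2"
      then have "R * (A + emb v) = 0" using diff(1)[of v] by simp
      moreover have "R \<noteq> 0" using ne by (simp add: R_def)
      ultimately have "A + emb v = 0" by simp
      then have A: "A = emb (- v)" by (simp add: hom_distribs eq_neg_iff_add_eq_0)
      then have "\<sigma>0 A = A" using Gal_emb[OF \<sigma>0(1), of "- v"] by simp
      moreover have "\<sigma>0 A = X 2 + X 4 \<or> \<sigma>0 A = X 4 + X 1"
        using character_cases[OF \<psi> \<sigma>0(1)] \<sigma>0(2) X[OF \<sigma>0(1), of 1] X[OF \<sigma>0(1), of 2] even
        unfolding A_def by (elim insertE emptyE) (simp_all add: hom_distribs)
      ultimately show False using ne by (auto simp: A_def)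
    qed
    then show ?thesis using that[of "Y v", OF Y Y_even] cubic_distinct[OF \<psi> Y Y_even \<sigma>0] v by blast
  qed (use that[of X] X even ne in blast)
qed

text \<open>The value at \<open>- 1\<close> is 13, and in characteristic 13 the value at 3 is 49. In characteristic 2 the values at
\<open>u\<close> and \<open>u + 1\<close> differ by \<open>u\<^sup>2 + u\<close>, which is nonzero for \<open>u\<close> outside the prime field.\<close>

lemma noncuspidal_parameter:
  assumes "CARD('k) \<noteq> 2"
  obtains u :: 'k where "u \<noteq> 0" "u \<noteq> 1" "cuspidal_form 1 u \<noteq> 0"
proof (cases "(2::'k) = 0")
  case True
  obtain u :: 'k where u: "u \<noteq> 0" "u \<noteq> 1"
  proof -
    have "UNIV \<noteq> {0, 1::'k}" using assms by (metis card_2_iff zero_neq_one)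
    then show ?thesis using that by blast
  qed
  have *: "(8::'k) = 2 * 2 * 2" "(5::'k) = 1 + 2 * 2" by simp_all
  have form: "cuspidal_form 1 v = 1 + v^2 + v^3" for v :: 'k
    unfolding cuspidal_form_def * True by simp
  have "cuspidal_form 1 (u + 1) - cuspidal_form 1 u = u * (u - 1) + 2 * (u^2 + 3 * u + 1)"
    unfolding form by (simp add: eval_nat_numeral algebra_simps)
  then have "cuspidal_form 1 (u + 1) - cuspidal_form 1 u = u * (u - 1)" using True by simp
  then have "cuspidal_form 1 u \<noteq> 0 \<or> cuspidal_form 1 (u + 1) \<noteq> 0" using u by auto
  moreover have "u + 1 \<noteq> 0" using u(2) True by (metis add.commute add_left_cancel one_add_one)
  ultimately show ?thesis using u that[of u] that[of "u + 1"] by auto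
next
  case False
  have *: "(1::'k) \<noteq> - 1" using False by (metis add.right_inverse one_add_one)
  have 13: "cuspidal_form 1 (- 1) = (13 :: 'k)" by (simp add: cuspidal_form_def)
  show ?thesis
  proof (cases "(13::'k) = 0")
    case True
    have "(3::'k) \<noteq> 0"
    proof
      assume "(3::'k) = 0"
      then have "(13::'k) - 4 * 3 = 0" using True by simp
      then show False by simp
    qed
    moreover have "(3::'k) \<noteq> 1"
    proof
      assume "(3::'k) = 1"
      then have "(3::'k) - 1 = 0" by simp
      then show False using \<open>(2::'k) \<noteq> 0\<close> by simp
    qed
    moreover have "cuspidal_form 1 (3::'k) = 4 * 13 - 3" by (simp add: cuspidal_form_def)
    ultimately show ?thesis using that[of 3] True by simp
  qed (use that[of "- 1"] * 13 in auto)
qed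

text \<open>If \<open>\<psi>\<close> takes only the values \<open>\<plusminus>1\<close>, the three abscissae are fixed by the Galois group and are chosen in
\<open>k\<close>; otherwise they are conjugate over \<open>k\<close>.\<close>

lemma exists_curve_with_character:
  assumes \<psi>: "\<psi> \<in> carrier (character_group emb)" and "CARD('k) \<noteq> 2"
  shows "\<exists>E \<Psi>. elliptic_curve E \<and> rational_subgroup emb E \<Psi> \<and> card \<Psi> = 7 \<and> acts_via emb E \<Psi> \<psi>"
proof -
  obtain u :: 'k where u: "u \<noteq> 0" "u \<noteq> 1" "cuspidal_form 1 u \<noteq> 0"
    using noncuspidal_parameter assms(2) by blast
  obtain s where s: "\<And>\<sigma>. \<sigma> \<in> Gal \<Longrightarrow> \<sigma> s = (if \<psi> \<sigma> \<in> {1, 2, 4} then s else 1 - s)" "2 * s - 1 \<noteq> 0"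
    using quadratic_element[OF \<psi>] by blast
  show ?thesis
  proof (cases "\<forall>\<sigma>\<in>Gal. \<psi> \<sigma> \<in> {1, 6}")
    case True
    define X where "X i = emb (if i \<in> {1, 6} then 0 else if i \<in> {2, 5} then 1 else u)" for i :: int
    show ?thesis
    proof (rule curve_with_character[OF \<psi>, of X s])
      fix \<sigma> i assume \<sigma>: "\<sigma> \<in> Gal" and "i \<in> {1..6::int}"
      then have "i \<in> {1, 2, 3, 4, 5, 6}" "\<psi> \<sigma> = 1 \<or> \<psi> \<sigma> = 6" using True by auto
      then show "\<sigma> (X i) = X (\<psi> \<sigma> * i mod 7)"
        unfolding X_def Gal_emb[OF \<sigma>] by (elim insertE emptyE disjE) simp_all
    next
      have "cuspidal_form (X 2 - X 1) (X 4 - X 1) = emb (cuspidal_form 1 u)"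
        by (simp add: X_def cuspidal_form_def hom_distribs)
      then show "cuspidal_form (X 2 - X 1) (X 4 - X 1) \<noteq> 0" using u by simp
    qed (use u s in \<open>simp_all add: X_def\<close>)
  next
    case False
    then obtain \<sigma>0 where "\<sigma>0 \<in> Gal" "\<psi> \<sigma>0 \<notin> {1, 6}" by blast
    then obtain X where "\<And>\<sigma> i. \<sigma> \<in> Gal \<Longrightarrow> i \<in> {1..6} \<Longrightarrow> \<sigma> (X i) = X (\<psi> \<sigma> * i mod 7)"
      "X 6 = X 1" "X 5 = X 2" "X 3 = X 4" "X 1 \<noteq> X 2" "X 2 \<noteq> X 4" "X 4 \<noteq> X 1"
      "cuspidal_form (X 2 - X 1) (X 4 - X 1) \<noteq> 0"
      using cubic_elements_noncuspidal[OF \<psi> _ _ u(1,2)] by blast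
    then show ?thesis using s by (intro curve_with_character[OF \<psi>, of X s])
  qed
qed

section \<open>The group of characters\<close>

lemma character_mult_apply:
  "\<sigma> \<in> Gal \<Longrightarrow> (\<chi> \<otimes>\<^bsub>character_group emb\<^esub> \<psi>) \<sigma> = \<chi> \<sigma> * \<psi> \<sigma> mod 7"
  by (simp add: character_group_def F7_units_mult)

lemma character_one_apply: "\<sigma> \<in> Gal \<Longrightarrow> \<one>\<^bsub>character_group emb\<^esub> \<sigma> = 1"
  by (simp add: character_group_def F7_units_one)

lemma character_eqI:
  assumes "\<chi> \<in> carrier (character_group emb)" "\<psi> \<in> carrier (character_group emb)"
    and "\<And>\<sigma>. \<sigma> \<in> Gal \<Longrightarrow> \<chi> \<sigma> = \<psi> \<sigma>"
  shows "\<chi> = \<psi>"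
proof (rule extensionalityI)
  show "\<chi> \<in> extensional Gal" "\<psi> \<in> extensional Gal"
    using assms(1,2) by (simp_all add: character_group_def)
qed (rule assms(3))

text \<open>The inverse of a character is its fifth power, since \<open>F\<^sub>7\<^sup>\<times>\<close> has order 6.\<close>

lemma comm_group_character_group: "comm_group (character_group emb)"
proof (rule comm_groupI)
  fix \<chi> \<psi> assume \<chi>: "\<chi> \<in> carrier (character_group emb)" and \<psi>: "\<psi> \<in> carrier (character_group emb)"
  obtain S T where S: "finite S" "\<forall>\<sigma>\<in>Gal. (\<forall>x\<in>S. \<sigma> x = x) \<longrightarrow> \<chi> \<sigma> = 1"
    and T: "finite T" "\<forall>\<sigma>\<in>Gal. (\<forall>x\<in>T. \<sigma> x = x) \<longrightarrow> \<psi> \<sigma> = 1"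
    using character_finite_level[OF \<chi>] character_finite_level[OF \<psi>] by (elim exE conjE)
  show "\<chi> \<otimes>\<^bsub>character_group emb\<^esub> \<psi> \<in> carrier (character_group emb)"
    unfolding character_group_carrier_iff
  proof (intro conjI ballI)
    show "\<chi> \<otimes>\<^bsub>character_group emb\<^esub> \<psi> \<in> extensional Gal" by (simp add: character_group_def)
  next
    fix \<sigma> assume \<sigma>: "\<sigma> \<in> Gal"
    show "(\<chi> \<otimes>\<^bsub>character_group emb\<^esub> \<psi>) \<sigma> \<in> {1..6}"
      unfolding character_mult_apply[OF \<sigma>]
      using character_cases[OF \<chi> \<sigma>] character_cases[OF \<psi> \<sigma>] by (elim insertE emptyE) simp_all
    fix \<tau> assume \<tau>: "\<tau> \<in> Gal"
    show "(\<chi> \<otimes>\<^bsub>character_group emb\<^esub> \<psi>) (\<sigma> \<circ> \<tau>) =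
       (\<chi> \<otimes>\<^bsub>character_group emb\<^esub> \<psi>) \<sigma> * (\<chi> \<otimes>\<^bsub>character_group emb\<^esub> \<psi>) \<tau> mod 7"
      unfolding character_mult_apply[OF \<sigma>] character_mult_apply[OF \<tau>] character_mult_apply[OF Gal_comp[OF \<sigma> \<tau>]]
        character_comp[OF \<chi> \<sigma> \<tau>] character_comp[OF \<psi> \<sigma> \<tau>] mod_mult_eq
      by (simp add: ac_simps)
  next
    show "\<exists>S. finite S \<and> (\<forall>\<sigma>\<in>Gal. (\<forall>x\<in>S. \<sigma> x = x) \<longrightarrow> (\<chi> \<otimes>\<^bsub>character_group emb\<^esub> \<psi>) \<sigma> = 1)"
      using S T by (intro exI[of _ "S \<union> T"]) (simp add: character_mult_apply)
  qed
next
  show "\<one>\<^bsub>character_group emb\<^esub> \<in> carrier (character_group emb)"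
    unfolding character_group_carrier_iff
    by (intro conjI ballI exI[of _ "{}"]) (simp_all add: character_one_apply Gal_comp, simp add: character_group_def)
next
  fix \<chi> \<psi> \<phi> assume "\<chi> \<in> carrier (character_group emb)" "\<psi> \<in> carrier (character_group emb)"
    "\<phi> \<in> carrier (character_group emb)"
  show "\<chi> \<otimes>\<^bsub>character_group emb\<^esub> \<psi> \<otimes>\<^bsub>character_group emb\<^esub> \<phi> =
      \<chi> \<otimes>\<^bsub>character_group emb\<^esub> (\<psi> \<otimes>\<^bsub>character_group emb\<^esub> \<phi>)"
    by (simp add: character_group_def F7_units_mult mod_simps ac_simps cong: restrict_cong)
next
  fix \<chi> \<psi> 
  show "\<chi> \<otimes>\<^bsub>character_group emb\<^esub> \<psi> = \<psi> \<otimes>\<^bsub>character_group emb\<^esub> \<chi>"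
    by (simp add: character_group_def F7_units_mult mult.commute)
next
  fix \<chi> assume \<chi>: "\<chi> \<in> carrier (character_group emb)"
  have "\<chi> \<sigma> mod 7 = \<chi> \<sigma>" if "\<sigma> \<in> Gal" for \<sigma> using character_range[OF \<chi> that] by simp
  then show "\<one>\<^bsub>character_group emb\<^esub> \<otimes>\<^bsub>character_group emb\<^esub> \<chi> = \<chi>"
    using \<chi> by (auto simp: character_group_def F7_units_mult F7_units_one extensional_def fun_eq_iff)
  define \<psi> where "\<psi> = (\<lambda>\<sigma>\<in>Gal. \<chi> \<sigma> ^ 5 mod 7)"
  obtain S where S: "finite S" "\<forall>\<sigma>\<in>Gal. (\<forall>x\<in>S. \<sigma> x = x) \<longrightarrow> \<chi> \<sigma> = 1"
    using character_finite_level[OF \<chi>] by (elim exE conjE)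
  have "\<psi> \<in> carrier (character_group emb)"
    unfolding character_group_carrier_iff
  proof (intro conjI ballI)
    fix \<sigma> assume \<sigma>: "\<sigma> \<in> Gal"
    show "\<psi> \<sigma> \<in> {1..6}"
      using character_cases[OF \<chi> \<sigma>] \<sigma> unfolding \<psi>_def by (elim insertE emptyE) simp_all
    fix \<tau> assume \<tau>: "\<tau> \<in> Gal"
    show "\<psi> (\<sigma> \<circ> \<tau>) = \<psi> \<sigma> * \<psi> \<tau> mod 7"
      using \<sigma> \<tau> by (simp add: \<psi>_def Gal_comp character_comp[OF \<chi>] mod_simps power_mult_distrib)
  next
    show "\<exists>S. finite S \<and> (\<forall>\<sigma>\<in>Gal. (\<forall>x\<in>S. \<sigma> x = x) \<longrightarrow> \<psi> \<sigma> = 1)"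
      using S by (intro exI[of _ S]) (simp add: \<psi>_def)
  qed (simp add: \<psi>_def)
  moreover have "\<psi> \<otimes>\<^bsub>character_group emb\<^esub> \<chi> = \<one>\<^bsub>character_group emb\<^esub>"
  proof -
    have "\<chi> \<sigma> ^ 5 mod 7 * \<chi> \<sigma> mod 7 = 1" if "\<sigma> \<in> Gal" for \<sigma>
      using character_cases[OF \<chi> that] by (elim insertE emptyE) simp_all
    then show ?thesis by (simp add: character_group_def \<psi>_def F7_units_mult F7_units_one cong: restrict_cong)
  qed
  ultimately show "\<exists>\<psi>\<in>carrier (character_group emb). \<psi> \<otimes>\<^bsub>character_group emb\<^esub> \<chi> = \<one>\<^bsub>character_group emb\<^esub>"
    by blast
qed

text \<open>The resolvent \<open>t 1\<close> of \<open>\<psi>\<close> is fixed by \<open>F\<close>, hence lies in \<open>k\<close> and is fixed by \<open>\<sigma>\<close>, which sends it to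
\<open>t (\<psi> \<sigma>)\<close>; but \<open>y\<close> can be chosen such that these two resolvents differ.\<close>

lemma character_trivial_if_trivial_at_generator:
  fixes F :: "'l \<Rightarrow> 'l"
  assumes F: "F \<in> Gal" "\<And>z. F z = z \<Longrightarrow> z \<in> range emb"
    and \<psi>: "\<psi> \<in> carrier (character_group emb)" "\<psi> F = 1" and \<sigma>: "\<sigma> \<in> Gal"
  shows "\<psi> \<sigma> = 1"
proof (rule ccontr)
  assume ne: "\<psi> \<sigma> \<noteq> 1"
  define a where "a = \<psi> \<sigma>"
  have a: "a \<in> {1..6}" unfolding a_def by (rule character_range[OF \<psi>(1) \<sigma>])
  define c where "c i = (if i = 1 then 1 else if i = a then - 1 else 0 :: 'l)" for i :: int
  obtain t where t: "\<And>\<sigma> a. \<sigma> \<in> Gal \<Longrightarrow> a \<in> {1..6} \<Longrightarrow> \<sigma> (t a) = t (\<psi> \<sigma> * a mod 7)"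
    and nz: "(\<Sum>a=1..6. c a * t a) \<noteq> 0"
    by (rule resolvent[OF \<psi>(1), of c]) (auto simp: c_def)
  have "F (t 1) = t 1" using t[OF F(1), of 1] \<psi>(2) by simp
  then obtain b where "t 1 = emb b" using F(2) by blast
  then have "\<sigma> (t 1) = t 1" using Gal_emb[OF \<sigma>] by simp
  moreover have "\<sigma> (t 1) = t a" using t[OF \<sigma>, of 1] a by (simp add: a_def)
  ultimately have "t a = t 1" by simp
  have "(\<Sum>i=1..6. c i * t i) = (\<Sum>i\<in>{1, a}. c i * t i)"
    using a by (intro sum.mono_neutral_right) (auto simp: c_def)
  also have "\<dots> = t 1 - t a" using ne by (simp add: c_def a_def)
  finally show False using nz \<open>t a = t 1\<close> by simp
qed

lemma character_eq_if_eq_at_generator: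
  fixes F :: "'l \<Rightarrow> 'l"
  assumes F: "F \<in> Gal" "\<And>z. F z = z \<Longrightarrow> z \<in> range emb"
    and \<psi>: "\<psi> \<in> carrier (character_group emb)" and \<chi>: "\<chi> \<in> carrier (character_group emb)"
    and eq: "\<psi> F = \<chi> F"
  shows "\<psi> = \<chi>"
proof -
  interpret C: comm_group "character_group emb" by (rule comm_group_character_group)
  define \<theta> where "\<theta> = \<psi> \<otimes>\<^bsub>character_group emb\<^esub> inv\<^bsub>character_group emb\<^esub> \<chi>"
  have \<theta>: "\<theta> \<in> carrier (character_group emb)" using \<psi> \<chi> by (simp add: \<theta>_def)
  have "(\<chi> \<otimes>\<^bsub>character_group emb\<^esub> inv\<^bsub>character_group emb\<^esub> \<chi>) F = 1"
    using \<chi> F(1) by (simp add: character_one_apply)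
  then have "\<theta> F = 1" using F(1) eq by (simp add: \<theta>_def character_mult_apply)
  then have "\<theta> = \<one>\<^bsub>character_group emb\<^esub>"
    using character_trivial_if_trivial_at_generator[OF F \<theta>]
    by (intro character_eqI) (simp_all add: \<theta> character_one_apply)
  then show ?thesis using \<psi> \<chi> unfolding \<theta>_def
    by (metis C.inv_closed C.inv_equality C.inv_inv)
qed

end

section \<open>Characters over the field of two elements\<close>

locale closure_of_F2 = separably_closed_extension emb
  for emb :: "'k::field \<Rightarrow> 'l::field" +
  assumes card_base: "CARD('k) = 2"
begin

lemma base_cases: "c = 0 \<or> c = (1::'k)"
proof -
  obtain a b :: 'k where ab: "UNIV = {a, b}" using card_base by (metis card_2_iff)
  then have "c \<in> {a, b}" "0 \<in> {a, b}" "1 \<in> {a, b}" by (simp_all flip: ab)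
  then show ?thesis using zero_neq_one by (elim insertE emptyE) simp_all
qed

lemma emb_cases: "emb c = 0 \<or> emb c = 1"
  using base_cases[of c] by auto

lemma two_eq_0: "(2::'l) = 0"
proof -
  have "(1::'k) + 1 = 0" using base_cases[of "1 + 1"] by (metis add_cancel_right_right zero_neq_one)
  then have "emb (1 + 1) = emb 0" by simp
  then show ?thesis by (simp add: hom_distribs)
qed

text \<open>As simplification rules these evaluate the integer coefficients of Weierstrass formulas.\<close>

lemma numeral_char2 [simp]:
  "(numeral (Num.Bit0 n) :: 'l) = 0" "(numeral (Num.Bit1 n) :: 'l) = 1"
proof -
  have double: "x + x = 0" for x :: 'l by (metis mult_2 mult_zero_left two_eq_0)
  show "(numeral (Num.Bit0 n) :: 'l) = 0" by (simp only: numeral_Bit0 double)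
  show "(numeral (Num.Bit1 n) :: 'l) = 1" by (simp only: numeral_Bit1 double add_0)
qed

lemma char2:
  fixes x y :: 'l
  shows "x + x = 0" "- x = x" "x - y = x + y" "x + (x + y) = y"
proof -
  show *: "x + x = 0" for x :: 'l by (metis mult_2 mult_zero_left two_eq_0)
  show **: "- x = x" for x :: 'l using * by (simp add: neg_eq_iff_add_eq_0)
  show "x - y = x + y" by (metis ** diff_conv_add_uminus)
  show "x + (x + y) = y" using * by (simp flip: add.assoc)
qed

lemma square_add: "(x + y)^2 = x^2 + (y :: 'l)^2"
  by (simp add: power2_sum)

definition Frob :: "'l \<Rightarrow> 'l" where "Frob x = x^2"

lemma field_hom_Frob: "field_hom Frob"
  by unfold_locales (simp_all add: Frob_def square_add power_mult_distrib)

lemma Frob_Gal: "Frob \<in> Gal"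
proof (rule endomorphism_in_galois_group[OF field_hom_Frob])
  show "Frob (emb c) = emb c" for c using emb_cases[of c] by (auto simp: Frob_def)
qed

lemma Frob_power_in_Gal: "Frob ^^ n \<in> Gal"
proof (induction n)
  case 0
  show ?case unfolding funpow.simps by (rule Gal_id)
next
  case (Suc n)
  show ?case unfolding funpow.simps by (rule Gal_comp[OF Frob_Gal Suc])
qed

lemma idempotent_in_base:
  assumes "x^2 = (x::'l)"
  shows "x = 0 \<or> x = 1"
proof -
  have "x * (x - 1) = 0" using assms by (simp add: power2_eq_square right_diff_distrib)
  then show ?thesis by auto
qed

lemma Frob_fixed: "Frob z = z \<Longrightarrow> z \<in> range emb"
  unfolding Frob_def using idempotent_in_base[of z] emb.hom_zero emb.hom_one by (metis rangeI)

lemma character_eq_if_eq_at_Frob: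
  assumes "\<psi> \<in> carrier (character_group emb)" "\<chi> \<in> carrier (character_group emb)"
    and "\<psi> Frob = \<chi> Frob"
  shows "\<psi> = \<chi>"
  by (rule character_eq_if_eq_at_generator[where F = Frob and \<psi> = \<psi> and \<chi> = \<chi>])
    (fact Frob_Gal Frob_fixed assms)+

text \<open>The character of the extension generated by a root \<open>s\<close> of \<open>x\<^sup>2 + x + 1\<close>, whose conjugate is \<open>s + 1\<close>.\<close>

lemma quadratic_character:
  obtains \<epsilon> where "\<epsilon> \<in> carrier (character_group emb)" "\<epsilon> Frob = 6"
proof -
  define p :: "'l poly" where "p = [:1, 1, 1:]"
  have "separable_poly p"
    unfolding separable_poly_iff_bezout
    by (intro exI[of _ 0] exI[of _ 1]) (simp add: p_def pderiv_pCons char2 one_pCons)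
  moreover have "degree p > 0" by (simp add: p_def)
  ultimately obtain s where "poly p s = 0" using separable_poly_has_root by blast
  moreover have "poly p s = s^2 + (s + 1)" by (simp add: p_def power2_eq_square algebra_simps)
  ultimately have "s^2 + (s + 1) = 0" by simp
  then have s: "s^2 = s + 1" by (simp only: add_eq_0_iff2 char2)
  have s1: "s + 1 \<noteq> s" by simp
  define \<epsilon> where "\<epsilon> = (\<lambda>\<sigma>\<in>Gal. if \<sigma> s = s then 1 else 6 :: int)"
  have \<sigma>s: "\<sigma> s = s \<or> \<sigma> s = s + 1" if "\<sigma> \<in> Gal" for \<sigma>
  proof -
    interpret field_hom \<sigma> using that by (rule Gal_field_hom)
    have "(\<sigma> s)^2 = \<sigma> s + 1" using arg_cong[OF s, of \<sigma>] by (simp add: hom_distribs)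
    then have "(\<sigma> s - s) * (\<sigma> s - (s + 1)) = 0"
      using s by (simp add: power2_eq_square algebra_simps char2)
    then show ?thesis by auto
  qed
  have "\<epsilon> \<in> carrier (character_group emb)"
    unfolding character_group_carrier_iff
  proof (intro conjI ballI)
    show "\<epsilon> \<in> extensional Gal" by (simp add: \<epsilon>_def)
    show "\<exists>S. finite S \<and> (\<forall>\<sigma>\<in>Gal. (\<forall>x\<in>S. \<sigma> x = x) \<longrightarrow> \<epsilon> \<sigma> = 1)"
      by (intro exI[of _ "{s}"]) (simp add: \<epsilon>_def)
  next
    fix \<sigma> assume \<sigma>: "\<sigma> \<in> Gal"
    show "\<epsilon> \<sigma> \<in> {1..6}" using \<sigma> by (simp add: \<epsilon>_def)
    fix \<tau> assume \<tau>: "\<tau> \<in> Gal"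
    interpret field_hom \<sigma> using \<sigma> by (rule Gal_field_hom)
    show "\<epsilon> (\<sigma> \<circ> \<tau>) = \<epsilon> \<sigma> * \<epsilon> \<tau> mod 7"
      using \<sigma>s[OF \<sigma>] \<sigma>s[OF \<tau>] \<sigma> \<tau> Gal_comp[OF \<sigma> \<tau>]
      by (elim disjE) (simp_all add: \<epsilon>_def hom_distribs char2 add.assoc)
  qed
  moreover have "\<epsilon> Frob = 6" using Frob_Gal s s1 by (simp add: \<epsilon>_def Frob_def)
  ultimately show ?thesis by (rule that)
qed

lemma character_order_2_iff:
  assumes \<chi>: "\<chi> \<in> carrier (character_group emb)"
  shows "group.ord (character_group emb) \<chi> = 2 \<longleftrightarrow> \<chi> Frob = 6"
proof -
  interpret C: comm_group "character_group emb" by (rule comm_group_character_group)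
  have one: "\<phi> = \<one>\<^bsub>character_group emb\<^esub> \<longleftrightarrow> \<phi> Frob = 1" if "\<phi> \<in> carrier (character_group emb)" for \<phi>
    using character_eq_if_eq_at_Frob[OF that C.one_closed] Frob_Gal by (auto simp: character_one_apply)
  have "\<chi> [^]\<^bsub>character_group emb\<^esub> (2::nat) = \<chi> \<otimes>\<^bsub>character_group emb\<^esub> \<chi>"
    using \<chi> by (simp add: numeral_2_eq_2)
  then have sq: "\<chi> [^]\<^bsub>character_group emb\<^esub> (2::nat) = \<one>\<^bsub>character_group emb\<^esub> \<longleftrightarrow> \<chi> Frob * \<chi> Frob mod 7 = 1"
    using one[of "\<chi> \<otimes>\<^bsub>character_group emb\<^esub> \<chi>"] \<chi> Frob_Gal by (simp add: character_mult_apply)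
  have "C.ord \<chi> = 2 \<longleftrightarrow> C.ord \<chi> dvd 2 \<and> C.ord \<chi> \<noteq> 1"
    using two_is_prime_nat unfolding prime_nat_iff by auto
  also have "\<dots> \<longleftrightarrow> \<chi> Frob * \<chi> Frob mod 7 = 1 \<and> \<chi> Frob \<noteq> 1"
    using C.pow_eq_id[OF \<chi>, of 2] C.ord_eq_1[OF \<chi>] sq one[OF \<chi>] by simp
  also have "\<dots> \<longleftrightarrow> \<chi> Frob = 6"
    using character_cases[OF \<chi> Frob_Gal] by (elim insertE emptyE) simp_all
  finally show ?thesis .
qed

text \<open>A root of \<open>x\<^sup>3 + x + 1\<close>, a factor of \<open>x\<^sup>7 - 1\<close> in characteristic 2.\<close>

lemma seventh_root_of_unity:
  obtains \<zeta> :: 'l where "\<zeta>^7 = 1" "\<zeta> \<noteq> 1"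
proof -
  define p :: "'l poly" where "p = [:1, 1, 0, 1:]"
  have "separable_poly p"
    unfolding separable_poly_iff_bezout
    by (intro exI[of _ 1] exI[of _ "[:0, 1:]"]) (simp add: p_def pderiv_pCons char2 one_pCons)
  moreover have "degree p > 0" by (simp add: p_def)
  ultimately obtain z where "poly p z = 0" using separable_poly_has_root by blast
  moreover have "poly p z = z^3 + (z + 1)" by (simp add: p_def power3_eq_cube algebra_simps)
  ultimately have "z^3 + (z + 1) = 0" by simp
  then have z3: "z^3 = z + 1" by (simp only: add_eq_0_iff2 char2)
  have "z^7 = (z^3)^2 * z" by (simp flip: power_mult add: eval_nat_numeral)
  also have "\<dots> = (z + 1)^2 * z" by (simp only: z3)
  also have "\<dots> = z^3 + z" by (simp add: square_add power3_eq_cube power2_eq_square algebra_simps)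
  also have "\<dots> = 1" unfolding z3 by (simp add: char2 ac_simps)
  finally have "z^7 = 1" .
  moreover have "z \<noteq> 1" using z3 by (auto simp: char2)
  ultimately show ?thesis by (rule that)
qed

text \<open>The powers of \<open>\<zeta>\<close> are all seven roots of \<open>x\<^sup>7 - 1\<close>, so that the value of the cyclotomic character at
\<open>\<sigma>\<close> is the exponent of \<open>\<sigma> \<zeta>\<close>. Frobenius has exponent 2.\<close>

lemma cyclotomic_character_F2:
  "cyclotomic_character emb \<in> carrier (character_group emb)" "cyclotomic_character emb Frob = 2"
proof -
  obtain \<zeta> :: 'l where \<zeta>: "\<zeta>^7 = 1" "\<zeta> \<noteq> 1" by (rule seventh_root_of_unity)
  have \<zeta>_mod: "\<zeta>^n = \<zeta>^(n mod 7)" for n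
  proof -
    have "\<zeta>^n = \<zeta>^(7 * (n div 7) + n mod 7)" by simp
    also have "\<dots> = \<zeta>^(n mod 7)" unfolding power_add power_mult by (simp add: \<zeta>(1))
    finally show ?thesis .
  qed
  have \<zeta>_inj: "i = j" if "\<zeta>^i = \<zeta>^j" "i < 7" "j < 7" for i j
  proof -
    have "i = j" if "\<zeta>^i = \<zeta>^j" "i \<le> j" "j < 7" for i j
    proof (rule ccontr)
      assume "i \<noteq> j"
      define d where "d = j - i"
      have d: "0 < d" "d < 7" "j = i + d" using that \<open>i \<noteq> j\<close> by (auto simp: d_def)
      have "\<zeta> \<noteq> 0" using \<zeta>(1) by auto
      then have "\<zeta>^d = 1" using that(1) d(3) by (simp add: power_add)
      have "\<not> 7 dvd d" using d by (auto dest: dvd_imp_le)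
      then have "coprime d 7" using prime_imp_coprime[of 7 d] by (simp add: coprime_commute)
      then obtain e where "[d * e = Suc 0] (mod 7)" using cong_solve_coprime_nat by blast
      then have "d * e mod 7 = 1" by (simp add: cong_def)
      then have "\<zeta>^(d * e) = \<zeta>" using \<zeta>_mod[of "d * e"] by simp
      then show False using \<open>\<zeta>^d = 1\<close> \<zeta>(2) by (simp add: power_mult)
    qed
    then show ?thesis using that by (metis nat_le_linear)
  qed
  have roots: "\<exists>i<7. z = \<zeta>^i" if "z^7 = 1" for z
  proof -
    define p :: "'l poly" where "p = monom 1 7 - 1"
    have p: "poly p x = x^7 - 1" for x by (simp add: p_def poly_monom)
    have "p \<noteq> 0" using p[of 0] by auto
    moreover have "degree p \<le> 7" unfolding p_def
      by (rule degree_diff_le) (simp_all add: degree_monom_le)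
    ultimately have fin: "finite {x. poly p x = 0}" and le: "card {x. poly p x = 0} \<le> 7"
      using poly_roots_finite[of p] poly_roots_degree[of p] by auto
    have "inj_on (\<lambda>i. \<zeta>^i) {..<7}" using \<zeta>_inj by (auto intro: inj_onI)
    then have "card ((\<lambda>i. \<zeta>^i) ` {..<7}) = 7" by (simp add: card_image)
    moreover have "(\<zeta>^i)^7 = 1" for i by (metis \<zeta>(1) mult.commute power_mult power_one)
    then have "(\<lambda>i. \<zeta>^i) ` {..<7} \<subseteq> {x. poly p x = 0}" by (auto simp: p)
    ultimately have "(\<lambda>i. \<zeta>^i) ` {..<7} = {x. poly p x = 0}"
      using fin le by (intro card_subset_eq) (auto dest: card_mono)
    then have "z \<in> (\<lambda>i. \<zeta>^i) ` {..<7}" using that by (simp add: p)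
    then show ?thesis by auto
  qed
  have \<omega>: "cyclotomic_character emb \<sigma> \<in> {1..6} \<and> \<sigma> \<zeta> = \<zeta>^nat (cyclotomic_character emb \<sigma>)"
    if \<sigma>: "\<sigma> \<in> Gal" for \<sigma>
  proof -
    interpret field_hom \<sigma> using \<sigma> by (rule Gal_field_hom)
    have "(\<sigma> \<zeta>)^7 = 1" using arg_cong[OF \<zeta>(1), of \<sigma>] by (simp add: hom_distribs)
    then obtain n where n: "n < 7" "\<sigma> \<zeta> = \<zeta>^n" using roots by blast
    have "n \<noteq> 0"
    proof
      assume "n = 0"
      then have "\<sigma> \<zeta> = 1" using n by simp
      then show False using \<zeta>(2) by simp
    qed
    have "\<exists>!a. a \<in> carrier F7_units \<and> (\<forall>\<zeta>. \<zeta>^7 = 1 \<longrightarrow> \<sigma> \<zeta> = \<zeta>^nat a)"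
    proof (rule ex1I[of _ "int n"])
      have "\<sigma> z = z^n" if "z^7 = 1" for z
      proof -
        obtain i where "z = \<zeta>^i" using roots \<open>z^7 = 1\<close> by blast
        then show ?thesis using n by (simp add: hom_distribs flip: power_mult) (simp add: mult.commute)
      qed
      then show "int n \<in> carrier F7_units \<and> (\<forall>\<zeta>. \<zeta>^7 = 1 \<longrightarrow> \<sigma> \<zeta> = \<zeta>^nat (int n))"
        using n \<open>n \<noteq> 0\<close> by (simp add: F7_units_carrier)
    next
      fix a assume a: "a \<in> carrier F7_units \<and> (\<forall>\<zeta>. \<zeta>^7 = 1 \<longrightarrow> \<sigma> \<zeta> = \<zeta>^nat a)"
      then have "\<zeta>^nat a = \<zeta>^n" using \<zeta>(1) n(2) by metis
      moreover have "nat a < 7" using conjunct1[OF a] by (auto simp: F7_units_carrier)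
      ultimately have "nat a = n" using n(1) by (intro \<zeta>_inj)
      then show "a = int n" using conjunct1[OF a] by (auto simp: F7_units_carrier)
    qed
    note the = theI'[OF this]
    have "cyclotomic_character emb \<sigma> =
        (THE a. a \<in> carrier F7_units \<and> (\<forall>\<zeta>. \<zeta>^7 = 1 \<longrightarrow> \<sigma> \<zeta> = \<zeta>^nat a))"
      unfolding cyclotomic_character_def using \<sigma> by (rule restrict_apply')
    then show ?thesis using the \<zeta>(1) unfolding F7_units_carrier by metis
  qed
  have \<omega>_eq: "cyclotomic_character emb \<sigma> = a" if "\<sigma> \<in> Gal" "\<sigma> \<zeta> = \<zeta>^nat a" "a \<in> {1..6}" for \<sigma> a
  proof -
    have "\<zeta>^nat (cyclotomic_character emb \<sigma>) = \<zeta>^nat a" using \<omega>[OF that(1)] that(2) by simp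
    then have "nat (cyclotomic_character emb \<sigma>) = nat a"
      using \<omega>[OF that(1)] that(3) by (intro \<zeta>_inj) auto
    then show ?thesis using \<omega>[OF that(1)] that(3) by auto
  qed
  show "cyclotomic_character emb Frob = 2"
    by (rule \<omega>_eq[OF Frob_Gal]) (simp_all add: Frob_def)
  show "cyclotomic_character emb \<in> carrier (character_group emb)"
    unfolding character_group_carrier_iff
  proof (intro conjI ballI)
    show "cyclotomic_character emb \<in> extensional Gal" by (simp add: cyclotomic_character_def)
    have "cyclotomic_character emb \<sigma> = 1" if "\<sigma> \<in> Gal" "\<sigma> \<zeta> = \<zeta>" for \<sigma>
      using that by (intro \<omega>_eq) simp_all
    then show "\<exists>S. finite S \<and> (\<forall>\<sigma>\<in>Gal. (\<forall>x\<in>S. \<sigma> x = x) \<longrightarrow> cyclotomic_character emb \<sigma> = 1)"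
      by (intro exI[of _ "{\<zeta>}"]) simp
  next
    fix \<sigma> assume \<sigma>: "\<sigma> \<in> Gal"
    show "cyclotomic_character emb \<sigma> \<in> {1..6}" using \<omega>[OF \<sigma>] by blast
    fix \<tau> assume \<tau>: "\<tau> \<in> Gal"
    interpret field_hom \<sigma> using \<sigma> by (rule Gal_field_hom)
    define a where "a = cyclotomic_character emb \<sigma>"
    define b where "b = cyclotomic_character emb \<tau>"
    have ab: "a \<in> {1..6}" "b \<in> {1..6}" "\<sigma> \<zeta> = \<zeta>^nat a" "\<tau> \<zeta> = \<zeta>^nat b"
      using \<omega>[OF \<sigma>] \<omega>[OF \<tau>] by (simp_all add: a_def b_def)
    have "(\<sigma> \<circ> \<tau>) \<zeta> = \<zeta>^(nat a * nat b)" by (simp add: ab hom_distribs power_mult)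
    also have "\<dots> = \<zeta>^(nat a * nat b mod 7)" by (rule \<zeta>_mod)
    also have "nat a * nat b mod 7 = nat (a * b mod 7)"
      using ab(1,2) by (simp add: nat_mult_distrib nat_mod_distrib)
    finally show "cyclotomic_character emb (\<sigma> \<circ> \<tau>) = a * b mod 7"
    proof (rule \<omega>_eq[OF Gal_comp[OF \<sigma> \<tau>]])
      have "a \<in> {1, 2, 3, 4, 5, 6}" "b \<in> {1, 2, 3, 4, 5, 6}" using ab by auto
      then show "a * b mod 7 \<in> {1..6}" by (elim insertE emptyE) simp_all
    qed
  qed
qed

text \<open>Frobenius sends \<open>X 1\<close> to \<open>X 4\<close> and \<open>X 4\<close> to \<open>X 2\<close>, so the three elements are \<open>x\<close>, \<open>x\<^sup>4\<close>, \<open>x\<^sup>2\<close> for some \<open>x\<close>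
in the field of eight elements. The difference \<open>t = x\<^sup>2 + x\<close> has trace zero and hence satisfies
\<open>t\<^sup>3 = t + 1\<close>, which makes the cuspidal form equal to \<open>t\<^sup>3 (t\<^sup>2 + t) \<noteq> 0\<close>.\<close>

lemma exists_curve_with_character_F2:
  assumes \<psi>: "\<psi> \<in> carrier (character_group emb)" and Frob: "\<psi> Frob \<in> {3, 4}"
  shows "\<exists>E \<Psi>. elliptic_curve E \<and> rational_subgroup emb E \<Psi> \<and> card \<Psi> = 7 \<and> acts_via emb E \<Psi> \<psi>"
proof -
  obtain s where s: "\<And>\<sigma>. \<sigma> \<in> Gal \<Longrightarrow> \<sigma> s = (if \<psi> \<sigma> \<in> {1, 2, 4} then s else 1 - s)" "2 * s - 1 \<noteq> 0"
    using quadratic_element[OF \<psi>] by blast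
  have "\<psi> Frob \<notin> {1, 6}" using Frob by auto
  then obtain X where X: "\<And>\<sigma> i. \<sigma> \<in> Gal \<Longrightarrow> i \<in> {1..6} \<Longrightarrow> \<sigma> (X i) = X (\<psi> \<sigma> * i mod 7)"
    and even: "X 6 = X 1" "X 5 = X 2" "X 3 = X 4"
    and ne: "X 1 \<noteq> X 2" "X 2 \<noteq> X 4" "X 4 \<noteq> X 1"
    using cubic_elements[OF \<psi> Frob_Gal] by blast
  define x where "x = X 1"
  have X4: "X 4 = x^2" and X2: "X 2 = (X 4)^2" and X1: "x = (X 2)^2"
    using X[OF Frob_Gal, of 1] X[OF Frob_Gal, of 4] X[OF Frob_Gal, of 2] Frob even
    by (auto simp: Frob_def x_def)
  define t where "t = X 4 - X 1"
  have t: "t = x^2 + x" by (simp add: t_def X4 x_def char2)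
  have r: "X 2 - X 1 = t^2 + t"
    unfolding X2 X4 t by (simp add: x_def[symmetric] square_add char2 ac_simps)
  have "t^2 = x^4 + x^2" unfolding t square_add by (simp flip: power_mult)
  moreover have "t^4 = (x^4)^2 + x^4"
  proof -
    have "t^4 = (t^2)^2" by (simp flip: power_mult)
    also have "\<dots> = (x^4)^2 + (x^2)^2" unfolding \<open>t^2 = x^4 + x^2\<close> by (rule square_add)
    finally show ?thesis by (simp flip: power_mult)
  qed
  ultimately have "t + t^2 + t^4 = x + (x^4)^2" unfolding t by (simp add: ac_simps char2)
  also have "(x^4)^2 = x" using X1 unfolding X2 X4 by (simp flip: power_mult)
  finally have "t * (t^3 + t + 1) = 0"
    by (simp add: char2 power3_eq_cube power2_eq_square power4_eq_xxxx algebra_simps)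
  moreover have "t \<noteq> 0" using ne by (simp add: t_def)
  ultimately have t3: "t^3 = t + 1" by (simp add: add_eq_0_iff char2 add.assoc)
  have "cuspidal_form (t^2 + t) t = t^3 * (t^3 + t^2 + 1)"
    unfolding cuspidal_form_def by (simp add: eval_nat_numeral algebra_simps char2)
  also have "t^3 + t^2 + 1 = X 2 - X 1" unfolding t3 r by (simp add: char2 ac_simps)
  finally have "cuspidal_form (X 2 - X 1) (X 4 - X 1) \<noteq> 0"
    unfolding r[symmetric] t_def[symmetric] using \<open>t \<noteq> 0\<close> ne by simp
  then show ?thesis using X even ne s by (intro curve_with_character[OF \<psi>, of X s])
qed

end

section \<open>Frobenius on subgroups of order seven\<close>

lemma map_point_point_add:
  assumes "field_hom h"
  shows "map_point h (point_add E P Q) = point_add (map_weierstrass h E) (map_point h P) (map_point h Q)"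
proof (cases P)
  case [simp]: (Affine x1 y1)
  interpret field_hom h by fact
  obtain a1 a2 a3 a4 a6 where [simp]: "E = Weierstrass a1 a2 a3 a4 a6" by (cases E)
  show ?thesis
  proof (cases Q)
    case [simp]: (Affine x2 y2)
    have "- h y1 - h a1 * h x2 - h a3 = h (- y1 - a1 * x2 - a3)" by (simp add: hom_distribs)
    then have "h y2 = - h y1 - h a1 * h x2 - h a3 \<longleftrightarrow> y2 = - y1 - a1 * x2 - a3" by simp
    then show ?thesis by (auto simp: Let_def hom_distribs)
  qed simp
qed (cases E; cases Q; simp)

lemma point_add_self_neq: "point_add E (Affine x y) (Affine x y) \<noteq> Affine x y"
proof
  obtain a1 a2 a3 a4 a6 where E: "E = Weierstrass a1 a2 a3 a4 a6" by (cases E)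
  assume *: "point_add E (Affine x y) (Affine x y) = Affine x y"
  then have "y \<noteq> - y - a1 * x - a3" by (auto simp: E)
  then show False using * by (auto simp: E Let_def)
qed

text \<open>A curve with coefficients in the field of two elements, and a set of seven points over the separable
closure that is closed under addition and Frobenius. The lemmas with \<open>eigenvalue\<close> in their name show which multiplications
cannot be the action of Frobenius on these points.\<close>

locale F2_subgroup = closure_of_F2 emb
  for emb :: "'k::field \<Rightarrow> 'l::field" +
  fixes a1 a2 a3 a4 a6 :: 'l and \<Psi> :: "'l point set"
  assumes coeffs: "a1 \<in> {0, 1}" "a2 \<in> {0, 1}" "a3 \<in> {0, 1}" "a4 \<in> {0, 1}" "a6 \<in> {0, 1}"
    and nonsingular: "discriminant (Weierstrass a1 a2 a3 a4 a6) \<noteq> 0"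
    and on_curve: "P \<in> \<Psi> \<Longrightarrow> on_curve (Weierstrass a1 a2 a3 a4 a6) P"
    and closed: "P \<in> \<Psi> \<Longrightarrow> Q \<in> \<Psi> \<Longrightarrow> point_add (Weierstrass a1 a2 a3 a4 a6) P Q \<in> \<Psi>"
    and Frob_closed: "P \<in> \<Psi> \<Longrightarrow> map_point Frob P \<in> \<Psi>"
    and card_\<Psi>: "card \<Psi> = 7"
begin

abbreviation "E \<equiv> Weierstrass a1 a2 a3 a4 a6"

text \<open>At most two points lie above each abscissa, so that two abscissae account for at most four of the six
affine points.\<close>

lemma exists_point_outside:
  assumes A: "finite A" "card A \<le> 2"
  obtains x y where "Affine x y \<in> \<Psi>" "x \<notin> A"
proof -
  define Y where "Y x = {y. poly [:- (x^3 + a2 * x^2 + a4 * x + a6), a1 * x + a3, 1:] y = 0}" for x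
  have Y: "finite (Y x) \<and> card (Y x) \<le> 2" for x
    using poly_roots_finite[of "[:- (x^3 + a2 * x^2 + a4 * x + a6), a1 * x + a3, 1:]"]
      poly_roots_degree[of "[:- (x^3 + a2 * x^2 + a4 * x + a6), a1 * x + a3, 1:]"]
    unfolding Y_def by simp
  have "\<not> \<Psi> \<subseteq> insert Infinity (\<Union>x\<in>A. Affine x ` Y x)"
  proof
    assume sub: "\<Psi> \<subseteq> insert Infinity (\<Union>x\<in>A. Affine x ` Y x)"
    have "card (\<Union>x\<in>A. Affine x ` Y x) \<le> (\<Sum>x\<in>A. card (Affine x ` Y x))"
      by (rule card_UN_le[OF A(1)])
    also have "\<dots> \<le> (\<Sum>x\<in>A. 2)"
      by (intro sum_mono) (meson Y card_image_le order_trans)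
    also have "\<dots> \<le> 4" using A(2) by simp
    finally have 1: "card (\<Union>x\<in>A. Affine x ` Y x) \<le> 4" .
    have 2: "finite (\<Union>x\<in>A. Affine x ` Y x)" using A(1) Y by blast
    then have "card (insert Infinity (\<Union>x\<in>A. Affine x ` Y x)) \<le> 5"
      using 1 by (simp add: card_insert_if)
    moreover have "7 \<le> card (insert Infinity (\<Union>x\<in>A. Affine x ` Y x))"
      using sub 2 card_\<Psi> by (metis card_mono finite_insert)
    ultimately show False by simp
  qed
  then obtain P where P: "P \<in> \<Psi>" "P \<notin> insert Infinity (\<Union>x\<in>A. Affine x ` Y x)" by blast
  then obtain x y where [simp]: "P = Affine x y" by (cases P) auto
  have "y \<in> Y x" using on_curve[OF P(1)] by (simp add: Y_def power2_eq_square algebra_simps)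
  then have "x \<notin> A" using P(2) by auto
  then show ?thesis using that P(1) by simp
qed

text \<open>If the abscissa of twice a point is \<open>x\<^sup>2\<close>, the duplication formula says that \<open>x\<close> is a root of a polynomial of
degree at most 4. In characteristic 2 and with coefficients 0 and 1, this polynomial is the square of the
quadratic polynomial below.\<close>

lemma double_relation:
  assumes on: "on_curve E (Affine x y)"
    and double: "point_add E (Affine x y) (Affine x y) = Affine (x^2) v"
  shows "(1 + a1) * x^2 + (a1 * a3 + a3) * x + (a1 * a3 * a4 + a1 * a6 + a2 * a3 + a4) = 0"
proof -
  define d where "d = a1 * x + a3"
  define n where "n = x^2 + a4 + a1 * y"
  have d: "d \<noteq> 0"
  proof
    assume "d = 0"
    then have "y = - y - a1 * x - a3" by (simp add: char2 add.assoc d_def)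
    then show False using double by simp
  qed
  then have "y \<noteq> - y - a1 * x - a3" by (simp add: char2 add.assoc d_def)
  then have "x^2 = (n / d)^2 + a1 * (n / d) + a2"
    using double by (simp add: Let_def char2 n_def d_def add.assoc)
  then have "x^2 * d^2 = ((n / d)^2 + a1 * (n / d) + a2) * d^2" by simp
  also have "\<dots> = n^2 + a1 * n * d + a2 * d^2"
    using d by (simp add: field_simps power2_eq_square)
  finally have 1: "x^2 * d^2 = n^2 + a1 * n * d + a2 * d^2" .
  have y2: "y^2 = a1 * x * y + a3 * y + x^3 + a2 * x^2 + a4 * x + a6"
  proof -
    have "y^2 + (a1 * x * y + a3 * y) = x^3 + a2 * x^2 + a4 * x + a6" using on by (simp add: add.assoc)
    then have "y^2 = (x^3 + a2 * x^2 + a4 * x + a6) - (a1 * x * y + a3 * y)" by (simp add: eq_diff_eq)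
    then show ?thesis by (simp add: char2 ac_simps)
  qed
  have "n^2 = x^4 + a4^2 + a1^2 * y^2"
    unfolding n_def square_add by (simp add: power_mult_distrib flip: power_mult)
  then have "n^2 + a1 * n * d + a2 * d^2 + x^2 * d^2 =
     ((1 + a1) * x^2 + (a1 * a3 + a3) * x + (a1 * a3 * a4 + a1 * a6 + a2 * a3 + a4))^2"
    unfolding square_add power_mult_distrib y2 n_def d_def
    using coeffs
    by (elim insertE emptyE) (simp_all add: square_add power_mult_distrib char2 eval_nat_numeral algebra_simps)
  moreover have "n^2 + a1 * n * d + a2 * d^2 + x^2 * d^2 = 0" unfolding 1 by (rule char2)
  ultimately show ?thesis by simp
qed

text \<open>If the quadratic polynomial vanished identically, then \<open>b\<^sub>2 = 1\<close>, \<open>b\<^sub>4 = b\<^sub>6\<close>, \<open>b\<^sub>8 = 0\<close>, and the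
discriminant \<open>b\<^sub>2\<^sup>2 b\<^sub>8 + b\<^sub>6\<^sup>2 + b\<^sub>2 b\<^sub>4 b\<^sub>6\<close> would be zero.\<close>

lemma relation_nontrivial:
  "1 + a1 \<noteq> 0 \<or> a1 * a3 + a3 \<noteq> 0 \<or> a1 * a3 * a4 + a1 * a6 + a2 * a3 + a4 \<noteq> 0"
  using nonsingular coeffs
  by (elim insertE emptyE) (simp_all add: Let_def char2)

text \<open>The six affine points have at least three abscissae, too many for a nonzero quadratic polynomial.\<close>

lemma not_all_doubled:
  assumes "\<And>x y. Affine x y \<in> \<Psi> \<Longrightarrow> \<exists>v. point_add E (Affine x y) (Affine x y) = Affine (x^2) v"
  shows False
proof -
  define p where "p = [:a1 * a3 * a4 + a1 * a6 + a2 * a3 + a4, a1 * a3 + a3, 1 + a1:]"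
  have "p \<noteq> 0" using relation_nontrivial by (auto simp: p_def)
  moreover have "degree p \<le> 2" by (simp add: p_def)
  ultimately have fin: "finite {x. poly p x = 0}" and le: "card {x. poly p x = 0} \<le> 2"
    using poly_roots_finite[of p] poly_roots_degree[of p] by auto
  obtain x y where xy: "Affine x y \<in> \<Psi>" "x \<notin> {x. poly p x = 0}"
    using exists_point_outside[OF fin le] .
  obtain v where "point_add E (Affine x y) (Affine x y) = Affine (x^2) v" using assms[OF xy(1)] ..
  from double_relation[OF on_curve[OF xy(1)] this] have "poly p x = 0"
    by (simp add: p_def power2_eq_square algebra_simps)
  then show False using xy(2) by simp
qed

lemma Frob_power: "(Frob ^^ n) x = x ^ (2 ^ n)"
  by (induction n) (simp_all add: Frob_def power_mult[symmetric] mult.commute)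

lemma map_Frob_power_add:
  "map_point (Frob ^^ n) (point_add E P Q) = point_add E (map_point (Frob ^^ n) P) (map_point (Frob ^^ n) Q)"
proof -
  interpret field_hom "Frob ^^ n" using Frob_power_in_Gal by (rule Gal_field_hom)
  have "map_weierstrass (Frob ^^ n) E = E" using coeffs by auto
  then show ?thesis using map_point_point_add[OF field_hom_axioms, of E P Q] by simp
qed

lemma Frob_power_closed: "P \<in> \<Psi> \<Longrightarrow> map_point (Frob ^^ n) P \<in> \<Psi>"
proof (induction n)
  case 0
  then show ?case by (simp add: point.map_id0 flip: id_def)
next
  case (Suc n)
  have "map_point (Frob ^^ Suc n) P = map_point Frob (map_point (Frob ^^ n) P)"
    unfolding funpow.simps by (rule point.map_comp[symmetric])
  then show ?case unfolding \<open>map_point (Frob ^^ Suc n) P = _\<close> by (intro Frob_closed Suc)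
qed

text \<open>The affine points would have only the abscissae 0 and 1.\<close>

lemma eigenvalue_neq_1:
  assumes "\<And>P. P \<in> \<Psi> \<Longrightarrow> map_point Frob P = P"
  shows False
proof -
  obtain x y where xy: "Affine x y \<in> \<Psi>" "x \<notin> {0, 1}"
    using exists_point_outside[of "{0, 1}"] by auto
  then show False using assms[OF xy(1)] idempotent_in_base[of x] by (auto simp: Frob_def)
qed

lemma eigenvalue_neq_2:
  assumes "\<And>P. P \<in> \<Psi> \<Longrightarrow> map_point Frob P = point_add E P P"
  shows False
  using assms by (intro not_all_doubled) (metis Frob_def point.simps(9))

lemma add_affine:
  assumes "x \<noteq> x'"
  obtains u v where "point_add E (Affine x y) (Affine x' y') = Affine u v"
  using assms by (simp add: Let_def)

text \<open>A root of a nonzero polynomial of degree at most 2 over the field of two elements lies in the field of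
four elements.\<close>

lemma root_of_relation:
  assumes "(1 + a1) * u^2 + (a1 * a3 + a3) * u + (a1 * a3 * a4 + a1 * a6 + a2 * a3 + a4) = 0"
  shows "u^4 = (u::'l)"
proof -
  define \<alpha> where "\<alpha> = 1 + a1"
  define \<beta> where "\<beta> = a1 * a3 + a3"
  define \<gamma> where "\<gamma> = a1 * a3 * a4 + a1 * a6 + a2 * a3 + a4"
  have in01: "x + y \<in> {0, 1}" "x * y \<in> {0, 1}" if "x \<in> {0, 1}" "y \<in> {0, 1::'l}" for x y
    using that by (auto simp: char2)
  have "\<alpha> \<in> {0, 1}" "\<beta> \<in> {0, 1}" "\<gamma> \<in> {0, 1}"
    unfolding \<alpha>_def \<beta>_def \<gamma>_def by (intro in01 coeffs insertI1 insertI2)+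
  moreover have "\<alpha> * u^2 + \<beta> * u + \<gamma> = 0" "\<alpha> \<noteq> 0 \<or> \<beta> \<noteq> 0 \<or> \<gamma> \<noteq> 0"
    using assms relation_nontrivial unfolding \<alpha>_def \<beta>_def \<gamma>_def by blast+
  moreover have "u^4 = (u^2)^2" by (simp flip: power_mult)
  moreover have "u = 0" if "u^2 = 0" using that by simp
  moreover have "u = 1" if "u^2 + 1 = 0"
  proof -
    have "(u + 1)^2 = 0" using that by (simp add: square_add)
    then have "u + 1 = 0" by simp
    then show ?thesis by (simp add: add_eq_0_iff2 char2)
  qed
  moreover have "u^4 = u" if "u^2 + u = 0"
  proof -
    have "u^2 = u" using that by (simp add: add_eq_0_iff2 char2)
    then show ?thesis using \<open>u^4 = (u^2)^2\<close> by simp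
  qed
  moreover have "u^4 = u" if "u^2 + u + 1 = 0"
  proof -
    have "u^2 = u + 1" using that by (simp add: add_eq_0_iff2 char2 add.assoc)
    then have "u^4 = (u + 1) + 1" using \<open>u^4 = (u^2)^2\<close> by (simp add: square_add)
    then show ?thesis by (simp add: char2 add.assoc)
  qed
  moreover have "u = 1" if "u + 1 = 0" using that by (simp add: add_eq_0_iff2 char2)
  ultimately show ?thesis by (elim insertE emptyE) auto
qed

text \<open>An eigenvalue 5 of Frobenius means that its third power is \<open>- 1\<close> and its fourth power is 2. The first
of these is recovered from the addition formulas. If the abscissa of \<open>P\<close> is not in the field of
eight elements, then \<open>R = P + F\<^sup>3 P\<close> is an affine point fixed by \<open>F\<^sup>3\<close> and satisfies \<open>F R = 2 R\<close>. Its
abscissa then lies in the fields of four and of eight elements, and so does its ordinate by the equation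
of the curve. So \<open>R\<close> is rational and \<open>R = F R = 2 R\<close>, which is impossible. Hence \<open>x\<^sup>8 = x\<close>, and \<open>F\<^sup>4 P = 2 P\<close> has abscissa \<open>x\<^sup>1\<^sup>6 = x\<^sup>2\<close>.\<close>

lemma eigenvalue_neq_5:
  assumes F4: "\<And>P. P \<in> \<Psi> \<Longrightarrow> map_point (Frob ^^ 4) P = point_add E P P"
    and F6: "\<And>P. P \<in> \<Psi> \<Longrightarrow> map_point (Frob ^^ 6) P = P"
  shows False
proof (rule not_all_doubled)
  fix x y assume xy: "Affine x y \<in> \<Psi>"
  have "x^8 = x"
  proof (rule ccontr)
    assume ne: "x^8 \<noteq> x"
    define P where "P = Affine x y"
    define P3 where "P3 = map_point (Frob ^^ 3) P"
    have P3: "P3 = Affine (x^8) (y^8)" by (simp add: P3_def P_def Frob_power)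
    have "P3 \<in> \<Psi>" unfolding P3_def P_def by (intro Frob_power_closed xy)
    obtain u v where uv: "point_add E P P3 = Affine u v"
      using add_affine[of x "x^8"] ne unfolding P_def P3 by metis
    have R: "Affine u v \<in> \<Psi>" using closed[OF xy \<open>P3 \<in> \<Psi>\<close>] uv by (simp add: P_def)
    have "map_point (Frob ^^ 3) P3 = P"
    proof -
      have "map_point (Frob ^^ 3) P3 = map_point (Frob ^^ 6) P"
        by (simp add: P3_def P_def Frob_power flip: power_mult)
      then show ?thesis using F6[OF xy] by (simp add: P_def)
    qed
    then have "map_point (Frob ^^ 3) (Affine u v) = point_add E P3 P"
      unfolding uv[symmetric] map_Frob_power_add by (simp add: P3_def)
    also have "\<dots> = Affine u v"
      using point_add_commute[OF on_curve[OF \<open>P3 \<in> \<Psi>\<close>] on_curve[OF xy]] uv by (simp add: P_def)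
    finally have u8: "u^8 = u" and v8: "v^8 = v" by (simp_all add: Frob_power)
    have "u^16 = (u^8)^2" "v^16 = (v^8)^2" by (simp_all flip: power_mult)
    then have double: "point_add E (Affine u v) (Affine u v) = Affine (u^2) (v^2)"
      using F4[OF R] u8 v8 by (simp add: Frob_power)
    have "u^4 = u" by (rule root_of_relation[OF double_relation[OF on_curve[OF R] double]])
    moreover have "u^8 = (u^4)^2" by (simp flip: power_mult)
    ultimately have u2: "u^2 = u" using u8 by simp
    have u: "u \<in> {0, 1}" using idempotent_in_base[OF u2] by simp
    have "v^4 = v^2 \<or> v^4 = v"
    proof -
      define c where "c = a1 * u + a3"
      define f where "f = u^3 + a2 * u^2 + a4 * u + a6"
      have "c \<in> {0, 1}" "f \<in> {0, 1}"
        using coeffs u unfolding c_def f_def by (auto simp: char2)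
      moreover have "v^2 + c * v = f" using on_curve[OF R] by (simp add: c_def f_def algebra_simps)
      moreover have "v^4 = v^2" if "v^2 = f" "f^2 = f"
      proof -
        have "v^4 = (v^2)^2" by (simp flip: power_mult)
        then show ?thesis using that by simp
      qed
      moreover have "v^4 = v" if "v^2 + v = f" "f^2 = f"
      proof -
        have v2: "v^2 = f + v" using that(1) by (simp add: eq_diff_eq[symmetric] char2)
        have "v^4 = (v^2)^2" by (simp flip: power_mult)
        also have "\<dots> = f^2 + v^2" by (simp only: v2 square_add)
        also have "\<dots> = f + (f + v)" by (simp only: v2 that(2))
        finally show ?thesis by (simp only: char2)
      qed
      ultimately show ?thesis by (elim insertE emptyE) auto
    qed
    moreover have "v^8 = (v^4)^2" "v^4 = (v^2)^2" by (simp_all flip: power_mult)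
    ultimately have "v^8 = v^2" by metis
    then have "v^2 = v" using v8 by simp
    then show False using double u2 point_add_self_neq[of E u v] by simp
  qed
  moreover have "x^16 = (x^8)^2" by (simp flip: power_mult)
  ultimately have "x^16 = x^2" by simp
  then show "\<exists>v. point_add E (Affine x y) (Affine x y) = Affine (x^2) v"
    unfolding F4[OF xy, symmetric] by (simp add: Frob_power)
qed

text \<open>The sixth multiple of a rational point is the point itself only if it is 5-torsion, and the curves with
such a point are those with five rational points. They are found by running through the coefficients.\<close>

lemma rational_5_torsion:
  assumes "u \<in> {0, 1}" "v \<in> {0, 1}" and on: "on_curve E (Affine u v)"
    and "R = Affine u v"
    and six: "point_add E (point_add E (point_add E (point_add E (point_add E R R) R) R) R) R = R"
  shows "a1 = 0 \<and> a3 = 1 \<and> a6 = 0 \<and> a2 + a4 = 1"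
  using coeffs assms(1,2) on nonsingular six unfolding assms(4)
  by (elim insertE emptyE) (simp_all add: Let_def char2)

text \<open>For a point \<open>P\<close> with abscissa outside \<open>{0, 1}\<close> the sum \<open>R = P + F P\<close> is an affine rational point with
\<open>R = 6 R\<close>, so that the curve is \<open>y\<^sup>2 + y = x\<^sup>3 + x\<^sup>2\<close> or \<open>y\<^sup>2 + y = x\<^sup>3 + x\<close>. These curves have no point over
the field of four elements with such an abscissa.\<close>

lemma eigenvalue_neq_6:
  assumes F1: "\<And>P. P \<in> \<Psi> \<Longrightarrow> map_point Frob P =
      point_add E (point_add E (point_add E (point_add E (point_add E P P) P) P) P) P"
    and F2: "\<And>P. P \<in> \<Psi> \<Longrightarrow> map_point (Frob ^^ 2) P = P"
  shows False
proof -
  obtain x y where xy: "Affine x y \<in> \<Psi>" "x \<notin> {0, 1}"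
    using exists_point_outside[of "{0, 1}"] by auto
  have x4: "x^4 = x" and y4: "y^4 = y" using F2[OF xy(1)] by (simp_all add: Frob_power)
  have ne: "x \<noteq> x^2" using idempotent_in_base[of x] xy(2) by auto
  define P where "P = Affine x y"
  define P' where "P' = map_point Frob P"
  have P': "P' = Affine (x^2) (y^2)" by (simp add: P'_def P_def Frob_def)
  have "P' \<in> \<Psi>" unfolding P'_def P_def by (rule Frob_closed[OF xy(1)])
  obtain u v where uv: "point_add E P P' = Affine u v"
    using add_affine[OF ne] unfolding P_def P' by metis
  have R: "Affine u v \<in> \<Psi>" using closed[OF xy(1) \<open>P' \<in> \<Psi>\<close>] uv by (simp add: P_def)
  have "map_point Frob P' = P"
    by (simp add: P' P_def Frob_def x4 y4 flip: power_mult)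
  then have "map_point Frob (Affine u v) = point_add E P' P"
    using map_Frob_power_add[of 1 P P'] uv by (simp add: P'_def)
  also have "\<dots> = Affine u v"
    using point_add_commute[OF on_curve[OF \<open>P' \<in> \<Psi>\<close>] on_curve[OF xy(1)]] uv by (simp add: P_def)
  finally have fixed: "map_point Frob (Affine u v) = Affine u v" .
  then have "u \<in> {0, 1}" "v \<in> {0, 1}" using idempotent_in_base by (auto simp: Frob_def)
  then have curve: "a1 = 0 \<and> a3 = 1 \<and> a6 = 0 \<and> a2 + a4 = 1"
    using on_curve[OF R] refl F1[OF R, unfolded fixed, symmetric] by (rule rational_5_torsion)
  have "x * (x^3 - 1) = 0" using x4 by (simp add: eval_nat_numeral algebra_simps)
  then have x3: "x^3 = 1" using xy(2) by auto
  have on: "y^2 + y = 1 + a2 * x^2 + a4 * x" using on_curve[OF xy(1)] curve x3 by simp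
  have "(y^2 + y)^2 = y^2 + y" by (simp add: square_add y4 add.commute flip: power_mult)
  from idempotent_in_base[OF this] have "1 + a2 * x^2 + a4 * x \<in> {0, 1}" unfolding on by simp
  moreover have "a2 = 1 \<and> a4 = 0 \<or> a2 = 0 \<and> a4 = 1" using curve coeffs by (auto simp: char2)
  ultimately have "x^2 \<in> {0, 1} \<or> x \<in> {0, 1}" by (auto simp: add_eq_0_iff2 char2)
  then show False using xy(2) by (auto simp: power2_eq_1_iff char2)
qed

end

lemma curve_group_pow:
  "P [^]\<^bsub>curve_group E\<^esub> (1::int) = P"
  "P [^]\<^bsub>curve_group E\<^esub> (2::int) = point_add E P P"
  "P [^]\<^bsub>curve_group E\<^esub> (6::int) =
     point_add E (point_add E (point_add E (point_add E (point_add E P P) P) P) P) P"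
proof -
  have pow: "P [^]\<^bsub>curve_group E\<^esub> (0::nat) = Infinity"
    "P [^]\<^bsub>curve_group E\<^esub> Suc n = point_add E (P [^]\<^bsub>curve_group E\<^esub> n) P" for n
    by (simp_all add: nat_pow_def curve_group_def)
  have num: "(1::int) = int (Suc 0)" "(2::int) = int (Suc (Suc 0))"
    "(6::int) = int (Suc (Suc (Suc (Suc (Suc (Suc 0))))))" by simp_all
  show "P [^]\<^bsub>curve_group E\<^esub> (1::int) = P"
    "P [^]\<^bsub>curve_group E\<^esub> (2::int) = point_add E P P"
    "P [^]\<^bsub>curve_group E\<^esub> (6::int) =
     point_add E (point_add E (point_add E (point_add E (point_add E P P) P) P) P) P"
    unfolding num int_pow_int pow point_add.simps(1) by (rule refl)+
qed

context closure_of_F2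
begin

lemma character_Frob_power:
  assumes \<psi>: "\<psi> \<in> carrier (character_group emb)"
  shows "\<psi> (Frob ^^ n) = \<psi> Frob ^ n mod 7"
proof (induction n)
  case 0
  show ?case unfolding funpow.simps character_id[OF \<psi>] by simp
next
  case (Suc n)
  show ?case unfolding funpow.simps character_comp[OF \<psi> Frob_Gal Frob_power_in_Gal] Suc
    by (simp add: mod_simps)
qed

text \<open>An eigenvalue of Frobenius on a subgroup of order 7 is a root of \<open>X\<^sup>2 - t X + 2\<close> modulo 7 for some \<open>t\<close> with
\<open>\<bar>t\<bar> \<le> 2\<close>. Such roots exist only for \<open>t = 1\<close> and \<open>t = - 1\<close>, and they are 4 and 3. The lemmas above
rule out the other four residues.\<close>

lemma Frob_eigenvalue:
  assumes \<psi>: "\<psi> \<in> carrier (character_group emb)"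
    and E0: "elliptic_curve E0" and sub: "rational_subgroup emb E0 \<Psi>" and card: "card \<Psi> = 7"
    and acts: "acts_via emb E0 \<Psi> \<psi>"
  shows "\<psi> Frob \<in> {3, 4}"
proof -
  obtain b1 b2 b3 b4 b6 where b: "E0 = Weierstrass b1 b2 b3 b4 b6" by (cases E0)
  define E where "E = map_weierstrass emb E0"
  have E: "E = Weierstrass (emb b1) (emb b2) (emb b3) (emb b4) (emb b6)" by (simp add: E_def b)
  have subgroup: "subgroup \<Psi> (curve_group E)"
    and stable: "\<And>\<sigma> P. \<sigma> \<in> Gal \<Longrightarrow> P \<in> \<Psi> \<Longrightarrow> map_point \<sigma> P \<in> \<Psi>"
    using sub unfolding rational_subgroup_def E_def by blast+
  interpret S: F2_subgroup emb "emb b1" "emb b2" "emb b3" "emb b4" "emb b6" \<Psi>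
  proof
    show "emb b1 \<in> {0, 1}" "emb b2 \<in> {0, 1}" "emb b3 \<in> {0, 1}" "emb b4 \<in> {0, 1}" "emb b6 \<in> {0, 1}"
      using emb_cases by blast+
    show "discriminant (Weierstrass (emb b1) (emb b2) (emb b3) (emb b4) (emb b6)) \<noteq> 0"
      using E0 unfolding E[symmetric] E_def discriminant_map_weierstrass[OF emb.field_hom_axioms]
      by (simp add: elliptic_curve_def)
    show "on_curve (Weierstrass (emb b1) (emb b2) (emb b3) (emb b4) (emb b6)) P" if "P \<in> \<Psi>" for P
      using subgroup.mem_carrier[OF subgroup that] unfolding E[symmetric] by (simp add: curve_group_def)
    show "point_add (Weierstrass (emb b1) (emb b2) (emb b3) (emb b4) (emb b6)) P Q \<in> \<Psi>"
      if "P \<in> \<Psi>" "Q \<in> \<Psi>" for P Q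
      using subgroup.m_closed[OF subgroup that] unfolding E[symmetric] by (simp add: curve_group_def)
  qed (use stable Frob_Gal card in blast)+
  have act: "map_point (Frob ^^ n) P = P [^]\<^bsub>curve_group E\<^esub> (\<psi> Frob ^ n mod 7)" if "P \<in> \<Psi>" for n P
    using acts Frob_power_in_Gal[of n] that
    unfolding acts_via_def E_def character_Frob_power[OF \<psi>, symmetric] by blast
  have act1: "map_point Frob P = P [^]\<^bsub>curve_group E\<^esub> \<psi> Frob" if "P \<in> \<Psi>" for P
    using acts Frob_Gal that unfolding acts_via_def E_def by blast
  note pow = curve_group_pow[where E = E]
  have "\<psi> Frob \<noteq> 1"
    using S.eigenvalue_neq_1 act1 pow(1) by metis
  moreover have "\<psi> Frob \<noteq> 2"
    using S.eigenvalue_neq_2 act1 pow(2) unfolding E by metis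
  moreover have "\<psi> Frob \<noteq> 5"
  proof
    assume 5: "\<psi> Frob = 5"
    show False
    proof (rule S.eigenvalue_neq_5)
      fix P assume P: "P \<in> \<Psi>"
      show "map_point (Frob ^^ 4) P = point_add S.E P P"
        using act[OF P, of 4] pow(2)[of P] unfolding E 5 by simp
      show "map_point (Frob ^^ 6) P = P"
        using act[OF P, of 6] pow(1)[of P] unfolding E 5 by simp
    qed
  qed
  moreover have "\<psi> Frob \<noteq> 6"
  proof
    assume 6: "\<psi> Frob = 6"
    show False
    proof (rule S.eigenvalue_neq_6)
      fix P assume P: "P \<in> \<Psi>"
      show "map_point Frob P = point_add S.E (point_add S.E (point_add S.E (point_add S.E (point_add S.E P P) P) P) P) P"
        using act1[OF P] pow(3)[of P] unfolding E 6 by (rule trans)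
      show "map_point (Frob ^^ 2) P = P"
        using act[OF P, of 2] pow(1)[of P] unfolding E 6 by simp
    qed
  qed
  ultimately show ?thesis using character_cases[OF \<psi> Frob_Gal] by blast
qed

lemma exists_curve_iff:
  assumes \<psi>: "\<psi> \<in> carrier (character_group emb)" and \<epsilon>: "\<epsilon> \<in> carrier (character_group emb)" "\<epsilon> Frob = 6"
  shows "(\<exists>E \<Psi>. elliptic_curve E \<and> rational_subgroup emb E \<Psi> \<and> card \<Psi> = 7 \<and> acts_via emb E \<Psi> \<psi>) \<longleftrightarrow>
     \<psi> = inv\<^bsub>character_group emb\<^esub> cyclotomic_character emb \<or>
     \<psi> = inv\<^bsub>character_group emb\<^esub> cyclotomic_character emb \<otimes>\<^bsub>character_group emb\<^esub> \<epsilon>"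
proof -
  interpret C: comm_group "character_group emb" by (rule comm_group_character_group)
  define \<omega> where "\<omega> = inv\<^bsub>character_group emb\<^esub> cyclotomic_character emb"
  have \<omega>: "\<omega> \<in> carrier (character_group emb)"
    unfolding \<omega>_def using cyclotomic_character_F2(1) by (rule C.inv_closed)
  have "\<omega> \<otimes>\<^bsub>character_group emb\<^esub> cyclotomic_character emb = \<one>\<^bsub>character_group emb\<^esub>"
    unfolding \<omega>_def using cyclotomic_character_F2(1) by (rule C.l_inv)
  then have "\<omega> Frob * 2 mod 7 = 1"
    using character_mult_apply[OF Frob_Gal, of \<omega> "cyclotomic_character emb"]
      character_one_apply[OF Frob_Gal] cyclotomic_character_F2(2) by simp
  then have \<omega>4: "\<omega> Frob = 4"
    using character_cases[OF \<omega> Frob_Gal] by (elim insertE emptyE) simp_all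
  have \<omega>\<epsilon>: "\<omega> \<otimes>\<^bsub>character_group emb\<^esub> \<epsilon> \<in> carrier (character_group emb)"
    "(\<omega> \<otimes>\<^bsub>character_group emb\<^esub> \<epsilon>) Frob = 3"
    using \<omega> \<epsilon> C.m_closed by (simp_all add: character_mult_apply[OF Frob_Gal] \<omega>4)
  have "\<psi> = \<omega> \<longleftrightarrow> \<psi> Frob = 4" using character_eq_if_eq_at_Frob[OF \<psi> \<omega>] \<omega>4 by auto
  moreover have "\<psi> = \<omega> \<otimes>\<^bsub>character_group emb\<^esub> \<epsilon> \<longleftrightarrow> \<psi> Frob = 3"
    using character_eq_if_eq_at_Frob[OF \<psi> \<omega>\<epsilon>(1)] \<omega>\<epsilon>(2) by auto
  moreover have "(\<exists>E \<Psi>. elliptic_curve E \<and> rational_subgroup emb E \<Psi> \<and> card \<Psi> = 7 \<and> acts_via emb E \<Psi> \<psi>)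
      \<longleftrightarrow> \<psi> Frob \<in> {3, 4}"
    using exists_curve_with_character_F2[OF \<psi>] Frob_eigenvalue[OF \<psi>] by blast
  ultimately show ?thesis unfolding \<omega>_def[symmetric] by blast
qed

end

theorem corollary3p12:
  fixes emb :: "'k::field \<Rightarrow> 'ks::field"
    and \<psi> :: "('ks \<Rightarrow> 'ks) \<Rightarrow> int"
  assumes "CHAR('k) \<noteq> 7"
    and "separable_closure emb"
    and "\<psi> \<in> carrier (character_group emb)"
  shows "(CARD('k) \<noteq> 2 \<longrightarrow>
            (\<exists>E \<Psi>. elliptic_curve E \<and> rational_subgroup emb E \<Psi> \<and> card \<Psi> = 7 \<and>
                   acts_via emb E \<Psi> \<psi>)) \<and>
         (CARD('k) = 2 \<longrightarrow>
            (\<exists>\<epsilon>. {\<chi> \<in> carrier (character_group emb). group.ord (character_group emb) \<chi> = 2} = {\<epsilon>} \<and>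
              ((\<exists>E \<Psi>. elliptic_curve E \<and> rational_subgroup emb E \<Psi> \<and> card \<Psi> = 7 \<and>
                      acts_via emb E \<Psi> \<psi>) \<longleftrightarrow>
               \<psi> = inv\<^bsub>character_group emb\<^esub> cyclotomic_character emb \<or>
               \<psi> = inv\<^bsub>character_group emb\<^esub> cyclotomic_character emb
                     \<otimes>\<^bsub>character_group emb\<^esub> \<epsilon>)))"
proof (intro conjI impI)
  interpret separably_closed_extension emb by unfold_locales fact
  show "\<exists>E \<Psi>. elliptic_curve E \<and> rational_subgroup emb E \<Psi> \<and> card \<Psi> = 7 \<and> acts_via emb E \<Psi> \<psi>"
    if "CARD('k) \<noteq> 2"
    using exists_curve_with_character[OF assms(3) that] .
next
  assume "CARD('k) = 2"
  then interpret closure_of_F2 emb using assms(2) by unfold_locales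
  obtain \<epsilon> where \<epsilon>: "\<epsilon> \<in> carrier (character_group emb)" "\<epsilon> Frob = 6"
    by (rule quadratic_character)
  have "{\<chi> \<in> carrier (character_group emb). group.ord (character_group emb) \<chi> = 2} = {\<epsilon>}"
  proof (intro equalityI subsetI)
    fix \<chi> assume "\<chi> \<in> {\<chi> \<in> carrier (character_group emb). group.ord (character_group emb) \<chi> = 2}"
    then have \<chi>: "\<chi> \<in> carrier (character_group emb)" "group.ord (character_group emb) \<chi> = 2" by blast+
    then have "\<chi> Frob = \<epsilon> Frob" using character_order_2_iff[OF \<chi>(1)] \<epsilon>(2) by simp
    then show "\<chi> \<in> {\<epsilon>}" using character_eq_if_eq_at_Frob[OF \<chi>(1) \<epsilon>(1)] by blast
  next
    fix \<chi> assume "\<chi> \<in> {\<epsilon>}"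
    then show "\<chi> \<in> {\<chi> \<in> carrier (character_group emb). group.ord (character_group emb) \<chi> = 2}"
      using character_order_2_iff[OF \<epsilon>(1)] \<epsilon> by blast
  qed
  then show "\<exists>\<epsilon>. {\<chi> \<in> carrier (character_group emb). group.ord (character_group emb) \<chi> = 2} = {\<epsilon>} \<and>
      ((\<exists>E \<Psi>. elliptic_curve E \<and> rational_subgroup emb E \<Psi> \<and> card \<Psi> = 7 \<and> acts_via emb E \<Psi> \<psi>) \<longleftrightarrow>
       \<psi> = inv\<^bsub>character_group emb\<^esub> cyclotomic_character emb \<or>
       \<psi> = inv\<^bsub>character_group emb\<^esub> cyclotomic_character emb \<otimes>\<^bsub>character_group emb\<^esub> \<epsilon>)"
    using exists_curve_iff[OF assms(3) \<epsilon>] by blast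
qed

end
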